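(* For every $\delta>0$ there exists a continuous function $H:\mathbb{R}^2\to\mathbb{R}$ satisfying $1<N_H<1+\delta$ and $H(z)-1=o(|z|^{-1})$ as $|z|\to\infty$, for which the functional $E_H$ admits a Palais-Smale sequence $(u_n)_n\subset H^1(\mathbb{S}^1,\mathbb{R}^2)$ such that $L(u_n)\to\infty$.
   Context: Complex notation: $iz=(-y,x)$ for $z=(x,y)\in\mathbb{R}^2$. Functions on $\mathbb{S}^1$ are identified with $2\pi$-periodic functions of $\theta$; $'$ is the derivative in $\theta$; the barred integral $\frac{1}{2\pi}\int_0^{2\pi}$ is the average over $\mathbb{S}^1$. Write $H^1_{\rm per}=H^1(\mathbb{S}^1,\mathbb{R}^2)$, $H^{-1}_{\rm per}$ for its dual; constant functions are identified with points of $\mathbb{R}^2$. $N_H$: for $H\in L^1_{\rm loc}(\mathbb{R}^2)$ the distribution $\mathrm{dl}H$ (representing $\nabla H(z)\cdot z$) is $\langle \mathrm{dl}H,\varphi\rangle=-\int_{\mathbb{R}^2}H(z)\,\mathrm{div}(\varphi(z)z)\,dz$, $\varphi\in C_c^\infty(\mathbb{R}^2)$. If it is represented by an $L^2$ function, $N_H:=\frac{1}{\sqrt{4\pi}}\|\mathrm{dl}H\|_{L^2(\mathbb{R}^2)}$; otherwise $N_H=\infty$. Energy: $L(u)=\big(\frac{1}{2\pi}\int_0^{2\pi}|u'|^2d\theta\big)^{1/2}$, and for $K\in L^2_{\rm loc}(\mathbb{R}^2)$, $A_K(u)=\frac{1}{2\pi}\int_{\mathbb{R}^2}K(z)j_u(z)\,dz$,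 where $j_u(z)=\frac{1}{2\pi}\int_0^{2\pi}\frac{u-z}{|u-z|^2}\cdot iu'\,d\theta$ for $z\notin u(\mathbb{S}^1)$. (If $K$ is smooth and $Q\in C^1(\mathbb{R}^2,\mathbb{R}^2)$ satisfies $\mathrm{div}\,Q=K$, then $A_K(u)=\frac{1}{2\pi}\int_0^{2\pi}Q(u)\cdot iu'\,d\theta$.) For continuous $H$, $E_H(u)=L(u)+A_H(u)$ on $H^1_{\rm per}$; it is of class $C^1$ on $H^1_{\rm per}\setminus\mathbb{R}^2$ with $$dE_H(u)\varphi=\frac{1}{L(u)}\frac{1}{2\pi}\int_0^{2\pi}u'\cdot\varphi'\,d\theta+\frac{1}{2\pi}\int_0^{2\pi}H(u)\,\varphi\cdot iu'\,d\theta.$$ A Palais-Smale sequence for $E_H$ (at a level $c\in\mathbb{R}$) is a sequence $u_n\in H^1_{\rm per}\setminus\mathbb{R}^2$ with $E_H(u_n)\to c$ and $dE_H(u_n)\to0$ in $H^{-1}_{\rm per}$. *)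

theory Defs
  imports "HOL-Analysis.Analysis" "HOL-Library.Landau_Symbols"
begin

text \<open>
  The plane is the type \<^typ>\<open>complex\<close> with its Euclidean structure over the reals: \<open>x \<bullet> y\<close> is the
  Euclidean inner product, \<open>\<i> * z\<close> is the rotation \<open>(-y, x)\<close> of \<open>z = (x, y)\<close>, and
  \<^term>\<open>lebesgue\<close> is two-dimensional Lebesgue measure.  Differentiability is always real
  (Frechet) differentiability.
\<close>


subsection \<open>Smooth functions and square integrability\<close>

primrec C_k :: "nat \<Rightarrow> ('a::euclidean_space \<Rightarrow> real) \<Rightarrow> bool" where
  "C_k 0 f \<longleftrightarrow> continuous_on UNIV f"
| "C_k (Suc k) f \<longleftrightarrow>
     (\<forall>x. f differentiable (at x)) \<and>
     (\<forall>b\<in>Basis. C_k k (\<lambda>x. frechet_derivative f (at x) b))"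

definition smooth :: "('a::euclidean_space \<Rightarrow> real) \<Rightarrow> bool" where
  "smooth f \<longleftrightarrow> (\<forall>k. C_k k f)"

definition test_function :: "('a::euclidean_space \<Rightarrow> real) \<Rightarrow> bool" where
  "test_function \<phi> \<longleftrightarrow> smooth \<phi> \<and> compact (closure {x. \<phi> x \<noteq> 0})"

definition divergence :: "('a::euclidean_space \<Rightarrow> 'a) \<Rightarrow> 'a \<Rightarrow> real" where
  "divergence F x = (\<Sum>b\<in>Basis. frechet_derivative F (at x) b \<bullet> b)"

definition square_integrable :: "'a measure \<Rightarrow> ('a \<Rightarrow> 'b::{banach, second_countable_topology}) \<Rightarrow> bool" where
  "square_integrable M f \<longleftrightarrow> f \<in> borel_measurable M \<and> integrable M (\<lambda>x. (norm (f x))\<^sup>2)"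


subsection \<open>The quantity N\<open>\<^sub>H\<close>\<close>

definition dl :: "(complex \<Rightarrow> real) \<Rightarrow> (complex \<Rightarrow> real) \<Rightarrow> real" where
  "dl H \<phi> = - (LINT z|lebesgue. H z * divergence (\<lambda>w. \<phi> w *\<^sub>R w) z)"

definition dl_represented_by :: "(complex \<Rightarrow> real) \<Rightarrow> (complex \<Rightarrow> real) \<Rightarrow> bool" where
  "dl_represented_by H g \<longleftrightarrow>
     square_integrable lebesgue g \<and>
     (\<forall>\<phi>. test_function \<phi> \<longrightarrow> dl H \<phi> = (LINT z|lebesgue. g z * \<phi> z))"

text \<open>The representing function is unique almost everywhere, so its norm does not depend on the choice.\<close>

definition N_H :: "(complex \<Rightarrow> real) \<Rightarrow> ereal" where
  "N_H H =
     (if \<exists>g. dl_represented_by H g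
      then ereal (1 / sqrt (4 * pi) *
             sqrt (LINT z|lebesgue. ((SOME g. dl_represented_by H g) z)\<^sup>2))
      else \<infinity>)"


subsection \<open>The Sobolev space of closed curves\<close>

definition avg :: "(real \<Rightarrow> 'a::{banach, second_countable_topology}) \<Rightarrow> 'a" where
  "avg f = (1 / (2 * pi)) *\<^sub>R (LINT t|lebesgue_on {0..2 * pi}. f t)"

definition periodic :: "(real \<Rightarrow> 'a) \<Rightarrow> bool" where
  "periodic f \<longleftrightarrow> (\<forall>t. f (t + 2 * pi) = f t)"

definition weak_deriv_of :: "(real \<Rightarrow> complex) \<Rightarrow> (real \<Rightarrow> complex) \<Rightarrow> bool" where
  "weak_deriv_of u g \<longleftrightarrow>
     square_integrable (lebesgue_on {0..2 * pi}) g \<and>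
     (\<forall>\<phi>. smooth \<phi> \<and> periodic \<phi> \<longrightarrow>
        avg (\<lambda>t. deriv \<phi> t *\<^sub>R u t) = - avg (\<lambda>t. \<phi> t *\<^sub>R g t))"

text \<open>Elements of the Sobolev space are represented by their continuous representatives, so no
  almost-everywhere identification is needed.\<close>

definition H1_per :: "(real \<Rightarrow> complex) set" where
  "H1_per = {u. continuous_on UNIV u \<and> periodic u \<and> (\<exists>g. weak_deriv_of u g)}"

text \<open>The weak derivative is determined up to a null subset of \<open>[0, 2\<pi>]\<close>; below it occurs only
  inside \<^const>\<open>avg\<close>.\<close>

definition wderiv :: "(real \<Rightarrow> complex) \<Rightarrow> real \<Rightarrow> complex" where
  "wderiv u = (SOME g. weak_deriv_of u g)"

definition H1_norm :: "(real \<Rightarrow> complex) \<Rightarrow> real" where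
  "H1_norm u = sqrt (avg (\<lambda>t. (norm (u t))\<^sup>2) + avg (\<lambda>t. (norm (wderiv u t))\<^sup>2))"

definition nonconstant_H1_per :: "(real \<Rightarrow> complex) set" where
  "nonconstant_H1_per = {u \<in> H1_per. \<not> (\<exists>c. u = (\<lambda>_. c))}"


subsection \<open>The energy\<close>

definition L_fun :: "(real \<Rightarrow> complex) \<Rightarrow> real" where
  "L_fun u = sqrt (avg (\<lambda>t. (norm (wderiv u t))\<^sup>2))"

text \<open>Only the values off the image of \<open>u\<close> are meaningful; for \<open>u\<close> in \<^const>\<open>H1_per\<close> that image is a
  null set, so the values on it do not affect the area functional below.\<close>

definition j_fun :: "(real \<Rightarrow> complex) \<Rightarrow> complex \<Rightarrow> real" where
  "j_fun u z = avg (\<lambda>t. ((u t - z) /\<^sub>R (norm (u t - z))\<^sup>2) \<bullet> (\<i> * wderiv u t))"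

definition A_fun :: "(complex \<Rightarrow> real) \<Rightarrow> (real \<Rightarrow> complex) \<Rightarrow> real" where
  "A_fun K u = 1 / (2 * pi) * (LINT z|lebesgue. K z * j_fun u z)"

definition E_fun :: "(complex \<Rightarrow> real) \<Rightarrow> (real \<Rightarrow> complex) \<Rightarrow> real" where
  "E_fun H u = L_fun u + A_fun H u"


subsection \<open>Differentials and Palais-Smale sequences\<close>

text \<open>\<open>D\<close> belongs to the dual of \<^const>\<open>H1_per\<close>; its values outside \<^const>\<open>H1_per\<close> are irrelevant.\<close>

definition H1_dual :: "((real \<Rightarrow> complex) \<Rightarrow> real) \<Rightarrow> bool" where
  "H1_dual D \<longleftrightarrow>
     (\<forall>\<phi>\<in>H1_per. \<forall>\<psi>\<in>H1_per. D (\<lambda>t. \<phi> t + \<psi> t) = D \<phi> + D \<psi>) \<and>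
     (\<forall>\<phi>\<in>H1_per. \<forall>r::real. D (\<lambda>t. r *\<^sub>R \<phi> t) = r * D \<phi>) \<and>
     (\<exists>C. \<forall>\<phi>\<in>H1_per. \<bar>D \<phi>\<bar> \<le> C * H1_norm \<phi>)"

definition dual_norm :: "((real \<Rightarrow> complex) \<Rightarrow> real) \<Rightarrow> real" where
  "dual_norm D = (SUP \<phi>\<in>{\<phi> \<in> H1_per. H1_norm \<phi> \<le> 1}. \<bar>D \<phi>\<bar>)"

text \<open>Frechet differentiability with respect to the \<^const>\<open>H1_norm\<close>; the differential is unique on
  \<^const>\<open>H1_per\<close>.\<close>

definition has_H1_differential ::
  "((real \<Rightarrow> complex) \<Rightarrow> real) \<Rightarrow> ((real \<Rightarrow> complex) \<Rightarrow> real) \<Rightarrow> (real \<Rightarrow> complex) \<Rightarrow> bool" where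
  "has_H1_differential F D u \<longleftrightarrow>
     H1_dual D \<and>
     (\<forall>\<epsilon>>0. \<exists>\<eta>>0. \<forall>\<phi>\<in>H1_per. H1_norm \<phi> < \<eta> \<longrightarrow>
        \<bar>F (\<lambda>t. u t + \<phi> t) - F u - D \<phi>\<bar> \<le> \<epsilon> * H1_norm \<phi>)"

definition palais_smale ::
  "(complex \<Rightarrow> real) \<Rightarrow> real \<Rightarrow> (nat \<Rightarrow> real \<Rightarrow> complex) \<Rightarrow> bool" where
  "palais_smale H c u \<longleftrightarrow>
     (\<forall>n. u n \<in> nonconstant_H1_per) \<and>
     (\<lambda>n. E_fun H (u n)) \<longlonglongrightarrow> c \<and>
     (\<exists>dE. (\<forall>n. has_H1_differential (E_fun H) (dE n) (u n)) \<and>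
           (\<lambda>n. dual_norm (dE n)) \<longlonglongrightarrow> 0)"

end

theory Submission
  imports Defs "HOL-Real_Asymp.Real_Asymp"
begin

text \<open>
  Take \<open>H = 1 + G\<close> with \<open>G(z) = - a ln |z|\<close> on \<open>\<epsilon> \<le> |z| \<le> 1\<close>, constant for \<open>|z| \<le> \<epsilon>\<close> and \<open>0\<close> outside the unit
  disc.  Then \<open>dl H = - a\<close> on the annulus \<open>\<epsilon> < |z| < 1\<close> and \<open>0\<close> elsewhere, so \<open>N\<^sub>H = a \<surd>(1 - \<epsilon>\<^sup>2) / 2\<close>.
  As \<open>H = 1\<close> on the unit circle, the \<open>k\<close>-fold circle \<open>e\<^sup>i\<^sup>k\<^sup>t\<close> is an exact critical point for every \<open>k\<close>.  Its
  energy is \<open>k\<close> times that of the simple circle, which vanishes precisely for \<open>a = 2 / (1 - \<epsilon>\<^sup>2)\<close>; then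
  \<open>N\<^sub>H = 1 / \<surd>(1 - \<epsilon>\<^sup>2)\<close> exceeds \<open>1\<close> by as little as we please, and the critical points \<open>e\<^sup>i\<^sup>k\<^sup>t\<close> at level \<open>0\<close>
  have length \<open>k \<rightarrow> \<infinity>\<close>.  The work lies in the Frechet differentiability of the area functional at these
  curves with respect to the Sobolev norm: it is split into the constant part of \<open>H\<close>, where it is an explicit quadratic form,
  and the part from \<open>G\<close>, which is small near the circle.
\<close>

section \<open>Smooth test functions\<close>

text \<open>The logarithm is the extremal profile. The energy of the k-fold circle is k - k/2 - (k /
  2 pi) times the integral of G, so it vanishes iff that integral is pi. Twice this integral is
  minus the integral of dl H; for G supported in the unit disc Cauchy-Schwarz then gives N >= 1,
  with equality only for dl H = -2 on the disc, that is G = -2 ln |z|. This G is unbounded at 0, and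
  truncating it at \<epsilon> restores continuity at the price of N slightly above 1.
  Differentiability is read off the definition: the energy of the circle is 0, so it suffices that
  the energy of circle plus \<phi> is of order N^(3/2), N being the Sobolev norm of \<phi>. Such a
  curve may oscillate across the circle with a merely square integrable derivative, so
  \<open>j_fun\<close> has no pointwise bound there. Instead: the curve stays within \<eta> = (1 + 2
  pi) N of the circle, so inside the disc the winding number is unchanged off an annulus of
  thickness \<eta>; on that annulus G is O(\<eta>); and 1/|w - z| has integral O(sqrt \<eta>) over a
  set of area O(\<eta>).\<close>

lemma C_k_SucI:
  assumes "\<And>x. (f has_derivative f' x) (at x)" "\<And>b. b \<in> Basis \<Longrightarrow> C_k k (\<lambda>x. f' x b)"
  shows "C_k (Suc k) f"
proof -
  have "frechet_derivative f (at x) = f' x" for x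
    using frechet_derivative_at[OF assms(1)] by simp
  then show ?thesis using assms by (auto simp: differentiable_def)
qed

lemma C_k_SucD:
  assumes "C_k (Suc k) f"
  shows "(f has_derivative frechet_derivative f (at x)) (at x)"
    and "b \<in> Basis \<Longrightarrow> C_k k (\<lambda>x. frechet_derivative f (at x) b)"
  using assms by (auto simp: frechet_derivative_works)

lemma C_k_Suc_imp: "C_k (Suc k) f \<Longrightarrow> C_k k f"
proof (induction k arbitrary: f)
  case 0
  then show ?case
    by (auto simp: continuous_on_eq_continuous_at intro: differentiable_imp_continuous_within)
next
  case (Suc k)
  then show ?case by (metis C_k.simps(2))
qed

lemma C_k_const: "C_k k (\<lambda>x. c)"
proof (induction k arbitrary: c)
  case (Suc k)
  show ?case by (rule C_k_SucI[where f'="\<lambda>x y. 0"]) (auto intro: Suc)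
qed auto

lemma C_k_inner: "C_k k (\<lambda>x. x \<bullet> a)"
proof (cases k)
  case (Suc k)
  show ?thesis unfolding Suc
    by (rule C_k_SucI[where f'="\<lambda>x y. y \<bullet> a"]) (auto intro!: derivative_eq_intros C_k_const)
qed (auto intro!: continuous_intros)

lemma C_k_add: "C_k k f \<Longrightarrow> C_k k g \<Longrightarrow> C_k k (\<lambda>x. f x + g x)"
proof (induction k arbitrary: f g)
  case (Suc k)
  show ?case
    by (rule C_k_SucI[OF has_derivative_add[OF C_k_SucD(1)[OF Suc.prems(1)] C_k_SucD(1)[OF Suc.prems(2)]]])
       (auto intro!: Suc.IH C_k_SucD(2)[OF Suc.prems(1)] C_k_SucD(2)[OF Suc.prems(2)])
qed (auto intro!: continuous_intros)

lemma C_k_mult: "C_k k f \<Longrightarrow> C_k k g \<Longrightarrow> C_k k (\<lambda>x. f x * g x)"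
proof (induction k arbitrary: f g)
  case (Suc k)
  show ?case
    by (rule C_k_SucI[OF has_derivative_mult[OF C_k_SucD(1)[OF Suc.prems(1)] C_k_SucD(1)[OF Suc.prems(2)]]])
       (auto intro!: Suc.IH C_k_add C_k_SucD(2)[OF Suc.prems(1)] C_k_SucD(2)[OF Suc.prems(2)]
          C_k_Suc_imp[OF Suc.prems(1)] C_k_Suc_imp[OF Suc.prems(2)])
qed (auto intro!: continuous_intros)

text \<open>The index \<open>j\<close> stays arbitrary so that the induction on \<open>k\<close>
  closes: the chain rule turns \<open>F j\<close> into \<open>F (Suc j)\<close>. Two towers of
  derivatives in closed form are fed in later, that of \<open>cos\<close> and that of
  \<open>exp_bump\<close>.\<close>

lemma C_k_compose_family:
  fixes F :: "nat \<Rightarrow> real \<Rightarrow> real"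
  assumes F: "\<And>j x. (F j has_real_derivative F (Suc j) x) (at x)" and "C_k k h"
  shows "C_k k (\<lambda>x. F j (h x))"
  using assms(2)
proof (induction k arbitrary: j)
  case 0
  have "continuous_on UNIV (F j)"
    using F by (auto simp: continuous_on_eq_continuous_at intro: DERIV_isCont)
  with 0 show ?case by (auto intro: continuous_on_compose2)
next
  case (Suc k)
  have "((\<lambda>x. F j (h x)) has_derivative (\<lambda>y. F (Suc j) (h x) * frechet_derivative h (at x) y)) (at x)" for x
    using has_derivative_compose[OF C_k_SucD(1)[OF Suc.prems] F[of j, unfolded has_field_derivative_def]]
    by simp
  then show ?case
    by (rule C_k_SucI) (intro C_k_mult Suc.IH C_k_Suc_imp[OF Suc.prems] C_k_SucD(2)[OF Suc.prems])
qed

lemma smooth_const [intro]: "smooth (\<lambda>x. c)" by (simp add: smooth_def C_k_const)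
lemma smooth_inner [intro]: "smooth (\<lambda>x. x \<bullet> a)" by (simp add: smooth_def C_k_inner)
lemma smooth_add [intro]: "smooth f \<Longrightarrow> smooth g \<Longrightarrow> smooth (\<lambda>x. f x + g x)" by (simp add: smooth_def C_k_add)
lemma smooth_mult [intro]: "smooth f \<Longrightarrow> smooth g \<Longrightarrow> smooth (\<lambda>x. f x * g x)" by (simp add: smooth_def C_k_mult)
lemma smooth_diff [intro]: "smooth f \<Longrightarrow> smooth g \<Longrightarrow> smooth (\<lambda>x. f x - g x)"
  using smooth_add[of f "\<lambda>x. (-1) * g x"] smooth_mult[of "\<lambda>_. -1" g] by auto

lemma smooth_prod: "finite A \<Longrightarrow> (\<And>i. i \<in> A \<Longrightarrow> smooth (f i)) \<Longrightarrow> smooth (\<lambda>x. \<Prod>i\<in>A. f i x)"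
  by (induction A rule: finite_induct) auto

lemma smooth_cos_affine: "smooth (\<lambda>t::real. cos (c * t + d))"
proof -
  \<comment> \<open>Differentiating \<open>cos\<close> is a shift by a quarter turn, so a single
    formula covers all derivatives; the phase \<open>d\<close> of the lemma covers the sine.\<close>
  have "((\<lambda>x. cos (x + real j * (pi/2))) has_real_derivative cos (x + real (Suc j) * (pi/2))) (at x)" for j x
  proof -
    have "cos (x + real (Suc j) * (pi/2)) = - sin (x + real j * (pi/2))"
      by (simp add: minus_sin_cos_eq algebra_simps add_divide_distrib)
    then show ?thesis by (auto intro!: derivative_eq_intros)
  qed
  from C_k_compose_family[where F="\<lambda>j x. cos (x + real j * (pi/2))" and j=0, OF this]
  have "smooth h \<Longrightarrow> smooth (\<lambda>t. cos (h t))" for h :: "real \<Rightarrow> real"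
    unfolding smooth_def by fastforce
  moreover have "smooth (\<lambda>t::real. t * c + d)" using smooth_add[OF smooth_inner[of c] smooth_const[of d]] by simp
  ultimately show ?thesis by (simp add: mult.commute)
qed

lemma smooth_continuous: "smooth f \<Longrightarrow> continuous_on UNIV f"
  by (metis C_k.simps(1) smooth_def)

lemma smooth_DERIV:
  fixes f :: "real \<Rightarrow> real"
  assumes "smooth f"
  shows "(f has_real_derivative deriv f t) (at t)" and "continuous_on UNIV (deriv f)"
proof -
  have 1: "C_k (Suc 0) f" using assms smooth_def by blast
  show *: "(f has_real_derivative deriv f t) (at t)" for t
    using 1 by (simp add: DERIV_deriv_iff_real_differentiable)
  have "frechet_derivative f (at t) 1 = deriv f t" for t
    using frechet_derivative_at[OF *[unfolded has_field_derivative_def]] by (metis mult.right_neutral)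
  then show "continuous_on UNIV (deriv f)"
    using 1 by simp
qed

lemma smooth_antideriv:
  fixes f :: "real \<Rightarrow> real"
  assumes "smooth f" "\<And>x. (F has_real_derivative f x) (at x)"
  shows "smooth F"
proof -
  have "C_k (Suc k) F" for k
    by (rule C_k_SucI[OF assms(2)[unfolded has_field_derivative_def]])
      (use assms(1) in \<open>auto simp: smooth_def\<close>)
  then show ?thesis using C_k_Suc_imp smooth_def by blast
qed

section \<open>A smooth cutoff of the half-line\<close>

definition exp_bump :: "real poly \<Rightarrow> real \<Rightarrow> real" where
  "exp_bump p x = (if 0 < x then poly p (1/x) * exp (-(1/x)) else 0)"

lemma poly_mult_exp_tendsto_0: "((\<lambda>y::real. poly p y * exp (- y)) \<longlongrightarrow> 0) at_top"
proof -
  have "((\<lambda>y. \<Sum>i\<le>degree p. coeff p i * (y ^ i / exp y)) \<longlongrightarrow> (\<Sum>i\<le>degree p. coeff p i * 0)) at_top"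
    by (intro tendsto_intros tendsto_power_div_exp_0)
  then show ?thesis by (simp add: poly_altdef sum_distrib_right exp_minus divide_inverse mult.assoc)
qed

text \<open>The polynomial factor closes the family under differentiation: in y = 1/x the derivative
  of p(y) exp(-y) is (p - p')(y) y^2 exp(-y). At 0 the right difference quotient is y p(y) exp(-y),
  which decays as y tends to infinity.\<close>

lemma exp_bump_has_derivative:
  "(exp_bump p has_real_derivative exp_bump ((p - pderiv p) * [:0,0,1:]) x) (at x)"
proof -
  consider "x < 0" | "x = 0" | "x > 0" by linarith
  then show ?thesis
  proof cases
    case 1
    have "((\<lambda>x. 0) has_real_derivative 0) (at x)" by simp
    then show ?thesis
      by (rule has_field_derivative_transform_within_open[where S="{..<0}", OF DERIV_cong])
         (use 1 in \<open>auto simp: exp_bump_def\<close>)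
  next
    case 3
    have "((\<lambda>x. poly p (1/x) * exp (-(1/x))) has_real_derivative
       poly ((p - pderiv p) * [:0,0,1:]) (1/x) * exp (-(1/x))) (at x)"
      using 3 by (auto intro!: derivative_eq_intros DERIV_chain'[OF _ poly_DERIV] simp: field_simps power2_eq_square)
    then show ?thesis
      by (rule has_field_derivative_transform_within_open[where S="{0<..}", OF DERIV_cong])
         (use 3 in \<open>auto simp: exp_bump_def\<close>)
  next
    case 2
    have "((\<lambda>h. exp_bump p h / h) \<longlongrightarrow> 0) (at_right 0)"
    proof -
      have "((\<lambda>h. poly (p * [:0,1:]) (inverse h) * exp (- inverse h)) \<longlongrightarrow> 0) (at_right (0::real))"
        by (rule filterlim_compose[OF poly_mult_exp_tendsto_0 filterlim_inverse_at_top_right])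
      then show ?thesis
        by (rule Lim_transform_eventually)
           (auto simp: eventually_at_filter exp_bump_def field_simps)
    qed
    moreover have "((\<lambda>h. exp_bump p h / h) \<longlongrightarrow> 0) (at_left 0)"
      by (rule Lim_transform_eventually[OF tendsto_const])
         (auto simp: eventually_at_filter exp_bump_def)
    ultimately have "((\<lambda>h. exp_bump p h / h) \<longlongrightarrow> 0) (at 0)"
      using filterlim_split_at by blast
    then show ?thesis using 2 by (simp add: DERIV_def exp_bump_def)
  qed
qed

lemma smooth_exp_bump:
  assumes "smooth h"
  shows "smooth (\<lambda>x. exp_bump p (h x))"
proof -
  have "C_k k (\<lambda>x. exp_bump p (h x))" for k
    using C_k_compose_family[where F="\<lambda>j. exp_bump (((\<lambda>p. (p - pderiv p) * [:0,0,1:]) ^^ j) p)" and j=0 and k=k and h=h]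
      assms exp_bump_has_derivative by (simp add: smooth_def)
  then show ?thesis by (simp add: smooth_def)
qed

text \<open>For x > 0 this is exp(-1 / (m x)), increasing to 1 with m: a smooth pointwise
  approximation of the indicator of the open half-line, bounded by 1 as dominated convergence
  requires.\<close>

definition cutoff :: "nat \<Rightarrow> real \<Rightarrow> real" where
  "cutoff m x = exp_bump 1 (real m * x)"

lemma smooth_cutoff: "smooth h \<Longrightarrow> smooth (\<lambda>x. cutoff m (h x))"
  unfolding cutoff_def by (intro smooth_exp_bump smooth_mult smooth_const)

lemma cutoff_bounds: "0 \<le> cutoff m x" "cutoff m x \<le> 1"
  by (auto simp: cutoff_def exp_bump_def)

lemma cutoff_nonpos: "x \<le> 0 \<Longrightarrow> cutoff m x = 0"
  by (auto simp: cutoff_def exp_bump_def mult_less_0_iff zero_less_mult_iff)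

lemma cutoff_tendsto: "(\<lambda>m. cutoff m x) \<longlonglongrightarrow> (if 0 < x then 1 else 0)"
proof (cases "0 < x")
  case True
  have "(\<lambda>m. exp (- inverse (real m) * inverse x)) \<longlonglongrightarrow> exp (- 0 * inverse x)"
    by (intro tendsto_intros lim_inverse_n)
  then have "(\<lambda>m. exp (- inverse (real m) * inverse x)) \<longlonglongrightarrow> 1" by simp
  then show ?thesis using True
    by (rule_tac Lim_transform_eventually, simp)
       (auto intro!: eventually_mono[OF eventually_gt_at_top[of 0]] simp: cutoff_def exp_bump_def field_simps)
next
  case False
  then show ?thesis by (simp add: cutoff_nonpos)
qed

text \<open>Open boxes are stable under intersection and generate the Borel sets, so the sets of
  vanishing integral exhaust them by the pi-lambda argument. Complements need the integral over the
  whole space, which is the limit over growing boxes.\<close>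

lemma AE_zero_if_box_integrals_zero:
  fixes f :: "'a::euclidean_space \<Rightarrow> real"
  assumes int: "integrable lborel f" and box: "\<And>a b. (LINT x:box a b|lborel. f x) = 0"
  shows "AE x in lborel. f x = 0"
proof (rule sigma_finite_measure.density_zero[OF lborel.sigma_finite_measure_axioms int])
  fix A :: "'a set" assume "A \<in> sets lborel"
  then have A: "A \<in> sigma_sets UNIV (range (\<lambda>(a,b). box a b))" by (simp add: borel_eq_box)
  have total: "(LINT x|lborel. f x) = 0"
  proof -
    let ?A = "\<lambda>n::nat. box (- (real n *\<^sub>R One)) (real n *\<^sub>R One) :: 'a set"
    have U: "(\<Union>i. ?A i) = UNIV" by (rule UN_box_eq_UNIV)
    have mono: "incseq ?A"
    proof (rule incseq_SucI)
      fix n show "?A n \<le> ?A (Suc n)" by (rule subset_box_imp) (auto simp: inner_simps)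
    qed
    have "(\<lambda>n. LINT x:?A n|lborel. f x) \<longlonglongrightarrow> (LINT x:(\<Union>i. ?A i)|lborel. f x)"
      using mono int by (intro set_integral_cont_up) (auto simp: U set_integrable_def)
    then have "(LINT x:(\<Union>i. ?A i)|lborel. f x) = 0" using box by (simp add: LIMSEQ_const_iff)
    then show ?thesis unfolding U by (simp add: set_lebesgue_integral_def)
  qed
  show "(LINT x:A|lborel. f x) = 0"
  proof (rule sigma_sets_induct_disjoint[OF _ _ A, where P="\<lambda>A. (LINT x:A|lborel. f x) = 0"])
    show "Int_stable (range (\<lambda>(a,b). box a b :: 'a set))"
      by (auto simp: Int_stable_def box_Int_box)
    fix B assume "B \<in> sigma_sets UNIV (range (\<lambda>(a,b). box a b :: 'a set))" and B0: "(LINT x:B|lborel. f x) = 0"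
    then have B: "B \<in> sets lborel" by (simp add: borel_eq_box)
    have "(LINT x:UNIV - B|lborel. f x) = (LINT x|lborel. f x - indicator B x *\<^sub>R f x)"
      unfolding set_lebesgue_integral_def by (rule Bochner_Integration.integral_cong) (auto simp: indicator_def)
    also have "\<dots> = 0"
      using B0 total int integrable_mult_indicator[OF B int]
      by (subst Bochner_Integration.integral_diff) (auto simp: set_lebesgue_integral_def)
    finally show "(LINT x:UNIV - B|lborel. f x) = 0" .
  next
    fix B :: "nat \<Rightarrow> 'a set"
    assume d: "disjoint_family B" and "range B \<subseteq> sigma_sets UNIV (range (\<lambda>(a,b). box a b :: 'a set))"
      and z: "\<And>i. (LINT x:B i|lborel. f x) = 0"
    then have m: "B i \<in> sets lborel" for i by (auto simp: borel_eq_box)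
    have "set_integrable lborel (\<Union>i. B i) f"
      unfolding set_integrable_def using m int by (intro integrable_mult_indicator) auto
    then have "(LINT x:(\<Union>i. B i)|lborel. f x) = (\<Sum>i. (LINT x:B i|lborel. f x))"
      using d m by (intro lebesgue_integral_countable_add) (auto simp: disjoint_family_on_def)
    then show "(LINT x:(\<Union>i. B i)|lborel. f x) = 0" using z by simp
  qed (use box in \<open>auto simp: set_lebesgue_integral_def\<close>)
qed

section \<open>Closed Sobolev curves\<close>

text \<open>Transfer to the completed measure: \<open>f\<close> is replaced by a Borel function
  \<open>g\<close> equal to it almost everywhere.\<close>

lemma AE_lebesgue_zero_if_box_integrals_zero:
  fixes f :: "'a::euclidean_space \<Rightarrow> real"
  assumes int: "integrable lebesgue f" and box: "\<And>a b. (LINT x:box a b|lebesgue. f x) = 0"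
  shows "AE x in lebesgue. f x = 0"
proof -
  obtain g where g[measurable]: "g \<in> borel_measurable lborel" and "AE x in lborel. f x = g x"
    using completion_ex_borel_measurable_real[OF borel_measurable_integrable[OF int]] by auto
  then have fg: "AE x in lebesgue. f x = g x" by (simp add: AE_completion)
  have mf[measurable]: "f \<in> borel_measurable lebesgue" using int by auto
  have mg[measurable]: "g \<in> borel_measurable lebesgue" using g by (rule measurable_completion)
  have "integrable lebesgue g"
    using int fg by (subst integrable_cong_AE[symmetric]) auto
  then have 1: "integrable lborel g" by (simp add: integrable_completion)
  have 2: "(LINT x:box a b|lborel. g x) = 0" for a b
  proof -
    have "(LINT x:box a b|lebesgue. g x) = (LINT x:box a b|lebesgue. f x)"
      unfolding set_lebesgue_integral_def
    proof (rule integral_cong_AE)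
      have b: "box a b \<in> sets lebesgue" by simp
      show "(\<lambda>x. indicat_real (box a b) x *\<^sub>R g x) \<in> borel_measurable lebesgue"
        by (rule borel_measurable_scaleR[OF borel_measurable_indicator[OF b] mg])
      show "(\<lambda>x. indicat_real (box a b) x *\<^sub>R f x) \<in> borel_measurable lebesgue"
        by (rule borel_measurable_scaleR[OF borel_measurable_indicator[OF b] mf])
    qed (use fg in auto)
    then show ?thesis using box[of a b]
      unfolding set_lebesgue_integral_def by (subst (asm) integral_completion) auto
  qed
  have "AE x in lebesgue. g x = 0"
    by (rule AE_completion[OF AE_zero_if_box_integrals_zero[OF 1 2]])
  with fg show ?thesis by auto
qed

abbreviation circ :: "real measure" where "circ \<equiv> lebesgue_on {0..2 * pi}"

lemma finite_measure_circ: "finite_measure circ"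
  by (rule finite_measure_lebesgue_on) auto

lemma sigma_finite_circ: "sigma_finite_measure circ"
  using finite_measure_circ by (simp add: finite_measure_def)

lemma measure_circ: "measure circ (space circ) = 2 * pi"
  by (subst measure_restrict_space) (simp_all add: space_restrict_space)

lemma integral_circ_const: "(LINT t|circ. c) = (2 * pi) *\<^sub>R c" for c :: "'a::{banach, second_countable_topology}"
  by (simp only: lebesgue_integral_const measure_circ)

lemma continuous_circ_measurable:
  "continuous_on UNIV (f::real \<Rightarrow> 'a::euclidean_space) \<Longrightarrow> f \<in> borel_measurable circ"
  by (rule continuous_imp_measurable_on_sets_lebesgue) (auto intro: continuous_on_subset)

lemma id_circ_measurable [measurable]: "(\<lambda>x. x) \<in> borel_measurable circ"
  by (rule continuous_circ_measurable) (intro continuous_intros)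

lemma continuous_circ_bounded:
  fixes f :: "real \<Rightarrow> 'a::euclidean_space"
  assumes "continuous_on UNIV f"
  obtains B where "B > 0" "\<And>t. t \<in> {0..2*pi} \<Longrightarrow> norm (f t) \<le> B"
proof -
  have "compact (f ` {0..2*pi})"
    by (rule compact_continuous_image[OF continuous_on_subset[OF assms]]) auto
  then obtain B where "B > 0" "\<forall>x\<in>f ` {0..2*pi}. norm x \<le> B"
    using compact_imp_bounded[of "f ` {0..2*pi}"] unfolding bounded_pos by blast
  then show ?thesis using that[of B] by blast
qed

lemma integrable_circ_continuous:
  fixes f :: "real \<Rightarrow> 'a::euclidean_space"
  assumes "continuous_on UNIV f" shows "integrable circ f"
proof -
  obtain B where "B > 0" "\<And>t. t \<in> {0..2*pi} \<Longrightarrow> norm (f t) \<le> B"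
    using continuous_circ_bounded[OF assms] by blast
  then have "AE t in circ. norm (f t) \<le> B" by (intro AE_I2) simp
  then show ?thesis
    by (rule finite_measure.integrable_const_bound[OF finite_measure_circ _ continuous_circ_measurable[OF assms]])
qed

lemma integrable_circ_continuous_scaleR:
  fixes g :: "real \<Rightarrow> 'a::euclidean_space"
  assumes "continuous_on UNIV f" "integrable circ g"
  shows "integrable circ (\<lambda>t. f t *\<^sub>R g t)"
proof -
  obtain B where "B > 0" "\<And>t. t \<in> {0..2*pi} \<Longrightarrow> norm (f t) \<le> B"
    using continuous_circ_bounded[OF assms(1)] by blast
  then have bd: "AE t in circ. norm (f t *\<^sub>R g t) \<le> norm (B * norm (g t))"
    by (intro AE_I2) (simp add: mult_right_mono)
  have i: "integrable circ (\<lambda>t. B * norm (g t))"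
    using assms(2) by (intro integrable_mult_right integrable_norm)
  have m: "(\<lambda>t. f t *\<^sub>R g t) \<in> borel_measurable circ"
    by (rule borel_measurable_scaleR[OF continuous_circ_measurable[OF assms(1)] borel_measurable_integrable[OF assms(2)]])
  show ?thesis by (rule Bochner_Integration.integrable_bound[OF i m bd])
qed

lemma square_integrable_circ_integrable:
  fixes g :: "real \<Rightarrow> 'a::euclidean_space"
  assumes "square_integrable circ g" shows "integrable circ g"
proof (rule Bochner_Integration.integrable_bound)
  show "integrable circ (\<lambda>t. 1 + (norm (g t))\<^sup>2)"
    using assms integrable_circ_continuous[of "\<lambda>_. 1::real"] by (auto simp: square_integrable_def)
  show "AE x in circ. norm (g x) \<le> norm (1 + (norm (g x))\<^sup>2)"
  proof (rule AE_I2)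
    fix x
    have "0 \<le> (norm (g x) - 1)\<^sup>2" by simp
    then show "norm (g x) \<le> norm (1 + (norm (g x))\<^sup>2)"
      by (simp add: power2_eq_square algebra_simps) (smt (verit) mult_nonneg_nonneg norm_ge_zero)
  qed
qed (use assms in \<open>auto simp: square_integrable_def\<close>)

lemma square_integrable_add:
  fixes g h :: "'b \<Rightarrow> 'a::euclidean_space"
  assumes g: "square_integrable M g" and h: "square_integrable M h"
  shows "square_integrable M (\<lambda>t. g t + h t)"
  unfolding square_integrable_def
proof
  show m: "(\<lambda>t. g t + h t) \<in> borel_measurable M"
    using assms by (intro borel_measurable_add) (simp_all add: square_integrable_def)
  show "integrable M (\<lambda>t. (norm (g t + h t))\<^sup>2)"
  proof (rule Bochner_Integration.integrable_bound)
    show "integrable M (\<lambda>t. 2 * (norm (g t))\<^sup>2 + 2 * (norm (h t))\<^sup>2)"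
      using assms by (auto simp: square_integrable_def)
    show "AE t in M. norm ((norm (g t + h t))\<^sup>2) \<le> norm (2 * (norm (g t))\<^sup>2 + 2 * (norm (h t))\<^sup>2)"
    proof (rule AE_I2)
      fix t
      have "(norm (g t + h t))\<^sup>2 + (norm (g t - h t))\<^sup>2 = 2 * (norm (g t))\<^sup>2 + 2 * (norm (h t))\<^sup>2"
        by (simp add: power2_norm_eq_inner algebra_simps inner_commute)
      moreover have "0 \<le> (norm (g t - h t))\<^sup>2" by simp
      ultimately have "(norm (g t + h t))\<^sup>2 \<le> 2 * (norm (g t))\<^sup>2 + 2 * (norm (h t))\<^sup>2"
        by linarith
      then show "norm ((norm (g t + h t))\<^sup>2) \<le> norm (2 * (norm (g t))\<^sup>2 + 2 * (norm (h t))\<^sup>2)"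
        by (simp add: abs_of_nonneg)
    qed
    show "(\<lambda>t. (norm (g t + h t))\<^sup>2) \<in> borel_measurable M"
      using m by (intro borel_measurable_power measurable_compose[OF m borel_measurable_norm])
  qed
qed

lemma square_integrable_inner:
  fixes g h :: "'b \<Rightarrow> 'a::euclidean_space"
  assumes g: "square_integrable M g" and h: "square_integrable M h"
  shows "integrable M (\<lambda>t. g t \<bullet> h t)"
proof -
  have "integrable M (\<lambda>t. ((norm (g t + h t))\<^sup>2 - (norm (g t))\<^sup>2 - (norm (h t))\<^sup>2) / 2)"
    using square_integrable_add[OF assms] assms by (auto simp: square_integrable_def)
  moreover have "((norm (x + y))\<^sup>2 - (norm x)\<^sup>2 - (norm y)\<^sup>2) / 2 = x \<bullet> y" for x y :: 'a
    by (simp add: power2_norm_eq_inner algebra_simps inner_commute)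
  ultimately show ?thesis by simp
qed

text \<open>Test functions must be periodic, so the cutoff of an interval (a, b) is built from cos(t
  - midpoint) - cos(half length), which on [0, 2 pi] is positive exactly on (a, b). In the limit all
  interval integrals of \<open>f\<close> vanish.\<close>

lemma AE_circ_zero_if_test_integrals_zero_real:
  fixes f :: "real \<Rightarrow> real"
  assumes int: "integrable circ f"
    and test: "\<And>\<phi>. smooth \<phi> \<Longrightarrow> periodic \<phi> \<Longrightarrow> (LINT t|circ. \<phi> t * f t) = 0"
  shows "AE t in circ. f t = 0"
proof -
  define F where "F = (\<lambda>t. indicator {0..2*pi} t * f t)"
  have intF: "integrable lebesgue F"
    using int unfolding F_def by (subst (asm) integrable_restrict_space) auto
  have *: "(LINT t|circ. indicator {a<..<b} t * f t) = 0" if "0 \<le> a" "a < b" "b \<le> 2*pi" for a b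
  proof -
    define \<phi> where "\<phi> = (\<lambda>m t. cutoff m (cos (t - (a+b)/2) - cos ((b-a)/2)))"
    have sm: "smooth (\<phi> m)" for m unfolding \<phi>_def
      using smooth_cos_affine[of 1 "-((a+b)/2)"] by (intro smooth_cutoff smooth_diff smooth_const) simp
    have per: "periodic (\<phi> m)" for m unfolding \<phi>_def periodic_def
    proof
      fix t
      have "cos (t + 2*pi - (a+b)/2) = cos (t - (a+b)/2 + 2*pi)" by (simp add: algebra_simps)
      then show "cutoff m (cos (t + 2 * pi - (a + b) / 2) - cos ((b - a) / 2)) = cutoff m (cos (t - (a + b) / 2) - cos ((b - a) / 2))"
        by (simp only: cos_periodic)
    qed
    have lim: "(\<lambda>m. \<phi> m t) \<longlonglongrightarrow> indicator {a<..<b} t" if t: "t \<in> {0..2*pi}" for t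
    proof -
      have "0 < cos (t - (a+b)/2) - cos ((b-a)/2) \<longleftrightarrow> t \<in> {a<..<b}"
      proof (cases "t \<in> {a<..<b}")
        case True
        then have "\<bar>t - (a+b)/2\<bar> < (b-a)/2" by (auto simp: abs_less_iff field_simps)
        then have "cos ((b-a)/2) < cos \<bar>t - (a+b)/2\<bar>"
          using that \<open>b \<le> 2*pi\<close> \<open>0 \<le> a\<close> by (intro cos_monotone_0_pi) auto
        then show ?thesis using True by simp
      next
        case False
        then have ge: "\<bar>t - (a+b)/2\<bar> \<ge> (b-a)/2" by (auto simp: field_simps abs_if split: if_splits)
        have le: "\<bar>t - (a+b)/2\<bar> \<le> 2*pi - (b-a)/2"
          using t \<open>0 \<le> a\<close> \<open>b \<le> 2*pi\<close> \<open>a<b\<close> by (auto simp: field_simps abs_if)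
        have "cos \<bar>t - (a+b)/2\<bar> \<le> cos ((b-a)/2)"
        proof (cases "\<bar>t - (a+b)/2\<bar> \<le> pi")
          case True
          then show ?thesis using ge \<open>a<b\<close> by (intro cos_monotone_0_pi_le) auto
        next
          case False
          \<comment> \<open>Beyond distance pi from the midpoint the cosine increases again; the
            reflection x -> 2 pi - x returns to the monotone range, and \<open>le\<close> keeps the
            reflected point outside (a, b).\<close>
          have "cos (2*pi - \<bar>t - (a+b)/2\<bar>) \<le> cos ((b-a)/2)"
          proof (rule cos_monotone_0_pi_le)
            show "0 \<le> (b-a)/2" using \<open>a<b\<close> by simp
            show "(b-a)/2 \<le> 2*pi - \<bar>t - (a+b)/2\<bar>" using le by linarith
            show "2*pi - \<bar>t - (a+b)/2\<bar> \<le> pi" using False by linarith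
          qed
          then show ?thesis by (simp add: cos_diff)
        qed
        then show ?thesis using False by simp
      qed
      then show ?thesis
        using cutoff_tendsto[of "cos (t - (a+b)/2) - cos ((b-a)/2)"] unfolding \<phi>_def
        by (auto simp: indicator_def split: if_splits)
    qed
    have "(\<lambda>m. LINT t|circ. \<phi> m t * f t) \<longlonglongrightarrow> (LINT t|circ. indicator {a<..<b} t * f t)"
    proof (rule integral_dominated_convergence[where w="\<lambda>t. norm (f t)"])
      show "(\<lambda>t. indicat_real {a<..<b} t * f t) \<in> borel_measurable circ"
        using int by measurable
      show "(\<lambda>t. \<phi> m t * f t) \<in> borel_measurable circ" for m
        using continuous_circ_measurable[OF smooth_continuous[OF sm]] int by measurable
      show "integrable circ (\<lambda>t. norm (f t))" using int by simp
      show "AE t in circ. (\<lambda>m. \<phi> m t * f t) \<longlonglongrightarrow> indicator {a<..<b} t * f t"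
        by (rule AE_I2) (auto intro!: tendsto_intros lim)
      show "AE t in circ. norm (\<phi> m t * f t) \<le> norm (f t)" for m
        by (rule AE_I2) (auto simp: \<phi>_def abs_mult cutoff_bounds mult_left_le_one_le)
    qed
    then show ?thesis using test[OF sm per] by (simp add: LIMSEQ_const_iff)
  qed
  have "AE t in lebesgue. F t = 0"
  proof (rule AE_lebesgue_zero_if_box_integrals_zero[OF intF])
    fix a b :: real
    define a' b' where "a' = max a 0" and "b' = min b (2*pi)"
    have eq: "(LINT t:box a b|lebesgue. F t) = (LINT t|circ. indicator {a'<..<b'} t * f t)"
    proof -
      \<comment> \<open>The box cut down to [0, 2 pi] and the open interval from \<open>a'\<close>
        to \<open>b'\<close> differ at most in the end points 0 and 2 pi.\<close>
      have "AE t in lebesgue. t \<noteq> (0::real)" "AE t in lebesgue. t \<noteq> 2*pi"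
        by (auto intro!: AE_completion AE_lborel_singleton)
      then have "AE t in lebesgue. indicator (box a b) t *\<^sub>R F t = indicator {0..2*pi} t *\<^sub>R (indicator {a'<..<b'} t * f t)"
        by eventually_elim (auto simp: F_def a'_def b'_def indicator_def box_real)
      moreover have "(\<lambda>t. indicator {a'<..<b'} t * f t) \<in> borel_measurable circ"
        using int by measurable
      then have "(\<lambda>t. indicator {0..2*pi} t *\<^sub>R (indicator {a'<..<b'} t * f t)) \<in> borel_measurable lebesgue"
        by (subst (asm) borel_measurable_restrict_space_iff) (auto simp: mult.commute)
      moreover have "(\<lambda>t. indicat_real (box a b) t *\<^sub>R F t) \<in> borel_measurable lebesgue"
        by (rule borel_measurable_scaleR[OF borel_measurable_indicator borel_measurable_integrable[OF intF]]) simp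
      ultimately have "(LINT t:box a b|lebesgue. F t) = (LINT t|lebesgue. indicator {0..2*pi} t *\<^sub>R (indicator {a'<..<b'} t * f t))"
        unfolding set_lebesgue_integral_def by (intro integral_cong_AE)
      also have "\<dots> = (LINT t|circ. indicator {a'<..<b'} t * f t)"
        by (rule integral_restrict_space[symmetric]) simp
      finally show ?thesis .
    qed
    show "(LINT t:box a b|lebesgue. F t) = 0"
    proof (cases "a' < b'")
      case True
      then show ?thesis unfolding eq by (intro *) (auto simp: a'_def b'_def)
    next
      case False
      then show ?thesis unfolding eq by simp
    qed
  qed
  then show ?thesis by (subst AE_restrict_space_iff) (auto simp: F_def)
qed

lemma AE_circ_zero_if_test_integrals_zero:
  fixes f :: "real \<Rightarrow> complex"
  assumes int: "integrable circ f"
    and test: "\<And>\<phi>. smooth \<phi> \<Longrightarrow> periodic \<phi> \<Longrightarrow> (LINT t|circ. \<phi> t *\<^sub>R f t) = 0"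
  shows "AE t in circ. f t = 0"
proof -
  have i: "integrable circ (\<lambda>t. \<phi> t *\<^sub>R f t)" if "smooth \<phi>" for \<phi>
    using int that by (intro integrable_circ_continuous_scaleR smooth_continuous)
  have "AE t in circ. Re (f t) = 0"
  proof (rule AE_circ_zero_if_test_integrals_zero_real)
    fix \<phi> :: "real \<Rightarrow> real" assume s: "smooth \<phi>" "periodic \<phi>"
    have "(LINT t|circ. Re (\<phi> t *\<^sub>R f t)) = Re (LINT t|circ. \<phi> t *\<^sub>R f t)"
      using i[OF s(1)] by (rule integral_Re)
    then show "(LINT t|circ. \<phi> t * Re (f t)) = 0" using test[OF s] by simp
  qed (use int in auto)
  moreover have "AE t in circ. Im (f t) = 0"
  proof (rule AE_circ_zero_if_test_integrals_zero_real)
    fix \<phi> :: "real \<Rightarrow> real" assume s: "smooth \<phi>" "periodic \<phi>"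
    have "(LINT t|circ. Im (\<phi> t *\<^sub>R f t)) = Im (LINT t|circ. \<phi> t *\<^sub>R f t)"
      using i[OF s(1)] by (rule integral_Im)
    then show "(LINT t|circ. \<phi> t * Im (f t)) = 0" using test[OF s] by simp
  qed (use int in auto)
  ultimately show ?thesis by eventually_elim (simp add: complex_eq_iff)
qed

section \<open>Weak derivatives: uniqueness and linearity\<close>

lemma weak_deriv_integrable: "weak_deriv_of u g \<Longrightarrow> integrable circ g"
  by (auto simp: weak_deriv_of_def intro: square_integrable_circ_integrable)

lemma weak_deriv_test:
  assumes "weak_deriv_of u g" "smooth \<phi>" "periodic \<phi>"
  shows "(LINT t|circ. deriv \<phi> t *\<^sub>R u t) = - (LINT t|circ. \<phi> t *\<^sub>R g t)"
  using assms unfolding weak_deriv_of_def avg_def by (auto simp flip: scaleR_minus_right)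

text \<open>\<open>wderiv\<close> is an arbitrary choice; this is what permits replacing it by an
  explicit derivative under \<open>avg\<close>.\<close>

lemma weak_deriv_unique:
  assumes g: "weak_deriv_of u g" and h: "weak_deriv_of u h"
  shows "AE t in circ. g t = h t"
proof -
  note i = weak_deriv_integrable[OF g] weak_deriv_integrable[OF h]
  have "AE t in circ. g t - h t = 0"
  proof (rule AE_circ_zero_if_test_integrals_zero)
    fix \<phi> :: "real \<Rightarrow> real" assume s: "smooth \<phi>" "periodic \<phi>"
    show "(LINT t|circ. \<phi> t *\<^sub>R (g t - h t)) = 0"
      using weak_deriv_test[OF g s] weak_deriv_test[OF h s]
        integrable_circ_continuous_scaleR[OF smooth_continuous[OF s(1)] i(1)]
        integrable_circ_continuous_scaleR[OF smooth_continuous[OF s(1)] i(2)]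
      by (simp add: scaleR_diff_right)
  qed (use i in auto)
  then show ?thesis by auto
qed

lemma H1_per_wderiv: "u \<in> H1_per \<Longrightarrow> weak_deriv_of u (wderiv u)"
  unfolding wderiv_def H1_per_def using someI_ex[of "weak_deriv_of u"] by blast

lemma weak_deriv_add:
  assumes u: "continuous_on UNIV u" "weak_deriv_of u g" and v: "continuous_on UNIV v" "weak_deriv_of v h"
  shows "weak_deriv_of (\<lambda>t. u t + v t) (\<lambda>t. g t + h t)"
  unfolding weak_deriv_of_def
proof safe
  show "square_integrable circ (\<lambda>t. g t + h t)"
    using u v by (auto simp: weak_deriv_of_def intro: square_integrable_add)
  fix \<phi> :: "real \<Rightarrow> real" assume s: "smooth \<phi>" "periodic \<phi>"
  have "(LINT t|circ. deriv \<phi> t *\<^sub>R (u t + v t)) = (LINT t|circ. deriv \<phi> t *\<^sub>R u t) + (LINT t|circ. deriv \<phi> t *\<^sub>R v t)"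
    using u v smooth_DERIV(2)[OF s(1)]
    by (simp add: scaleR_add_right integrable_circ_continuous_scaleR integrable_circ_continuous)
  moreover have "(LINT t|circ. \<phi> t *\<^sub>R (g t + h t)) = (LINT t|circ. \<phi> t *\<^sub>R g t) + (LINT t|circ. \<phi> t *\<^sub>R h t)"
    using u v smooth_continuous[OF s(1)]
    by (simp add: scaleR_add_right integrable_circ_continuous_scaleR weak_deriv_integrable)
  ultimately show "avg (\<lambda>t. deriv \<phi> t *\<^sub>R (u t + v t)) = - avg (\<lambda>t. \<phi> t *\<^sub>R (g t + h t))"
    using weak_deriv_test[OF u(2) s] weak_deriv_test[OF v(2) s]
    by (simp add: avg_def scaleR_diff_right scaleR_add_right)
qed

lemma H1_per_add:
  assumes "u \<in> H1_per" "v \<in> H1_per"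
  shows "(\<lambda>t. u t + v t) \<in> H1_per"
    and "AE t in circ. wderiv (\<lambda>t. u t + v t) t = wderiv u t + wderiv v t"
proof -
  have *: "weak_deriv_of (\<lambda>t. u t + v t) (\<lambda>t. wderiv u t + wderiv v t)"
    using assms by (intro weak_deriv_add H1_per_wderiv) (auto simp: H1_per_def)
  then show 1: "(\<lambda>t. u t + v t) \<in> H1_per"
    using assms by (auto simp: H1_per_def periodic_def intro!: continuous_intros)
  show "AE t in circ. wderiv (\<lambda>t. u t + v t) t = wderiv u t + wderiv v t"
    by (rule weak_deriv_unique[OF H1_per_wderiv[OF 1] *])
qed


section \<open>Primitives of integrable functions and the fundamental theorem for weak
  derivatives\<close>

lemma norm_integral_circ_le:
  fixes g :: "real \<Rightarrow> 'a::euclidean_space"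
  assumes "integrable circ g" "0 \<le> s" "s \<le> t" "t \<le> 2 * pi"
  shows "norm (integral {s..t} g) \<le> (LINT t|circ. norm (g t))"
    and "integral {0..t} g - integral {0..s} g = integral {s..t} g"
proof -
  have sub: "integrable (lebesgue_on {a..b}) g" if "0 \<le> a" "b \<le> 2 * pi" for a b
    by (rule integrable_subinterval[OF assms(1)]) (use that in auto)
  then have "integral {s..t} g = (LINT t|lebesgue_on {s..t}. g t)"
    using assms by (subst lebesgue_integral_eq_integral) auto
  also have "norm \<dots> \<le> (LINT t|lebesgue_on {s..t}. norm (g t))"
    by (rule integral_norm_bound)
  also have "\<dots> = integral {s..t} (\<lambda>t. norm (g t))"
    using assms by (intro lebesgue_integral_eq_integral integrable_norm sub) auto
  also have "\<dots> \<le> integral {0..2*pi} (\<lambda>t. norm (g t))"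
    using assms sub[of s t] by (intro integral_subset_le integrable_on_lebesgue_on integrable_norm) auto
  also have "\<dots> = (LINT t|circ. norm (g t))"
    using assms by (subst lebesgue_integral_eq_integral) auto
  finally show "norm (integral {s..t} g) \<le> (LINT t|circ. norm (g t))" .
  show "integral {0..t} g - integral {0..s} g = integral {s..t} g"
    using assms Henstock_Kurzweil_Integration.integral_combine[of 0 s t g] integrable_on_lebesgue_on[OF sub[of 0 t]]
    by (simp add: algebra_simps)
qed

lemma primitive_eq_indicator_integral:
  fixes g :: "real \<Rightarrow> 'a::euclidean_space"
  assumes "integrable circ g" "0 \<le> t" "t \<le> 2 * pi"
  shows "integral {0..t} g = (LINT s|circ. indicator {0..t} s *\<^sub>R g s)"
proof -
  have "integral {0..t} g = (LINT s|lebesgue_on {0..t}. g s)"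
    using assms integrable_subinterval[OF assms(1), of 0 t]
    by (subst lebesgue_integral_eq_integral) auto
  also have "\<dots> = (LINT s|lebesgue. indicator {0..t} s *\<^sub>R g s)"
    by (rule integral_restrict_space) simp
  also have "\<dots> = (LINT s|lebesgue. indicator {0..2*pi} s *\<^sub>R (indicator {0..t} s *\<^sub>R g s))"
    using assms by (intro Bochner_Integration.integral_cong) (auto simp: indicator_def)
  also have "\<dots> = (LINT s|circ. indicator {0..t} s *\<^sub>R g s)"
    by (rule integral_restrict_space[symmetric]) simp
  finally show ?thesis .
qed

lemma pair_sigma_finite_circ: "sigma_finite_measure N \<Longrightarrow> pair_sigma_finite circ N"
  using sigma_finite_circ by (simp add: pair_sigma_finite_def)

lemma smooth_integral_deriv:
  assumes "smooth \<phi>" "0 \<le> s" "s \<le> 2 * pi"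
  shows "(LINT t|circ. indicator {s..2*pi} t * deriv \<phi> t) = \<phi> (2*pi) - \<phi> s"
proof -
  have i: "integrable circ (deriv \<phi>)"
    using smooth_DERIV(2)[OF assms(1)] by (rule integrable_circ_continuous)
  have "(LINT t|circ. indicator {s..2*pi} t * deriv \<phi> t) = (LINT t|lebesgue_on {s..2*pi}. deriv \<phi> t)"
  proof -
    have "(LINT t|lebesgue_on {s..2*pi}. deriv \<phi> t) = (LINT t|lebesgue. indicator {s..2*pi} t *\<^sub>R deriv \<phi> t)"
      by (rule integral_restrict_space) simp
    also have "\<dots> = (LINT t|lebesgue. indicator {0..2*pi} t *\<^sub>R (indicator {s..2*pi} t *\<^sub>R deriv \<phi> t))"
      using assms by (intro Bochner_Integration.integral_cong) (auto simp: indicator_def)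
    also have "\<dots> = (LINT t|circ. indicator {s..2*pi} t *\<^sub>R deriv \<phi> t)"
      by (rule integral_restrict_space[symmetric]) simp
    finally show ?thesis by simp
  qed
  also have "\<dots> = integral {s..2*pi} (deriv \<phi>)"
    using assms integrable_subinterval[OF i, of s "2*pi"] by (subst lebesgue_integral_eq_integral) auto
  also have "\<dots> = \<phi> (2*pi) - \<phi> s"
    by (rule integral_unique[OF fundamental_theorem_of_calculus])
       (use assms smooth_DERIV(1) in \<open>auto simp: has_real_derivative_iff_has_vector_derivative intro: has_vector_derivative_at_within\<close>)
  finally show ?thesis .
qed

text \<open>Integration by parts when the primitive belongs to a merely integrable function: Fubini
  on the triangle \<open>r \<le> t\<close>, where the inner integral of \<open>deriv \<phi>\<close>
  over [r, 2 pi] is a difference of values of \<open>\<phi>\<close>.\<close>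

lemma integral_deriv_mult_primitive:
  fixes g :: "real \<Rightarrow> complex"
  assumes g: "integrable circ g" and s: "smooth \<phi>"
  shows "(LINT t|circ. deriv \<phi> t *\<^sub>R integral {0..t} g) =
    \<phi> (2*pi) *\<^sub>R (LINT t|circ. g t) - (LINT t|circ. \<phi> t *\<^sub>R g t)"
proof -
  interpret P: pair_sigma_finite circ circ by (rule pair_sigma_finite_circ[OF sigma_finite_circ])
  have mg: "g \<in> borel_measurable circ" using g by simp
  have md: "deriv \<phi> \<in> borel_measurable circ"
    by (rule continuous_circ_measurable[OF smooth_DERIV(2)[OF s]])
  obtain B where B: "B > 0" "\<And>t. t \<in> {0..2*pi} \<Longrightarrow> norm (deriv \<phi> t) \<le> B"
    using continuous_circ_bounded[OF smooth_DERIV(2)[OF s]] by blast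
  let ?f = "\<lambda>(t, r). (if r \<le> t then 1 else 0::real) *\<^sub>R (deriv \<phi> t *\<^sub>R g r)"
  have mf: "?f \<in> borel_measurable (circ \<Otimes>\<^sub>M circ)"
    using mg md by measurable
  have "integrable (circ \<Otimes>\<^sub>M circ) (\<lambda>(t, r). B *\<^sub>R (norm (g r)))"
  proof -
    have "integrable (circ \<Otimes>\<^sub>M circ) (\<lambda>(t, r). B * norm (g r))"
    proof (rule P.Fubini_integrable)
      show "(\<lambda>(t, r). B * norm (g r)) \<in> borel_measurable (circ \<Otimes>\<^sub>M circ)" using mg by measurable
      show "integrable circ (\<lambda>x. LINT y|circ. norm (case (x, y) of (t, r) \<Rightarrow> B * norm (g r)))"
        by simp
      show "AE x in circ. integrable circ (\<lambda>y. case (x, y) of (t, r) \<Rightarrow> B * norm (g r))"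
        using g by simp
    qed
    then show ?thesis by simp
  qed
  then have int: "integrable (circ \<Otimes>\<^sub>M circ) ?f"
  proof (rule Bochner_Integration.integrable_bound[OF _ mf], intro AE_I2)
    fix x assume "x \<in> space (circ \<Otimes>\<^sub>M circ)"
    then have "fst x \<in> {0..2*pi}" by (auto simp: space_pair_measure)
    then show "norm (?f x) \<le> norm (case x of (t, r) \<Rightarrow> B *\<^sub>R norm (g r))"
      using B(1) B(2)[of "fst x"] by (auto simp: case_prod_beta mult_right_mono)
  qed
  have "(LINT t|circ. deriv \<phi> t *\<^sub>R integral {0..t} g) = (LINT t|circ. LINT r|circ. ?f (t, r))"
  proof (rule Bochner_Integration.integral_cong)
    fix t assume "t \<in> space circ"
    then have t: "0 \<le> t" "t \<le> 2*pi" by auto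
    have "deriv \<phi> t *\<^sub>R integral {0..t} g = (LINT r|circ. deriv \<phi> t *\<^sub>R (indicator {0..t} r *\<^sub>R g r))"
      by (simp only: primitive_eq_indicator_integral[OF g t] integral_scaleR_right)
    also have "\<dots> = (LINT r|circ. ?f (t, r))"
      by (rule Bochner_Integration.integral_cong) (auto simp: indicator_def)
    finally show "deriv \<phi> t *\<^sub>R integral {0..t} g = (LINT r|circ. ?f (t, r))" .
  qed simp
  also have "\<dots> = (LINT r|circ. LINT t|circ. ?f (t, r))"
    using P.Fubini_integral[OF int] by simp
  also have "\<dots> = (LINT r|circ. (\<phi> (2*pi) - \<phi> r) *\<^sub>R g r)"
  proof (rule Bochner_Integration.integral_cong)
    fix r assume "r \<in> space circ"
    then have r: "0 \<le> r" "r \<le> 2*pi" by auto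
    have "(LINT t|circ. ?f (t, r)) = (LINT t|circ. (indicator {r..2*pi} t * deriv \<phi> t) *\<^sub>R g r)"
      by (rule Bochner_Integration.integral_cong) (auto simp: indicator_def)
    also have "\<dots> = (\<phi> (2*pi) - \<phi> r) *\<^sub>R g r"
    proof -
      have "integrable circ (\<lambda>t. indicator {r..2*pi} t *\<^sub>R deriv \<phi> t)"
        by (rule integrable_mult_indicator[OF _ integrable_circ_continuous[OF smooth_DERIV(2)[OF s]]])
           (use r in \<open>auto simp: sets_restrict_space_iff\<close>)
      then show ?thesis using smooth_integral_deriv[OF s r] by simp
    qed
    finally show "(LINT t|circ. ?f (t, r)) = (\<phi> (2*pi) - \<phi> r) *\<^sub>R g r" .
  qed simp
  also have "\<dots> = \<phi> (2*pi) *\<^sub>R (LINT t|circ. g t) - (LINT t|circ. \<phi> t *\<^sub>R g t)"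
    using g integrable_circ_continuous_scaleR[OF smooth_continuous[OF s] g]
    by (simp add: scaleR_diff_left)
  finally show ?thesis .
qed


text \<open>An antiderivative changes over one period by a constant, and this constant is the
  integral of \<open>\<psi>\<close>; mean zero is therefore what makes it periodic.\<close>

lemma periodic_antiderivative:
  assumes s: "smooth \<psi>" "periodic \<psi>" and mean: "(LINT t|circ. \<psi> t) = 0"
  obtains \<phi> where "smooth \<phi>" "periodic \<phi>" "deriv \<phi> = \<psi>"
proof -
  have "\<exists>F. \<forall>x :: real. -\<infinity> < ereal x \<longrightarrow> ereal x < \<infinity> \<longrightarrow> (F has_vector_derivative \<psi> x) (at x)"
    using smooth_continuous[OF s(1)] by (intro einterval_antiderivative) (auto simp: continuous_on_eq_continuous_at)
  then obtain F where F: "\<And>x. (F has_real_derivative \<psi> x) (at x)"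
    by (auto simp: has_real_derivative_iff_has_vector_derivative)
  have "periodic F"
    unfolding periodic_def
  proof
    fix t
    have "((\<lambda>t. F (t + 2*pi) - F t) has_real_derivative 0) (at x)" for x
    proof -
      have "((\<lambda>t. F (t + 2*pi)) has_real_derivative \<psi> (x + 2*pi)) (at x)"
        using F[of "x + 2*pi"] by (simp add: DERIV_shift)
      then have "((\<lambda>t. F (t + 2*pi) - F t) has_real_derivative \<psi> (x + 2*pi) - \<psi> x) (at x)"
        using F by (rule DERIV_diff)
      then show ?thesis using s(2) by (simp add: periodic_def)
    qed
    then have "F (t + 2*pi) - F t = F (0 + 2*pi) - F 0"
      using DERIV_isconst_all[of "\<lambda>t. F (t + 2*pi) - F t" t 0] by blast
    moreover have "integral {0..2*pi} \<psi> = F (2*pi) - F 0"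
      by (rule integral_unique[OF fundamental_theorem_of_calculus])
         (use F in \<open>auto simp: has_real_derivative_iff_has_vector_derivative intro: has_vector_derivative_at_within\<close>)
    moreover have "integral {0..2*pi} \<psi> = 0"
      using mean lebesgue_integral_eq_integral[OF integrable_circ_continuous[OF smooth_continuous[OF s(1)]]] by simp
    ultimately show "F (t + 2*pi) = F t" by simp
  qed
  moreover have "deriv F = \<psi>" using F DERIV_imp_deriv by blast
  ultimately show ?thesis using that smooth_antideriv[OF s(1) F] by blast
qed

lemma primitive_continuous:
  fixes g :: "real \<Rightarrow> 'a::euclidean_space"
  assumes "integrable circ g"
  shows "continuous_on {0..2*pi} (\<lambda>t. integral {0..t} g)"
  by (rule indefinite_integral_continuous_1[OF integrable_on_lebesgue_on[OF assms]]) simp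

lemma weak_deriv_mean_zero:
  assumes "weak_deriv_of u g" shows "(LINT t|circ. g t) = 0"
  using weak_deriv_test[OF assms smooth_const[of 1]] by (simp add: periodic_def)

text \<open>In the open interval the set where \<open>V\<close> differs from \<open>c\<close> is
  open and null, hence empty; the end points follow by continuity.\<close>

lemma AE_eq_const_continuous:
  fixes V :: "real \<Rightarrow> 'a::euclidean_space"
  assumes c: "continuous_on {0..2*pi} V" and AE: "AE t in circ. V t = c"
  shows "\<forall>t\<in>{0..2*pi}. V t = c"
proof -
  define S where "S = {0<..<2*pi} \<inter> V -` (- {c})"
  have "open S" unfolding S_def
    by (rule continuous_open_preimage) (use c in \<open>auto intro: continuous_on_subset\<close>)
  have "AE t in lebesgue. t \<in> {0..2*pi} \<longrightarrow> V t = c"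
    using AE by (subst (asm) AE_restrict_space_iff) auto
  then have "AE t in lebesgue. t \<notin> S" by eventually_elim (auto simp: S_def)
  then have "S \<in> null_sets lebesgue"
    using \<open>open S\<close> by (subst AE_iff_null_sets) auto
  then have "S = {}"
    using open_not_negligible[OF \<open>open S\<close>] by (auto simp: negligible_iff_null_sets)
  then have i: "\<And>t. t \<in> {0<..<2*pi} \<Longrightarrow> V t = c" by (auto simp: S_def)
  show ?thesis
    using continuous_constant_on_closure[of "{0<..<2*pi}" V c] c i by auto
qed

text \<open>The du Bois-Reymond argument: \<open>u\<close> minus the primitive of \<open>g\<close>
  annihilates the derivative of every periodic test function, hence is almost everywhere equal to
  its mean, and everywhere by continuity.\<close>

theorem weak_deriv_FTC:
  assumes u: "continuous_on UNIV u" "weak_deriv_of u g" and t: "t \<in> {0..2*pi}"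
  shows "u t = u 0 + integral {0..t} g"
proof -
  note g = weak_deriv_integrable[OF u(2)]
  define V where "V = (\<lambda>t. u t - integral {0..t} g)"
  have cV: "continuous_on {0..2*pi} V" unfolding V_def
    by (intro continuous_intros primitive_continuous g continuous_on_subset[OF u(1)]) auto
  have iG: "integrable circ (\<lambda>t. integral {0..t} g)"
    by (rule continuous_imp_integrable_real[OF primitive_continuous[OF g]])
  have iV: "integrable circ V" unfolding V_def
    using iG integrable_circ_continuous[OF u(1)] by simp
  define c where "c = avg V"
  have "AE t in circ. V t - c = 0"
  proof (rule AE_circ_zero_if_test_integrals_zero)
    show "integrable circ (\<lambda>t. V t - c)" using iV integrable_circ_continuous[of "\<lambda>_. c"] by simp
    fix \<psi> :: "real \<Rightarrow> real" assume s: "smooth \<psi>" "periodic \<psi>"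
    note i\<psi> = integrable_circ_continuous[OF smooth_continuous[OF s(1)]]
    \<comment> \<open>An arbitrary test function is a derivative of a periodic one only after its
      mean is removed; the mean reappears as the pairing with the constant \<open>c\<close>.\<close>
    define m where "m = avg \<psi>"
    have "smooth (\<lambda>t. \<psi> t - m)" "periodic (\<lambda>t. \<psi> t - m)" using s by (auto simp: periodic_def)
    moreover have "(LINT t|circ. \<psi> t - m) = 0"
      using i\<psi> integral_circ_const[of m] integrable_circ_continuous[of "\<lambda>_. m"] by (simp add: m_def avg_def)
    ultimately obtain \<phi> where \<phi>: "smooth \<phi>" "periodic \<phi>" "deriv \<phi> = (\<lambda>t. \<psi> t - m)"
      using periodic_antiderivative by blast
    \<comment> \<open>The boundary term of \<open>integral_deriv_mult_primitive\<close> drops out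
      because a weak derivative of a periodic curve has mean zero (test with 1).\<close>
    have "(LINT t|circ. deriv \<phi> t *\<^sub>R V t) = 0"
      using weak_deriv_test[OF u(2) \<phi>(1,2)] integral_deriv_mult_primitive[OF g \<phi>(1)] weak_deriv_mean_zero[OF u(2)]
        integrable_circ_continuous_scaleR[OF smooth_DERIV(2)[OF \<phi>(1)] iG]
        integrable_circ_continuous_scaleR[OF smooth_DERIV(2)[OF \<phi>(1)] integrable_circ_continuous[OF u(1)]]
      by (simp add: V_def scaleR_diff_right)
    then have "(LINT t|circ. \<psi> t *\<^sub>R V t) = m *\<^sub>R (LINT t|circ. V t)"
      using integrable_circ_continuous_scaleR[OF smooth_continuous[OF s(1)] iV] iV
      by (simp add: \<phi>(3) scaleR_diff_left)
    moreover have "(LINT t|circ. \<psi> t *\<^sub>R c) = m *\<^sub>R (LINT t|circ. V t)"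
      using i\<psi> by (simp add: m_def c_def avg_def mult.commute)
    moreover have "(LINT t|circ. \<psi> t *\<^sub>R (V t - c)) = (LINT t|circ. \<psi> t *\<^sub>R V t) - (LINT t|circ. \<psi> t *\<^sub>R c)"
      unfolding scaleR_diff_right
      by (rule Bochner_Integration.integral_diff) (use integrable_circ_continuous_scaleR[OF smooth_continuous[OF s(1)] iV] i\<psi> in auto)
    ultimately show "(LINT t|circ. \<psi> t *\<^sub>R (V t - c)) = 0" by simp
  qed
  then have "AE t in circ. V t = c" by auto
  from AE_eq_const_continuous[OF cV this] have "V t = V 0" using t by auto
  then show ?thesis by (simp add: V_def algebra_simps)
qed

lemma periodic_reduce:
  assumes "periodic f" obtains s where "s \<in> {0..2*pi}" "f t = f s"
proof -
  have p: "f (x + 2*pi * real n) = f x" for x n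
  proof (induction n)
    case (Suc n)
    have "f (x + 2*pi * real n + 2*pi) = f (x + 2*pi * real n)" using assms by (simp add: periodic_def)
    then show ?case using Suc by (simp add: algebra_simps)
  qed simp
  define k where "k = \<lfloor>t / (2*pi)\<rfloor>"
  have k: "2*pi * k \<le> t" "t \<le> 2*pi * k + 2*pi"
  proof -
    have "of_int k \<le> t / (2*pi)" "t / (2*pi) < of_int k + 1"
      unfolding k_def using floor_correct[of "t / (2*pi)"] by auto
    then show "2*pi * k \<le> t" "t \<le> 2*pi * k + 2*pi"
      by (simp_all add: pos_le_divide_eq pos_divide_less_eq algebra_simps)
  qed
  have "f t = f (t - 2*pi * k)"
  proof (cases "k \<ge> 0")
    case True
    then show ?thesis using p[of "t - 2*pi*k" "nat k"] by simp
  next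
    case False
    then show ?thesis using p[of t "nat (-k)"] by simp
  qed
  then show ?thesis using k by (intro that[of "t - 2*pi*k"]) auto
qed

text \<open>The variance of \<open>norm (g t)\<close> is nonnegative.\<close>

lemma avg_norm_le:
  fixes g :: "real \<Rightarrow> 'a::euclidean_space"
  assumes "square_integrable circ g"
  shows "avg (\<lambda>t. norm (g t)) \<le> sqrt (avg (\<lambda>t. (norm (g t))\<^sup>2))"
proof (rule real_le_rsqrt)
  define m where "m = avg (\<lambda>t. norm (g t))"
  have i1: "integrable circ (\<lambda>t. norm (g t))" using square_integrable_circ_integrable[OF assms] by simp
  have i2: "integrable circ (\<lambda>t. (norm (g t))\<^sup>2)" using assms by (simp add: square_integrable_def)
  have "0 \<le> (LINT t|circ. (norm (g t) - m)\<^sup>2)" by simp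
  also have "\<dots> = (LINT t|circ. (norm (g t))\<^sup>2 - 2 * m * norm (g t) + m\<^sup>2)"
    by (simp add: power2_eq_square algebra_simps)
  also have "\<dots> = (LINT t|circ. (norm (g t))\<^sup>2) - 2 * m * (LINT t|circ. norm (g t)) + 2*pi * m\<^sup>2"
    using i1 i2 integral_circ_const[of "m\<^sup>2"] integrable_circ_continuous[of "\<lambda>_. m\<^sup>2"] by simp
  also have "(LINT t|circ. norm (g t)) = 2*pi * m" by (simp add: m_def avg_def)
  finally have "0 \<le> (LINT t|circ. (norm (g t))\<^sup>2) - 2*pi * m\<^sup>2" by (simp add: power2_eq_square algebra_simps)
  then show "(avg (\<lambda>t. norm (g t)))\<^sup>2 \<le> avg (\<lambda>t. (norm (g t))\<^sup>2)"
    unfolding m_def[symmetric] by (simp add: avg_def field_simps)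
qed

lemma continuous_square_integrable:
  fixes u :: "real \<Rightarrow> 'a::euclidean_space"
  assumes "continuous_on UNIV u" shows "square_integrable circ u"
  unfolding square_integrable_def
  by (intro conjI continuous_circ_measurable integrable_circ_continuous continuous_intros assms)

lemma H1_norm_bounds:
  shows "0 \<le> H1_norm u"
    and "sqrt (avg (\<lambda>t. (norm (u t))\<^sup>2)) \<le> H1_norm u" "L_fun u \<le> H1_norm u"
    "sqrt (avg (\<lambda>t. (norm (wderiv u t))\<^sup>2)) \<le> H1_norm u"
  by (auto simp: H1_norm_def L_fun_def avg_def)

text \<open>The oscillation of \<open>u\<close> is at most the integral of its speed; averaging over
  the base point bounds one value by the mean of the norm plus this oscillation. The 1 comes from
  the mean, the 2 pi from the integral being 2 pi times an average. This converts Sobolev smallness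
  into uniform closeness of curves.\<close>

theorem H1_sup_bound:
  assumes u: "u \<in> H1_per"
  shows "norm (u t) \<le> (1 + 2*pi) * H1_norm u"
proof -
  obtain r where r: "r \<in> {0..2*pi}" "u t = u r"
    using u periodic_reduce[of u t] by (auto simp: H1_per_def)
  have c: "continuous_on UNIV u" using u by (simp add: H1_per_def)
  have w: "weak_deriv_of u (wderiv u)" by (rule H1_per_wderiv[OF u])
  note iw = weak_deriv_integrable[OF w]
  define N where "N = (LINT t|circ. norm (wderiv u t))"
  have le: "norm (u r) \<le> norm (u s) + N" if "s \<in> {0..2*pi}" for s
  proof -
    have "norm (u r - u s) \<le> N"
    proof (cases "s \<le> r")
      case True
      then show ?thesis
        using norm_integral_circ_le[OF iw, of s r] weak_deriv_FTC[OF c w, of r] weak_deriv_FTC[OF c w, of s] r(1) that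
        by (simp add: N_def)
    next
      case False
      then show ?thesis
        using norm_integral_circ_le[OF iw, of r s] weak_deriv_FTC[OF c w, of r] weak_deriv_FTC[OF c w, of s] r(1) that
          norm_minus_commute[of "u r" "u s"]
        by (simp add: N_def)
    qed
    then show ?thesis using norm_triangle_sub[of "u r" "u s"] by linarith
  qed
  have iu: "integrable circ (\<lambda>s. norm (u s))" using integrable_circ_continuous[OF c] by simp
  have "(LINT s|circ. norm (u r)) \<le> (LINT s|circ. norm (u s) + N)"
    by (rule integral_mono) (use le iu integrable_circ_continuous[of "\<lambda>_. norm (u r)"] integrable_circ_continuous[of "\<lambda>_. N"] in auto)
  also have "\<dots> = (LINT s|circ. norm (u s)) + 2*pi*N"
    using iu integrable_circ_continuous[of "\<lambda>_. N"] integral_circ_const[of N] by simp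
  finally have "2*pi * norm (u r) \<le> (LINT s|circ. norm (u s)) + 2*pi*N"
    by (simp only: integral_circ_const real_scaleR_def)
  then have "norm (u r) \<le> avg (\<lambda>s. norm (u s)) + 2*pi * avg (\<lambda>t. norm (wderiv u t))"
    by (simp add: avg_def N_def field_simps)
  also have "avg (\<lambda>s. norm (u s)) \<le> H1_norm u"
    using avg_norm_le[OF continuous_square_integrable[OF c]] H1_norm_bounds(2)[of u] by linarith
  also have "avg (\<lambda>t. norm (wderiv u t)) \<le> H1_norm u"
    using avg_norm_le[of "wderiv u"] w H1_norm_bounds(4)[of u] by (simp add: weak_deriv_of_def)
  finally show ?thesis by (simp add: r(2) algebra_simps)
qed

section \<open>Winding numbers of Sobolev curves\<close>

text \<open>The radial retraction onto the closed disc of radius \<open>K\<close>; writing it with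
  \<open>max\<close> gives continuity without a case distinction.\<close>

definition clamp_norm :: "real \<Rightarrow> complex \<Rightarrow> complex" where
  "clamp_norm K z = (K / max K (norm z)) *\<^sub>R z"

lemma clamp_norm:
  assumes "K > 0"
  shows "continuous_on UNIV (clamp_norm K)" "norm (clamp_norm K z) \<le> K"
    "norm z \<le> K \<Longrightarrow> clamp_norm K z = z" "norm (z - clamp_norm K z) \<le> norm z"
proof -
  have pos: "max K (norm z) > 0" for z :: complex using assms by auto
  show "continuous_on UNIV (clamp_norm K)"
    unfolding clamp_norm_def using pos by (intro continuous_intros) (metis less_irrefl)
  show "norm (clamp_norm K z) \<le> K"
    using assms pos[of z] by (auto simp: clamp_norm_def field_simps max_def)
  show "norm z \<le> K \<Longrightarrow> clamp_norm K z = z" using assms by (simp add: clamp_norm_def max_def)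
  have "z - clamp_norm K z = (1 - K / max K (norm z)) *\<^sub>R z"
    by (simp add: clamp_norm_def algebra_simps)
  moreover have "0 \<le> 1 - K / max K (norm z)" "1 - K / max K (norm z) \<le> 1"
    using assms pos[of z] by (auto simp: field_simps)
  ultimately show "norm (z - clamp_norm K z) \<le> norm z"
    by (simp add: mult_left_le_one_le)
qed

text \<open>Density of continuous functions in the mean, in two halves of size e/2: first
  \<open>g\<close> is clamped at a large radius, then the clamped function is approximated by
  clamped continuous functions. Clamping the approximants too gives the constant bound
  \<open>2 * K\<close> for dominated convergence.\<close>

lemma integrable_circ_approx_continuous:
  fixes g :: "real \<Rightarrow> complex"
  assumes g: "integrable circ g" and e: "e > 0"
  obtains h where "continuous_on UNIV h" "(LINT t|circ. norm (g t - h t)) < e"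
proof -
  have mg: "g \<in> borel_measurable circ" using g by simp
  have mc: "clamp_norm K \<in> borel_measurable borel" if "K > 0" for K
    using clamp_norm(1)[OF that] by (rule borel_measurable_continuous_onI)
  have "(\<lambda>n. LINT t|circ. norm (g t - clamp_norm (real (Suc n)) (g t))) \<longlonglongrightarrow> (LINT t|circ. 0)"
  proof (rule integral_dominated_convergence[where w="\<lambda>t. norm (g t)"])
    show "(\<lambda>t. norm (g t - clamp_norm (real (Suc n)) (g t))) \<in> borel_measurable circ" for n
      using mg measurable_compose[OF mg mc[of "real (Suc n)"]] by simp
    show "integrable circ (\<lambda>t. norm (g t))" using g by simp
    show "AE t in circ. (\<lambda>n. norm (g t - clamp_norm (real (Suc n)) (g t))) \<longlonglongrightarrow> 0"
    proof (rule AE_I2)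
      fix t
      obtain N where N: "norm (g t) \<le> real N" using real_arch_simple by blast
      have "norm (g t - clamp_norm (real (Suc n)) (g t)) = 0" if "n \<ge> N" for n
        using N that clamp_norm(3)[of "real (Suc n)" "g t"] by simp
      then show "(\<lambda>n. norm (g t - clamp_norm (real (Suc n)) (g t))) \<longlonglongrightarrow> 0"
        by (intro tendsto_eventually) (auto simp: eventually_sequentially)
    qed
    show "AE t in circ. norm (norm (g t - clamp_norm (real (Suc n)) (g t))) \<le> norm (g t)" for n
      using clamp_norm(4)[of "real (Suc n)"] by (intro AE_I2) simp
  qed simp
  then have "\<forall>\<^sub>F n in sequentially. (LINT t|circ. norm (g t - clamp_norm (real (Suc n)) (g t))) < e/2"
    by (rule order_tendstoD) (use e in simp)
  then obtain n where n: "(LINT t|circ. norm (g t - clamp_norm (real (Suc n)) (g t))) < e/2"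
    by (auto simp: eventually_sequentially)
  define K where "K = real (Suc n)"
  have K: "K > 0" by (simp add: K_def)
  \<comment> \<open>By definition this notion of measurability supplies continuous functions
    converging to \<open>g\<close> off a negligible set.\<close>
  have "g measurable_on {0..2*pi}"
    using mg by (subst measurable_on_iff_borel_measurable) auto
  then obtain N h where N: "negligible N" and h: "\<And>n. continuous_on UNIV (h n)"
    and lim: "\<And>t. t \<notin> N \<Longrightarrow> (\<lambda>n. h n t) \<longlonglongrightarrow> (if t \<in> {0..2*pi} then g t else 0)"
    unfolding measurable_on_def by blast
  have hc: "continuous_on UNIV (\<lambda>t. clamp_norm K (h n t))" for n
    by (rule continuous_on_compose2[OF clamp_norm(1)[OF K] h]) simp
  have mK: "(\<lambda>t. clamp_norm K (g t)) \<in> borel_measurable circ"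
    by (rule measurable_compose[OF mg mc[OF K]])
  have "(\<lambda>n. LINT t|circ. norm (clamp_norm K (g t) - clamp_norm K (h n t))) \<longlonglongrightarrow> (LINT t|circ. 0)"
  proof (rule integral_dominated_convergence[where w="\<lambda>t. 2 * K"])
    show "(\<lambda>t. norm (clamp_norm K (g t) - clamp_norm K (h n t))) \<in> borel_measurable circ" for n
      using mK continuous_circ_measurable[OF hc] by simp
    show "integrable circ (\<lambda>t. 2 * K)" by (rule integrable_circ_continuous) (intro continuous_intros)
    have "AE t in lebesgue. t \<notin> N"
      using N by (simp add: negligible_iff_null_sets AE_not_in)
    then have "AE t in circ. t \<notin> N" by (subst AE_restrict_space_iff) auto
    then show "AE t in circ. (\<lambda>n. norm (clamp_norm K (g t) - clamp_norm K (h n t))) \<longlonglongrightarrow> 0"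
    proof (rule AE_mp, intro AE_I2 impI)
      fix t assume t: "t \<in> space circ" "t \<notin> N"
      then have "(\<lambda>n. h n t) \<longlonglongrightarrow> g t" using lim[of t] by auto
      then have "(\<lambda>n. clamp_norm K (h n t)) \<longlonglongrightarrow> clamp_norm K (g t)"
        using clamp_norm(1)[OF K] by (intro isCont_tendsto_compose[of _ "clamp_norm K"]) (auto simp: continuous_on_eq_continuous_at)
      then have "(\<lambda>n. norm (clamp_norm K (g t) - clamp_norm K (h n t))) \<longlonglongrightarrow> norm (clamp_norm K (g t) - clamp_norm K (g t))"
        by (intro tendsto_intros)
      then show "(\<lambda>n. norm (clamp_norm K (g t) - clamp_norm K (h n t))) \<longlonglongrightarrow> 0" by simp
    qed
    show "AE t in circ. norm (norm (clamp_norm K (g t) - clamp_norm K (h n t))) \<le> 2 * K" for n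
    proof (rule AE_I2)
      fix t
      show "norm (norm (clamp_norm K (g t) - clamp_norm K (h n t))) \<le> 2 * K"
        using clamp_norm(2)[OF K, of "g t"] clamp_norm(2)[OF K, of "h n t"]
          norm_triangle_ineq4[of "clamp_norm K (g t)" "clamp_norm K (h n t)"] by simp
    qed
  qed simp
  then have "\<forall>\<^sub>F n in sequentially. (LINT t|circ. norm (clamp_norm K (g t) - clamp_norm K (h n t))) < e/2"
    by (rule order_tendstoD) (use e in simp)
  then obtain m where m: "(LINT t|circ. norm (clamp_norm K (g t) - clamp_norm K (h m t))) < e/2"
    by (auto simp: eventually_sequentially)
  have iK: "integrable circ (\<lambda>t. clamp_norm K (g t))"
    by (rule finite_measure.integrable_const_bound[OF finite_measure_circ _ mK]) (use clamp_norm(2)[OF K] in auto)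
  have ih: "integrable circ (\<lambda>t. clamp_norm K (h m t))" by (rule integrable_circ_continuous[OF hc])
  have "(LINT t|circ. norm (g t - clamp_norm K (h m t)))
     \<le> (LINT t|circ. norm (g t - clamp_norm K (g t)) + norm (clamp_norm K (g t) - clamp_norm K (h m t)))"
  proof (rule integral_mono)
    fix t
    show "norm (g t - clamp_norm K (h m t)) \<le> norm (g t - clamp_norm K (g t)) + norm (clamp_norm K (g t) - clamp_norm K (h m t))"
      using norm_triangle_ineq[of "g t - clamp_norm K (g t)" "clamp_norm K (g t) - clamp_norm K (h m t)"] by simp
  qed (use g iK ih in auto)
  also have "\<dots> < e"
    using n[folded K_def] m g iK ih by simp
  finally show ?thesis using that[OF hc] by blast
qed

lemma integrable_circ_divide:
  fixes v g :: "real \<Rightarrow> complex"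
  assumes g: "integrable circ g" and v: "v \<in> borel_measurable circ"
    and \<kappa>: "\<kappa> > 0" "\<And>t. t \<in> {0..2*pi} \<Longrightarrow> norm (v t) \<ge> \<kappa>"
  shows "integrable circ (\<lambda>t. g t / v t)"
proof (rule Bochner_Integration.integrable_bound[where f="\<lambda>t. g t /\<^sub>R \<kappa>"])
  show "integrable circ (\<lambda>t. g t /\<^sub>R \<kappa>)" using g by simp
  show "(\<lambda>t. g t / v t) \<in> borel_measurable circ" using g v by (intro borel_measurable_divide) auto
  show "AE t in circ. norm (g t / v t) \<le> norm (g t /\<^sub>R \<kappa>)"
  proof (rule AE_I2)
    fix t assume "t \<in> space circ"
    then have "norm (v t) \<ge> \<kappa>" using \<kappa>(2) by simp
    then have "norm (g t) / norm (v t) \<le> norm (g t) / \<kappa>" using \<kappa>(1) by (intro frac_le) auto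
    then show "norm (g t / v t) \<le> norm (g t /\<^sub>R \<kappa>)"
      using \<kappa>(1) by (simp add: norm_mult norm_inverse divide_inverse mult.commute)
  qed
qed

text \<open>Keeps the quotient of the two curves off the branch cut of \<open>Ln\<close>.\<close>

lemma Re_pos_if_near:
  fixes v p :: complex
  assumes "norm (v - p) < norm p" shows "Re (v / p) > 0"
proof -
  have p: "p \<noteq> 0" using assms by auto
  have "norm (1 - v / p) = norm ((p - v) / p)" using p by (simp add: diff_divide_distrib)
  also have "\<dots> < 1" using assms p by (simp add: norm_divide norm_minus_commute)
  finally have "\<bar>Re (1 - v / p)\<bar> < 1" using abs_Re_le_cmod[of "1 - v / p"] by linarith
  then show ?thesis by simp
qed

text \<open>Rouche's principle: if the closed curve \<open>v\<close> stays closer to \<open>p\<close> than \<open>p\<close> is to the origin, both wind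
  equally often around the origin. Approximating the derivative of \<open>v\<close> in the mean by continuous
  functions reduces this to integrating the derivative of the principal logarithm of \<open>v / p\<close>.\<close>

lemma integral_log_deriv_eq:
  fixes v p p' g :: "real \<Rightarrow> complex"
  assumes g: "integrable circ g" "(LINT t|circ. g t) = 0"
    and v: "\<And>t. t \<in> {0..2*pi} \<Longrightarrow> v t = v 0 + integral {0..t} g" "v \<in> borel_measurable circ"
    and p: "\<And>t. (p has_vector_derivative p' t) (at t)" "continuous_on UNIV p'" "p (2*pi) = p 0"
    and \<kappa>: "\<kappa> > 0" "\<And>t. t \<in> {0..2*pi} \<Longrightarrow> norm (v t - p t) + \<kappa> \<le> norm (p t)"
  shows "(LINT t|circ. g t / v t) = (LINT t|circ. p' t / p t)"
proof -
  define D where "D = (LINT t|circ. g t / v t) - (LINT t|circ. p' t / p t)"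
  define N where "N = (LINT t|circ. norm (g t))"
  \<comment> \<open>The first term accounts for exchanging the derivative \<open>g\<close> for its
    approximation, the second for exchanging the curve in the denominator; both errors are linear in
    \<open>e\<close>.\<close>
  define C where "C = 2 / \<kappa> + 4 * (N + \<kappa>) / \<kappa>\<^sup>2"
  have N0: "N \<ge> 0" by (simp add: N_def)
  have C0: "C > 0" using \<kappa> N0 by (simp add: C_def add_pos_nonneg)
  have vge: "norm (v t) \<ge> \<kappa>" if "t \<in> {0..2*pi}" for t
    using \<kappa>(2)[OF that] norm_triangle_ineq2[of "p t" "v t"] by (simp add: norm_minus_commute)
  have pge: "norm (p t) \<ge> \<kappa>" if "t \<in> {0..2*pi}" for t
    using \<kappa>(2)[OF that] norm_ge_zero[of "v t - p t"] by linarith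
  have cp: "continuous_on UNIV p"
    using p(1) by (auto simp: continuous_on_eq_continuous_at intro: has_vector_derivative_continuous)
  \<comment> \<open>The left side has the shape in which \<open>has_derivative_divide\<close>
    delivers the quotient rule.\<close>
  have quot: "- a * (inverse q * (h * b) * inverse q) + h * c / q = h * ((c * q - a * b) / (q * q))"
    if "q \<noteq> 0" for a b c h q :: complex
  proof -
    have "h * ((c * q - a * b) * (i * i)) = h * c * (q * i) * i - a * (i * (h * b) * i)" for i
      by (simp add: algebra_simps)
    from this[of "inverse q"] have "h * ((c * q - a * b) * (inverse q * inverse q)) = h * c * inverse q - a * (inverse q * (h * b) * inverse q)"
      unfolding right_inverse[OF that] mult_1_right .
    then show ?thesis unfolding divide_inverse inverse_mult_distrib by simp
  qed
  have quot2: "(c * q - a * b) / (q * q) * inverse (a / q) = c / a - b / q" if "a \<noteq> 0" "q \<noteq> 0" for a b c q :: complex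
    using that by (simp add: divide_simps)
  \<comment> \<open>The bound \<open>\<kappa>/8\<close> keeps the approximating curve within
    \<open>\<kappa>/4\<close> of \<open>v\<close>, so it still satisfies the nearness condition and
    stays at distance at least \<open>\<kappa>/2\<close> from the origin.\<close>
  have bound: "norm D \<le> C * e" if e: "0 < e" "e \<le> \<kappa>/8" for e
  proof -
    obtain h where h: "continuous_on UNIV h" "(LINT t|circ. norm (g t - h t)) < e"
      using integrable_circ_approx_continuous[OF g(1) e(1)] by blast
    have ih: "integrable circ h" by (rule integrable_circ_continuous[OF h(1)])
    \<comment> \<open>Subtracting the mean makes the primitive \<open>v1\<close> a closed curve;
      since \<open>g\<close> has mean zero, the correction is itself of size
      \<open>e\<close>.\<close>
    define m where "m = (1 / (2*pi)) *\<^sub>R (LINT t|circ. h t)"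
    define h1 where "h1 = (\<lambda>t. h t - m)"
    have ch1: "continuous_on UNIV h1" unfolding h1_def by (intro continuous_intros h)
    have ih1: "integrable circ h1" by (rule integrable_circ_continuous[OF ch1])
    have ic: "integrable circ (\<lambda>t. m)" "integrable circ (\<lambda>t. norm m)"
      by (intro integrable_circ_continuous continuous_intros)+
    have h10: "(LINT t|circ. h1 t) = 0"
      using ih ic integral_circ_const[of m] by (simp add: h1_def m_def)
    have mle: "2 * pi * norm m \<le> e"
    proof -
      have "2 * pi * norm m = norm (LINT t|circ. h t)" by (simp add: m_def)
      also have "\<dots> = norm (LINT t|circ. g t - h t)" using g ih by simp
      also have "\<dots> \<le> (LINT t|circ. norm (g t - h t))" by (rule integral_norm_bound)
      finally show ?thesis using h(2) by simp
    qed
    have gh1: "(LINT t|circ. norm (g t - h1 t)) \<le> 2 * e"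
    proof -
      have "(LINT t|circ. norm (g t - h1 t)) \<le> (LINT t|circ. norm (g t - h t) + norm m)"
      proof (rule integral_mono)
        fix t show "norm (g t - h1 t) \<le> norm (g t - h t) + norm m"
          using norm_triangle_ineq[of "g t - h t" m] by (simp add: h1_def diff_diff_eq2 algebra_simps)
      qed (use g ih ih1 ic in auto)
      also have "\<dots> = (LINT t|circ. norm (g t - h t)) + 2 * pi * norm m"
        using g ih ic integral_circ_const[of "norm m"] by simp
      finally show ?thesis using mle h(2) by simp
    qed
    define v1 where "v1 = (\<lambda>t. v 0 + integral {0..t} h1)"
    have near: "norm (v1 t - v t) \<le> 2 * e" if t: "t \<in> {0..2*pi}" for t
    proof -
      have "v1 t - v t = - integral {0..t} (\<lambda>s. g s - h1 s)"
        unfolding v1_def v(1)[OF t] using g(1) ih1 t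
        by (subst Henstock_Kurzweil_Integration.integral_diff)
           (auto intro!: integrable_on_lebesgue_on integrable_subinterval[of 0 "2*pi"])
      also have "norm \<dots> \<le> (LINT t|circ. norm (g t - h1 t))"
        using norm_integral_circ_le(1)[of "\<lambda>s. g s - h1 s" 0 t] g(1) ih1 t by simp
      finally show ?thesis using gh1 by simp
    qed
    have v1p: "norm (v1 t - p t) < norm (p t)" if t: "t \<in> {0..2*pi}" for t
      using near[OF t] \<kappa>(2)[OF t] \<kappa>(1) e norm_triangle_ineq[of "v1 t - v t" "v t - p t"] by simp
    have v1ge: "norm (v1 t) \<ge> \<kappa>/2" if t: "t \<in> {0..2*pi}" for t
      using near[OF t] vge[OF t] e norm_triangle_ineq2[of "v t" "v1 t"] by (simp add: norm_minus_commute)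
    have dv1: "(v1 has_vector_derivative h1 t) (at t within {0..2*pi})" if t: "t \<in> {0..2*pi}" for t
      unfolding v1_def using integral_has_vector_derivative[OF continuous_on_subset[OF ch1] t]
      by (auto intro!: derivative_eq_intros)
    have per1: "v1 (2*pi) = v1 0"
      using h10 lebesgue_integral_eq_integral[OF ih1] by (simp add: v1_def)
    \<comment> \<open>The quotient \<open>v1 t / p t\<close> never leaves the right half plane, so
      the principal logarithm is differentiable along it, and closedness makes its two end values
      agree.\<close>
    have "((\<lambda>t. h1 t / v1 t - p' t / p t) has_integral (Ln (v1 (2*pi) / p (2*pi)) - Ln (v1 0 / p 0))) {0..2*pi}"
    proof (rule fundamental_theorem_of_calculus)
      fix t assume t: "t \<in> {0..2*pi}"
      have nz: "v1 t \<noteq> 0" "p t \<noteq> 0" using v1ge[OF t] pge[OF t] \<kappa>(1) by auto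
      have "((\<lambda>t. v1 t / p t) has_vector_derivative (h1 t * p t - v1 t * p' t) / (p t * p t)) (at t within {0..2*pi})"
      proof -
        have a: "(v1 has_derivative (\<lambda>h. h *\<^sub>R h1 t)) (at t within {0..2*pi})"
          using dv1[OF t] by (simp only: has_vector_derivative_def)
        have b: "(p has_derivative (\<lambda>h. h *\<^sub>R p' t)) (at t within {0..2*pi})"
          using has_vector_derivative_at_within[OF p(1)[of t]] by (simp only: has_vector_derivative_def)
        have "(\<lambda>h. - v1 t * (inverse (p t) * (h *\<^sub>R p' t) * inverse (p t)) + (h *\<^sub>R h1 t) / p t)
           = (\<lambda>h. h *\<^sub>R ((h1 t * p t - v1 t * p' t) / (p t * p t)))"
          by (rule ext) (simp only: scaleR_conv_of_real quot[OF nz(2)])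
        with has_derivative_divide[OF a b nz(2)] show ?thesis
          by (simp only: has_vector_derivative_def)
      qed
      moreover have "v1 t / p t \<notin> \<real>\<^sub>\<le>\<^sub>0"
        using Re_pos_if_near[OF v1p[OF t]] by (auto simp: complex_nonpos_Reals_iff)
      then have "(Ln has_field_derivative inverse (v1 t / p t)) (at (v1 t / p t) within (\<lambda>t. v1 t / p t) ` {0..2*pi})"
        by (rule has_field_derivative_at_within[OF has_field_derivative_Ln])
      ultimately have "((Ln \<circ> (\<lambda>t. v1 t / p t)) has_vector_derivative (h1 t * p t - v1 t * p' t) / (p t * p t) * inverse (v1 t / p t)) (at t within {0..2*pi})"
        by (rule field_vector_diff_chain_within)
      then show "((\<lambda>t. Ln (v1 t / p t)) has_vector_derivative (h1 t / v1 t - p' t / p t)) (at t within {0..2*pi})"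
        unfolding o_def quot2[OF nz] .
    qed simp
    then have z: "integral {0..2*pi} (\<lambda>t. h1 t / v1 t - p' t / p t) = 0"
      by (simp add: per1 p(3) integral_unique)
    have cv1: "continuous_on {0..2*pi} v1"
      using has_vector_derivative_continuous[OF dv1] by (simp add: continuous_on_eq_continuous_within)
    have nz: "\<forall>t\<in>{0..2*pi}. v1 t \<noteq> 0" "\<forall>t\<in>{0..2*pi}. p t \<noteq> 0" using v1ge pge \<kappa>(1) by fastforce+
    have iq: "integrable circ (\<lambda>t. h1 t / v1 t)"
      by (rule continuous_imp_integrable_real[OF continuous_on_divide[OF continuous_on_subset[OF ch1] cv1 nz(1)]]) simp
    have ip: "integrable circ (\<lambda>t. p' t / p t)"
      by (rule continuous_imp_integrable_real[OF continuous_on_divide[OF continuous_on_subset[OF p(2)] continuous_on_subset[OF cp] nz(2)]]) simp_all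
    have "(LINT t|circ. h1 t / v1 t) = (LINT t|circ. p' t / p t)"
      using z iq ip lebesgue_integral_eq_integral[OF Bochner_Integration.integrable_diff[OF iq ip]] by simp
    moreover have igv: "integrable circ (\<lambda>t. g t / v t)"
      by (rule integrable_circ_divide[OF g(1) v(2) \<kappa>(1) vge])
    ultimately have "D = (LINT t|circ. g t / v t - h1 t / v1 t)" using iq by (simp add: D_def)
    also have "norm \<dots> \<le> (LINT t|circ. norm (g t / v t - h1 t / v1 t))" by (rule integral_norm_bound)
    also have "\<dots> \<le> (LINT t|circ. norm (g t - h1 t) / \<kappa> + norm (h1 t) * (4 * e / \<kappa>\<^sup>2))"
    proof (rule integral_mono)
      fix t assume "t \<in> space circ"
      then have t: "t \<in> {0..2*pi}" by simp
      have nz: "v1 t \<noteq> 0" "v t \<noteq> 0" using v1ge[OF t] vge[OF t] \<kappa>(1) by auto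
      have eq: "g t / v t - h1 t / v1 t = (g t - h1 t) / v t + h1 t * ((v1 t - v t) / (v t * v1 t))"
        using nz by (simp add: field_simps)
      have "norm ((g t - h1 t) / v t) \<le> norm (g t - h1 t) / \<kappa>"
        unfolding norm_divide using vge[OF t] \<kappa>(1) nz by (intro divide_left_mono) auto
      moreover have "norm ((v1 t - v t) / (v t * v1 t)) \<le> (2 * e) / (\<kappa> * (\<kappa>/2))"
        unfolding norm_divide norm_mult
        using near[OF t] vge[OF t] v1ge[OF t] \<kappa>(1) e by (intro frac_le mult_mono) auto
      then have "norm (h1 t * ((v1 t - v t) / (v t * v1 t))) \<le> norm (h1 t) * (4 * e / \<kappa>\<^sup>2)"
        unfolding norm_mult[of "h1 t"] by (intro mult_left_mono) (auto simp: power2_eq_square field_simps)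
      ultimately show "norm (g t / v t - h1 t / v1 t) \<le> norm (g t - h1 t) / \<kappa> + norm (h1 t) * (4 * e / \<kappa>\<^sup>2)"
        unfolding eq using norm_triangle_ineq[of "(g t - h1 t) / v t" "h1 t * ((v1 t - v t) / (v t * v1 t))"] by linarith
    qed (use g(1) ih1 iq igv in auto)
    also have "\<dots> = (LINT t|circ. norm (g t - h1 t)) / \<kappa> + (LINT t|circ. norm (h1 t)) * (4 * e / \<kappa>\<^sup>2)"
      using g(1) ih1 by simp
    also have "\<dots> \<le> (2 * e) / \<kappa> + (N + \<kappa>) * (4 * e / \<kappa>\<^sup>2)"
    proof -
      have "(LINT t|circ. norm (h1 t)) \<le> (LINT t|circ. norm (g t) + norm (g t - h1 t))"
      proof (rule integral_mono)
        fix t show "norm (h1 t) \<le> norm (g t) + norm (g t - h1 t)"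
          using norm_triangle_ineq4[of "g t" "g t - h1 t"] by simp
      qed (use g(1) ih1 in auto)
      also have "\<dots> = N + (LINT t|circ. norm (g t - h1 t))" using g(1) ih1 by (simp add: N_def)
      finally have "(LINT t|circ. norm (h1 t)) \<le> N + \<kappa>" using gh1 e by simp
      then show ?thesis using gh1 \<kappa>(1) e by (intro add_mono divide_right_mono mult_right_mono) auto
    qed
    also have "\<dots> = C * e" by (simp add: C_def algebra_simps)
    finally show ?thesis .
  qed
  have "D = 0"
  proof (rule ccontr)
    assume "D \<noteq> 0"
    then have d: "norm D > 0" by simp
    define e where "e = min (\<kappa>/8) (norm D / (2 * C))"
    have "0 < e" "e \<le> \<kappa>/8" using d \<kappa>(1) C0 by (auto simp: e_def)
    from bound[OF this] have "norm D \<le> C * (norm D / (2 * C))"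
      using C0 by (smt (verit) e_def min.cobounded2 mult_left_mono)
    also have "\<dots> = norm D / 2" using C0 by simp
    finally show False using d by simp
  qed
  then show ?thesis by (simp add: D_def)
qed

section \<open>Area integrals in the plane\<close>

lemma Complex_measurable [measurable]:
  "f \<in> borel_measurable M \<Longrightarrow> g \<in> borel_measurable M \<Longrightarrow> (\<lambda>x. Complex (f x) (g x)) \<in> borel_measurable M"
  by (simp add: borel_measurable_complex_iff)

text \<open>Both measures agree on boxes; this makes Fubini in real and imaginary part
  available.\<close>

lemma lborel_complex: "lborel = distr (lborel \<Otimes>\<^sub>M lborel) borel (\<lambda>(x, y). Complex x y)"
proof (rule lborel_eqI)
  fix l u :: complex assume le: "\<And>b. b \<in> Basis \<Longrightarrow> l \<bullet> b \<le> u \<bullet> b"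
  have le': "Re l \<le> Re u" "Im l \<le> Im u" using le[of 1] le[of \<i>] by (auto simp: Basis_complex_def)
  have "emeasure (distr (lborel \<Otimes>\<^sub>M lborel) borel (\<lambda>(x, y). Complex x y)) (box l u)
      = emeasure (lborel \<Otimes>\<^sub>M lborel) ((\<lambda>(x, y). Complex x y) -` box l u \<inter> space (lborel \<Otimes>\<^sub>M lborel))"
    by (rule emeasure_distr) auto
  also have "(\<lambda>(x, y). Complex x y) -` box l u \<inter> space (lborel \<Otimes>\<^sub>M lborel) = {Re l<..<Re u} \<times> {Im l<..<Im u}"
    by (auto simp: box_def Basis_complex_def space_pair_measure)
  also have "emeasure (lborel \<Otimes>\<^sub>M lborel) \<dots> = ennreal (Re u - Re l) * ennreal (Im u - Im l)"
    using le' by (subst lborel.emeasure_pair_measure_Times) auto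
  also have "\<dots> = ennreal (\<Prod>b\<in>Basis. (u - l) \<bullet> b)"
    using le' by (simp add: Basis_complex_def ennreal_mult)
  finally show "emeasure (distr (lborel \<Otimes>\<^sub>M lborel) borel (\<lambda>(x, y). Complex x y)) (box l u) = ennreal (\<Prod>b\<in>Basis. (u - l) \<bullet> b)" .
qed simp

text \<open>On each vertical line with abscissa x other than 0 the substitution y = x s is linear
  with factor \<open>\<bar>x\<bar>\<close>, and the line x = 0 is null; Tonelli then exchanges the
  order.\<close>

lemma nn_integral_slope:
  fixes f :: "complex \<Rightarrow> ennreal"
  assumes [measurable]: "f \<in> borel_measurable borel"
  shows "(\<integral>\<^sup>+z. f z \<partial>lborel) = (\<integral>\<^sup>+x. (\<integral>\<^sup>+s. ennreal \<bar>x\<bar> * f (Complex x (x * s)) \<partial>lborel) \<partial>lborel)"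
    and "(\<integral>\<^sup>+z. f z \<partial>lborel) = (\<integral>\<^sup>+s. (\<integral>\<^sup>+x. ennreal \<bar>x\<bar> * f (Complex x (x * s)) \<partial>lborel) \<partial>lborel)"
proof -
  have "(\<integral>\<^sup>+z. f z \<partial>lborel) = (\<integral>\<^sup>+p. f (case p of (x, y) \<Rightarrow> Complex x y) \<partial>(lborel \<Otimes>\<^sub>M lborel))"
    by (subst lborel_complex, subst nn_integral_distr) auto
  also have "\<dots> = (\<integral>\<^sup>+x. (\<integral>\<^sup>+y. f (Complex x y) \<partial>lborel) \<partial>lborel)"
    by (subst lborel.nn_integral_fst[symmetric]) (auto simp: case_prod_beta)
  also have "\<dots> = (\<integral>\<^sup>+x. (\<integral>\<^sup>+s. ennreal \<bar>x\<bar> * f (Complex x (x * s)) \<partial>lborel) \<partial>lborel)"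
  proof (rule nn_integral_cong_AE)
    have "AE x in lborel. x \<noteq> (0::real)" by (rule AE_lborel_singleton)
    then show "AE x in lborel. (\<integral>\<^sup>+y. f (Complex x y) \<partial>lborel) = (\<integral>\<^sup>+s. ennreal \<bar>x\<bar> * f (Complex x (x * s)) \<partial>lborel)"
    proof eventually_elim
      case (elim x)
      show ?case
        using elim by (subst nn_integral_real_affine[where c=x and t=0]) (auto simp: nn_integral_cmult)
    qed
  qed
  finally show 1: "(\<integral>\<^sup>+z. f z \<partial>lborel) = (\<integral>\<^sup>+x. (\<integral>\<^sup>+s. ennreal \<bar>x\<bar> * f (Complex x (x * s)) \<partial>lborel) \<partial>lborel)" .
  also have "\<dots> = (\<integral>\<^sup>+s. (\<integral>\<^sup>+x. ennreal \<bar>x\<bar> * f (Complex x (x * s)) \<partial>lborel) \<partial>lborel)"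
    by (rule lborel_pair.Fubini') simp
  finally show "(\<integral>\<^sup>+z. f z \<partial>lborel) = (\<integral>\<^sup>+s. (\<integral>\<^sup>+x. ennreal \<bar>x\<bar> * f (Complex x (x * s)) \<partial>lborel) \<partial>lborel)" .
qed

text \<open>Cartesian replacement for polar coordinates: a point is described by its abscissa \<open>x\<close> and the slope \<open>s\<close> of
  the line through the origin on which it lies; the Jacobian is \<open>\<bar>x\<bar>\<close>.\<close>

lemma integral_slope:
  fixes f :: "complex \<Rightarrow> real"
  assumes f: "integrable lborel f"
  shows "(LINT z|lborel. f z) = (LINT s|lborel. LINT x|lborel. \<bar>x\<bar> * f (Complex x (x * s)))"
proof -
  have [measurable]: "f \<in> borel_measurable borel" using f by auto
  let ?h = "\<lambda>(x, y). f (Complex x y)"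
  have ih: "integrable (lborel \<Otimes>\<^sub>M lborel) ?h"
    using f by (subst (asm) lborel_complex, subst (asm) integrable_distr_eq) (auto simp: case_prod_beta')
  let ?k = "\<lambda>(x, s). \<bar>x\<bar> * f (Complex x (x * s))"
  have ik: "integrable (lborel \<Otimes>\<^sub>M lborel) ?k"
  proof (rule integrableI_bounded)
    have "(\<integral>\<^sup>+p. ennreal (norm (?k p)) \<partial>(lborel \<Otimes>\<^sub>M lborel)) =
        (\<integral>\<^sup>+x. (\<integral>\<^sup>+s. ennreal \<bar>x\<bar> * ennreal (norm (f (Complex x (x * s)))) \<partial>lborel) \<partial>lborel)"
      by (subst lborel.nn_integral_fst[symmetric]) (auto simp: ennreal_mult abs_mult)
    also have "\<dots> = (\<integral>\<^sup>+z. ennreal (norm (f z)) \<partial>lborel)"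
      by (rule nn_integral_slope(1)[symmetric]) simp
    also have "\<dots> < \<infinity>" using f by (simp add: integrable_iff_bounded)
    finally show "(\<integral>\<^sup>+p. ennreal (norm (?k p)) \<partial>(lborel \<Otimes>\<^sub>M lborel)) < \<infinity>" .
  qed simp
  have "(LINT z|lborel. f z) = (LINT p|(lborel \<Otimes>\<^sub>M lborel). ?h p)"
    by (subst lborel_complex, subst integral_distr) (auto simp: case_prod_beta')
  also have "\<dots> = (LINT x|lborel. LINT y|lborel. f (Complex x y))"
    using lborel_pair.integral_fst'[OF ih] by simp
  also have "\<dots> = (LINT x|lborel. LINT s|lborel. ?k (x, s))"
  proof (rule integral_cong_AE)
    have "AE x in lborel. x \<noteq> (0::real)" by (rule AE_lborel_singleton)
    then show "AE x in lborel. (LINT y|lborel. f (Complex x y)) = (LINT s|lborel. ?k (x, s))"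
    proof eventually_elim
      case (elim x)
      then show ?case
        using lborel_integral_real_affine[of x "\<lambda>y. f (Complex x y)" 0] by simp
    qed
  qed auto
  also have "\<dots> = (LINT s|lborel. LINT x|lborel. ?k (x, s))"
    using lborel_pair.Fubini_integral[OF ik] by simp
  finally show ?thesis by simp
qed

text \<open>With s = tan \<theta> these are the integrals over (-pi/2, pi/2) of 1, cos^2, sin cos
  and sin^2. The first two come from explicit antiderivatives, the third from oddness, the last as a
  difference.\<close>

lemma slope_integrals:
  shows "integrable lborel (\<lambda>s::real. 1 / (1 + s\<^sup>2))" "(LINT s|lborel. 1 / (1 + s\<^sup>2)) = pi"
    and "integrable lborel (\<lambda>s::real. 1 / (1 + s\<^sup>2)\<^sup>2)" "(LINT s|lborel. 1 / (1 + s\<^sup>2)\<^sup>2) = pi / 2"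
    and "integrable lborel (\<lambda>s::real. s / (1 + s\<^sup>2)\<^sup>2)" "(LINT s|lborel. s / (1 + s\<^sup>2)\<^sup>2) = (0::real)"
    and "integrable lborel (\<lambda>s::real. s\<^sup>2 / (1 + s\<^sup>2)\<^sup>2)" "(LINT s|lborel. s\<^sup>2 / (1 + s\<^sup>2)\<^sup>2) = pi / 2"
proof -
  have pos: "1 + s\<^sup>2 > 0" for s :: real by (simp add: add_pos_nonneg)
  have c1: "isCont (\<lambda>s::real. 1 / (1 + s\<^sup>2)) x" for x using pos[of x] by (intro continuous_intros) auto
  have c2: "isCont (\<lambda>s::real. 1 / (1 + s\<^sup>2)\<^sup>2) x" for x using pos[of x] by (intro continuous_intros) auto
  have U: "einterval (-\<infinity>) \<infinity> = UNIV" by (auto simp: einterval_def)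
  note F1 = interval_integral_FTC_nonneg[where a="-\<infinity>" and b="\<infinity>" and F=arctan and f="\<lambda>s. 1 / (1 + s\<^sup>2)" and A="-(pi/2)" and B="pi/2"]
  have d1: "(arctan has_real_derivative 1 / (1 + x\<^sup>2)) (at x)" for x
    using DERIV_arctan[of x] by (simp add: divide_inverse)
  have l1: "((arctan \<circ> real_of_ereal) \<longlongrightarrow> -(pi/2)) (at_right (-\<infinity>))" "((arctan \<circ> real_of_ereal) \<longlongrightarrow> pi/2) (at_left \<infinity>)"
    using tendsto_arctan_at_bot tendsto_arctan_at_top by (auto simp: ereal_tendsto_simps)
  show i1: "integrable lborel (\<lambda>s::real. 1 / (1 + s\<^sup>2))"
    using F1(1) d1 c1 l1 U by (simp add: set_integrable_def)
  show v1: "(LINT s|lborel. 1 / (1 + s\<^sup>2)) = pi"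
    using F1(2) d1 c1 l1 U by (simp add: interval_lebesgue_integral_def set_lebesgue_integral_def)
  let ?F = "\<lambda>s::real. s / (2 * (1 + s\<^sup>2)) + arctan s / 2"
  note F2 = interval_integral_FTC_nonneg[where a="-\<infinity>" and b="\<infinity>" and F="?F" and f="\<lambda>s. 1 / (1 + s\<^sup>2)\<^sup>2" and A="-(pi/4)" and B="pi/4"]
  have d2: "(?F has_real_derivative 1 / (1 + x\<^sup>2)\<^sup>2) (at x)" for x
  proof -
    have "((\<lambda>s. 2 * (1 + s\<^sup>2)) has_real_derivative 2 * (2 * x)) (at x)"
      by (auto intro!: derivative_eq_intros)
    from DERIV_add[OF DERIV_divide[OF DERIV_ident this] DERIV_cdivide[OF d1, of 2]]
    have "(?F has_real_derivative ((1 * (2 * (1 + x\<^sup>2)) - x * (2 * (2 * x))) / (2 * (1 + x\<^sup>2))\<^sup>2 + (1 / (1 + x\<^sup>2)) / 2)) (at x)"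
      unfolding power2_eq_square[of "2 * (1 + x\<^sup>2)"] using pos[of x] by simp
    moreover have "(1 * (2 * (1 + x\<^sup>2)) - x * (2 * (2 * x))) / (2 * (1 + x\<^sup>2))\<^sup>2 + (1 / (1 + x\<^sup>2)) / 2 = 1 / (1 + x\<^sup>2)\<^sup>2"
    proof -
      have "(1 / (1 + x\<^sup>2)) / 2 = (2 * (1 + x\<^sup>2)) / (2 * (1 + x\<^sup>2))\<^sup>2"
        using pos[of x] by (simp add: power2_eq_square divide_simps) 
      moreover have "1 / (1 + x\<^sup>2)\<^sup>2 = 4 / (2 * (1 + x\<^sup>2))\<^sup>2"
        unfolding power_mult_distrib by simp
      ultimately show ?thesis by (simp add: add_divide_distrib[symmetric] power2_eq_square algebra_simps)
    qed
    ultimately show ?thesis by simp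
  qed
  have r: "((\<lambda>s::real. s / (2 * (1 + s\<^sup>2))) \<longlongrightarrow> 0) at_top" "((\<lambda>s::real. s / (2 * (1 + s\<^sup>2))) \<longlongrightarrow> 0) at_bot"
    by real_asymp+
  have l2: "((?F \<circ> real_of_ereal) \<longlongrightarrow> -(pi/4)) (at_right (-\<infinity>))" "((?F \<circ> real_of_ereal) \<longlongrightarrow> pi/4) (at_left \<infinity>)"
    using tendsto_add[OF r(2) tendsto_divide[OF tendsto_arctan_at_bot tendsto_const[of 2]]]
      tendsto_add[OF r(1) tendsto_divide[OF tendsto_arctan_at_top tendsto_const[of 2]]]
    by (auto simp: ereal_tendsto_simps)
  show i2: "integrable lborel (\<lambda>s::real. 1 / (1 + s\<^sup>2)\<^sup>2)"
    using F2(1) d2 c2 l2 U by (simp add: set_integrable_def)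
  show v2: "(LINT s|lborel. 1 / (1 + s\<^sup>2)\<^sup>2) = pi / 2"
    using F2(2) d2 c2 l2 U by (simp add: interval_lebesgue_integral_def set_lebesgue_integral_def)
  show "integrable lborel (\<lambda>s::real. s / (1 + s\<^sup>2)\<^sup>2)"
  proof (rule Bochner_Integration.integrable_bound[OF i1])
    show "AE s in (lborel :: real measure). norm (s / (1 + s\<^sup>2)\<^sup>2) \<le> norm (1 / (1 + s\<^sup>2))"
    proof (rule AE_I2)
      fix s :: real
      have "\<bar>s\<bar> \<le> 1 + s\<^sup>2"
      proof -
        have "0 \<le> (\<bar>s\<bar> - 1)\<^sup>2" by simp
        then have "2 * \<bar>s\<bar> \<le> 1 + s\<^sup>2" by (simp add: power2_eq_square algebra_simps)
        then show ?thesis by linarith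
      qed
      then have "\<bar>s\<bar> / (1 + s\<^sup>2)\<^sup>2 \<le> (1 + s\<^sup>2) / (1 + s\<^sup>2)\<^sup>2" by (rule divide_right_mono) simp
      also have "\<dots> = 1 / (1 + s\<^sup>2)" using pos[of s] by (simp add: power2_eq_square)
      finally show "norm (s / (1 + s\<^sup>2)\<^sup>2) \<le> norm (1 / (1 + s\<^sup>2))" using pos[of s] by simp
    qed
  qed simp
  show "(LINT s|lborel. s / (1 + s\<^sup>2)\<^sup>2) = (0::real)"
    using lborel_integral_real_affine[of "-1" "\<lambda>s. s / (1 + s\<^sup>2)\<^sup>2" 0] by simp
  have eq: "s\<^sup>2 / (1 + s\<^sup>2)\<^sup>2 = 1 / (1 + s\<^sup>2) - 1 / (1 + s\<^sup>2)\<^sup>2" for s :: real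
  proof -
    have "1 / (1 + s\<^sup>2) = (1 + s\<^sup>2) / (1 + s\<^sup>2)\<^sup>2" using pos[of s] by (simp add: power2_eq_square)
    then show ?thesis by (simp add: diff_divide_distrib[symmetric])
  qed
  show "integrable lborel (\<lambda>s::real. s\<^sup>2 / (1 + s\<^sup>2)\<^sup>2)" unfolding eq using i1 i2 by simp
  show "(LINT s|lborel. s\<^sup>2 / (1 + s\<^sup>2)\<^sup>2) = pi / 2" unfolding eq using i1 i2 v1 v2 by simp
qed

lemma lborel_affine_integral:
  fixes f :: "'a::euclidean_space \<Rightarrow> real"
  assumes c: "c \<noteq> 0" and [measurable]: "f \<in> borel_measurable borel"
  shows "(LINT x|lborel. f x) = \<bar>c\<bar> ^ DIM('a) * (LINT x|lborel. f (t + c *\<^sub>R x))"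
    and "integrable lborel f \<longleftrightarrow> integrable lborel (\<lambda>x. f (t + c *\<^sub>R x))"
proof -
  note l = lborel_affine[OF c, of t]
  show "(LINT x|lborel. f x) = \<bar>c\<bar> ^ DIM('a) * (LINT x|lborel. f (t + c *\<^sub>R x))"
  proof -
    have "(LINT x|lborel. f x) = (LINT x|distr lborel borel (\<lambda>x. t + c *\<^sub>R x). \<bar>c\<bar> ^ DIM('a) *\<^sub>R f x)"
      by (subst l, rule integral_density) auto
    then show ?thesis by (simp add: integral_distr)
  qed
  have "integrable lborel f \<longleftrightarrow> integrable (distr lborel borel (\<lambda>x. t + c *\<^sub>R x)) (\<lambda>x. \<bar>c\<bar> ^ DIM('a) *\<^sub>R f x)"
    by (subst l, rule integrable_density) auto
  also have "\<dots> \<longleftrightarrow> integrable lborel (\<lambda>x. f (t + c *\<^sub>R x))"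
    using c by (simp add: integrable_distr_eq)
  finally show "integrable lborel f \<longleftrightarrow> integrable lborel (\<lambda>x. f (t + c *\<^sub>R x))" .
qed

lemma lborel_affine_nn_integral:
  fixes f :: "'a::euclidean_space \<Rightarrow> ennreal"
  assumes c: "c \<noteq> 0" and [measurable]: "f \<in> borel_measurable borel"
  shows "(\<integral>\<^sup>+x. f x \<partial>lborel) = ennreal (\<bar>c\<bar> ^ DIM('a)) * (\<integral>\<^sup>+x. f (t + c *\<^sub>R x) \<partial>lborel)"
  by (subst lborel_affine[OF c, of t], subst nn_integral_density) (auto simp: nn_integral_distr nn_integral_cmult)

lemma norm_Complex_slope: "norm (Complex x (x * s)) = \<bar>x\<bar> * sqrt (1 + s\<^sup>2)"
proof -
  have "x\<^sup>2 + (x * s)\<^sup>2 = x\<^sup>2 * (1 + s\<^sup>2)" by (simp add: power_mult_distrib algebra_simps)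
  then show ?thesis by (simp add: cmod_def real_sqrt_mult)
qed

lemma inverse_norm_measurable:
  assumes "S \<in> sets (borel :: complex measure)"
  shows "(\<lambda>y. indicat_real S y / norm y) \<in> borel_measurable borel"
    and "(\<lambda>y. indicat_real S (w - y) / norm (w - y)) \<in> borel_measurable borel"
proof -
  show 1: "(\<lambda>y. indicat_real S y / norm y) \<in> borel_measurable borel"
    by (intro borel_measurable_divide borel_measurable_indicator borel_measurable_norm assms)
  have "(\<lambda>y. w - y) \<in> borel_measurable borel"
    by (intro borel_measurable_continuous_onI continuous_intros)
  from measurable_compose[OF this 1]
  show "(\<lambda>y. indicat_real S (w - y) / norm (w - y)) \<in> borel_measurable borel" .
qed

lemma cball_sets_borel [simp, measurable]: "cball (a::'a::metric_space) r \<in> sets borel"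
  by (intro borel_closed closed_cball)

text \<open>On the line of slope s put q = sqrt (1 + s^2). The Jacobian times the integrand is 1/q,
  on the interval where \<open>\<bar>x\<bar>\<close> is at most \<rho>/q, which gives 2 \<rho> / (1
  + s^2); integrating over s yields 2 pi \<rho>.\<close>

lemma nn_integral_inverse_norm_ball:
  assumes "\<rho> \<ge> 0"
  shows "(\<integral>\<^sup>+y. ennreal (indicator (cball 0 \<rho>) y / norm y) \<partial>(lborel :: complex measure)) \<le> ennreal (2 * pi * \<rho>)"
proof -
  let ?J = "\<lambda>s x. ennreal \<bar>x\<bar> * ennreal (indicator (cball 0 \<rho>) (Complex x (x * s)) / norm (Complex x (x * s)))"
  have "(\<integral>\<^sup>+y. ennreal (indicator (cball 0 \<rho>) y / norm y) \<partial>(lborel :: complex measure))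
    = (\<integral>\<^sup>+s. (\<integral>\<^sup>+x. ?J s x \<partial>lborel) \<partial>lborel)"
    by (rule nn_integral_slope(2)) (intro measurable_compose[OF inverse_norm_measurable(1) measurable_ennreal] cball_sets_borel)
  also have "\<dots> \<le> (\<integral>\<^sup>+s. ennreal (2 * \<rho> * (1 / (1 + s\<^sup>2))) \<partial>lborel)"
  proof (rule nn_integral_mono)
    fix s :: real
    define q where "q = sqrt (1 + s\<^sup>2)"
    have q: "q > 0" "q\<^sup>2 = 1 + s\<^sup>2" by (auto simp: q_def add_pos_nonneg)
    have "(\<integral>\<^sup>+x. ?J s x \<partial>lborel)
       \<le> (\<integral>\<^sup>+x. ennreal (1 / q) * indicator {-(\<rho>/q)..\<rho>/q} x \<partial>lborel)"
    proof (rule nn_integral_mono)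
      fix x :: real
      have "\<bar>x\<bar> * (indicator (cball 0 \<rho>) (Complex x (x * s)) / norm (Complex x (x * s))) \<le> 1 / q * indicator {-(\<rho>/q)..\<rho>/q} x"
      proof (cases "\<bar>x\<bar> * q \<le> \<rho>")
        case True
        then have "\<bar>x * q\<bar> \<le> \<rho>" using q(1) by (simp add: abs_mult)
        then have "x \<in> {-(\<rho>/q)..\<rho>/q}" using q(1) by (auto simp: abs_le_iff field_simps)
        then show ?thesis unfolding norm_Complex_slope q_def[symmetric]
          using q(1) by (cases "x = 0") (auto simp: indicator_def)
      next
        case False
        then have "Complex x (x * s) \<notin> cball 0 \<rho>" by (simp add: norm_Complex_slope q_def)
        then show ?thesis using q(1) by simp
      qed
      then show "?J s x \<le> ennreal (1 / q) * indicator {-(\<rho>/q)..\<rho>/q} x"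
        using q(1) by (simp add: ennreal_mult'[symmetric] ennreal_indicator[symmetric] ennreal_leI del: ennreal_indicator)
    qed
    also have "\<dots> = ennreal (1 / q) * ennreal (2 * (\<rho> / q))"
      using assms q(1) by (subst nn_integral_cmult_indicator) auto
    also have "\<dots> = ennreal (2 * \<rho> * (1 / (1 + s\<^sup>2)))"
      using assms q by (subst ennreal_mult[symmetric]) (auto simp: q(2)[symmetric] power2_eq_square)
    finally show "(\<integral>\<^sup>+x. ?J s x \<partial>lborel)
      \<le> ennreal (2 * \<rho> * (1 / (1 + s\<^sup>2)))" .
  qed
  also have "\<dots> = ennreal (LINT s|lborel. 2 * \<rho> * (1 / (1 + s\<^sup>2)))"
    using assms slope_integrals(1) by (intro nn_integral_eq_integral integrable_mult_right) (auto simp: add_nonneg_nonneg)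
  also have "(LINT s|lborel. 2 * \<rho> * (1 / (1 + s\<^sup>2))) = 2 * \<rho> * pi"
    by (simp only: integral_mult_right_zero slope_integrals(2))
  finally show ?thesis by (simp add: mult.commute mult.left_commute)
qed

text \<open>The singularity is split at distance \<open>\<rho>\<close>: the near part is a disc
  integral, and on the far part the integrand is at most 1/\<rho>. The radius stays free because for
  a set of area of order \<rho>^2 the bound is of order \<rho>, uniformly in
  \<open>w\<close>.\<close>

lemma nn_integral_inverse_dist_le:
  fixes w :: complex
  assumes S[measurable]: "S \<in> sets borel" and \<rho>: "\<rho> > 0" and fin: "emeasure lborel S < \<infinity>"
  shows "(\<integral>\<^sup>+z. ennreal (indicator S z / norm (w - z)) \<partial>lborel) \<le> ennreal (2 * pi * \<rho> + measure lborel S / \<rho>)"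
proof -
  have "(\<integral>\<^sup>+z. ennreal (indicator S z / norm (w - z)) \<partial>lborel)
     \<le> (\<integral>\<^sup>+z. ennreal (indicator (cball 0 \<rho>) (w - z) / norm (w - z)) + ennreal (1/\<rho>) * indicator S z \<partial>lborel)"
  proof (rule nn_integral_mono)
    fix z
    have "indicator S z / norm (w - z) \<le> indicator (cball 0 \<rho>) (w - z) / norm (w - z) + (1/\<rho>) * indicator S z"
      using \<rho> by (auto simp: indicator_def intro!: divide_left_mono mult_pos_pos)
    then have "ennreal (indicator S z / norm (w - z)) \<le> ennreal (indicator (cball 0 \<rho>) (w - z) / norm (w - z) + (1/\<rho>) * indicator S z)"
      by (rule ennreal_leI)
    also have "\<dots> = ennreal (indicator (cball 0 \<rho>) (w - z) / norm (w - z)) + ennreal (1/\<rho>) * indicator S z"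
      using \<rho> by (cases "z \<in> S") simp_all
    finally show "ennreal (indicator S z / norm (w - z)) \<le> ennreal (indicator (cball 0 \<rho>) (w - z) / norm (w - z)) + ennreal (1/\<rho>) * indicator S z" .
  qed
  also have "\<dots> = (\<integral>\<^sup>+z. ennreal (indicator (cball 0 \<rho>) (w - z) / norm (w - z)) \<partial>lborel) + ennreal (1/\<rho>) * emeasure lborel S"
    using measurable_compose[OF inverse_norm_measurable(2)[OF cball_sets_borel] measurable_ennreal]
    by (subst nn_integral_add) (auto simp: nn_integral_cmult_indicator)
  also have "(\<integral>\<^sup>+z. ennreal (indicator (cball 0 \<rho>) (w - z) / norm (w - z)) \<partial>lborel)
     = (\<integral>\<^sup>+y. ennreal (indicator (cball 0 \<rho>) y / norm y) \<partial>(lborel :: complex measure))"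
    using lborel_affine_nn_integral[of "-1" "\<lambda>y. ennreal (indicator (cball 0 \<rho>) y / norm y)" w]
      measurable_compose[OF inverse_norm_measurable(1)[OF cball_sets_borel] measurable_ennreal] by simp
  also have "\<dots> + ennreal (1/\<rho>) * emeasure lborel S \<le> ennreal (2 * pi * \<rho>) + ennreal (1/\<rho>) * emeasure lborel S"
    using \<rho> by (intro add_right_mono nn_integral_inverse_norm_ball) simp
  also have "\<dots> = ennreal (2 * pi * \<rho> + measure lborel S / \<rho>)"
    using \<rho> fin by (simp add: emeasure_eq_ennreal_measure ennreal_mult'[symmetric] ennreal_plus[symmetric] del: ennreal_plus)
  finally show ?thesis .
qed

text \<open>Since \<open>m\<close> is positive the two roots have opposite signs, so the signed
  length of the interval between them is the sum of the roots, which does not depend on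
  \<open>m\<close>.\<close>

lemma integral_sgn_chord:
  fixes b Q m :: real
  assumes Q: "Q > 0" and m: "m > 0"
  shows "(LINT x|lborel. sgn x * indicator {x. Q * x\<^sup>2 - 2 * b * x < m} x) = 2 * b / Q"
proof -
  define r where "r = sqrt (b\<^sup>2 + Q * m)"
  define xp xm where "xp = (b + r) / Q" and "xm = (b - r) / Q"
  have r2: "r\<^sup>2 = b\<^sup>2 + Q * m" using Q m by (simp add: r_def)
  have "b\<^sup>2 < r\<^sup>2" using Q m by (simp add: r2)
  then have rb: "\<bar>b\<bar> < r" using Q m by (metis abs_le_square_iff not_le r_def real_sqrt_ge_zero abs_of_nonneg add_nonneg_nonneg zero_le_power2 mult_pos_pos less_imp_le)
  have xx: "xm < 0" "0 < xp" using rb Q by (auto simp: xm_def xp_def divide_less_0_iff)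
  have fac: "Q * x\<^sup>2 - 2 * b * x - m = Q * ((x - xm) * (x - xp))" for x
  proof -
    have "Q * (Q * ((x - xm) * (x - xp))) = (Q * x - (b - r)) * (Q * x - (b + r))"
      using Q by (simp add: xm_def xp_def field_simps)
    also have "\<dots> = Q * (Q * x\<^sup>2 - 2 * b * x) - (r\<^sup>2 - b\<^sup>2)" by (simp add: power2_eq_square algebra_simps)
    also have "\<dots> = Q * (Q * x\<^sup>2 - 2 * b * x - m)" by (simp add: r2 algebra_simps)
    finally show ?thesis using Q by simp
  qed
  have mem: "Q * x\<^sup>2 - 2 * b * x < m \<longleftrightarrow> x \<in> {xm<..<xp}" for x
  proof -
    have "Q * x\<^sup>2 - 2 * b * x < m \<longleftrightarrow> (x - xm) * (x - xp) < 0"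
      using fac[of x] Q by (metis diff_less_0_iff_less mult_less_cancel_left_pos mult_zero_right)
    also have "\<dots> \<longleftrightarrow> x \<in> {xm<..<xp}" using xx by (auto simp: mult_less_0_iff)
    finally show ?thesis .
  qed
  have "(LINT x|lborel. sgn x * indicator {x. Q * x\<^sup>2 - 2 * b * x < m} x)
      = (LINT x|lborel. indicator {0<..<xp} x - indicator {xm<..<0} x)"
    using xx by (intro Bochner_Integration.integral_cong) (auto simp: mem indicator_def sgn_if)
  also have "\<dots> = xp + xm"
    using xx by (subst Bochner_Integration.integral_diff) auto
  also have "\<dots> = 2 * b / Q" using Q by (simp add: xp_def xm_def field_simps)
  finally show ?thesis .
qed

text \<open>In terms of the unit vector e of angle \<theta> this integrates 2 (w . e) (\<alpha>,
  \<beta>) . e over a half turn; after expansion the mixed term is odd and the squares have equal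
  weight.\<close>

lemma integral_cbilinear_slope:
  "(LINT s|lborel. (2 * (w1 + w2 * s) / (1 + s\<^sup>2)) * ((\<alpha> + \<beta> * s) / (1 + s\<^sup>2))) = pi * (w1 * \<alpha> + w2 * \<beta> :: real)"
proof -
  have "(LINT s|lborel. (2 * (w1 + w2 * s) / (1 + s\<^sup>2)) * ((\<alpha> + \<beta> * s) / (1 + s\<^sup>2)))
     = (LINT s|lborel. (2 * w1 * \<alpha>) * (1 / (1 + s\<^sup>2)\<^sup>2) + (2 * (w1 * \<beta> + w2 * \<alpha>)) * (s / (1 + s\<^sup>2)\<^sup>2) + (2 * w2 * \<beta>) * (s\<^sup>2 / (1 + s\<^sup>2)\<^sup>2))"
  proof (rule Bochner_Integration.integral_cong)
    fix s :: real
    show "(2 * (w1 + w2 * s) / (1 + s\<^sup>2)) * ((\<alpha> + \<beta> * s) / (1 + s\<^sup>2)) = (2 * w1 * \<alpha>) * (1 / (1 + s\<^sup>2)\<^sup>2) + (2 * (w1 * \<beta> + w2 * \<alpha>)) * (s / (1 + s\<^sup>2)\<^sup>2) + (2 * w2 * \<beta>) * (s\<^sup>2 / (1 + s\<^sup>2)\<^sup>2)"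
      unfolding times_divide_eq_right times_divide_eq_left times_divide_times_eq add_divide_distrib[symmetric] divide_divide_eq_left
      by (rule arg_cong2[where f="(/)"]) (simp_all add: power2_eq_square algebra_simps)
  qed simp
  also have "\<dots> = (2 * w1 * \<alpha>) * (pi/2) + (2 * (w1 * \<beta> + w2 * \<alpha>)) * 0 + (2 * w2 * \<beta>) * (pi/2)"
    using slope_integrals by (simp only: Bochner_Integration.integral_add integral_mult_right_zero integrable_mult_right Bochner_Integration.integrable_add)
  also have "\<dots> = pi * (w1 * \<alpha> + w2 * \<beta>)" by (simp add: algebra_simps)
  finally show ?thesis .
qed

text \<open>The gradient of ln |y|, the kernel in \<open>j_fun\<close>; its value at 0 is 0 by the
  convention on division.\<close>

abbreviation newton :: "complex \<Rightarrow> complex" where "newton y \<equiv> y /\<^sub>R (norm y)\<^sup>2"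

lemma newton_measurable [measurable]: "newton \<in> borel_measurable borel"
  by (intro borel_measurable_scaleR borel_measurable_inverse borel_measurable_power borel_measurable_norm) simp_all

lemma norm_newton: "norm (newton y) = 1 / norm y"
  by (cases "y = 0") (simp_all add: power2_eq_square divide_inverse)

text \<open>A line through an interior point cuts the disc in a chord whose midpoint depends linearly on the point;
  in slope coordinates only this midpoint enters.\<close>

lemma ball_potential:
  assumes w: "norm w < M"
  shows "(LINT z|lborel. indicator (ball 0 M) z * (newton (w - z) \<bullet> e)) = pi * (w \<bullet> e)"
proof -
  \<comment> \<open>The substitution y = w - z moves the singularity to the origin, where the slope
    coordinates are centred.\<close>
  define f where "f = (\<lambda>y. indicator (ball 0 M) (w - y) * (newton y \<bullet> e))"
  have cm: "(\<lambda>y. w - y) \<in> borel_measurable borel" by (intro borel_measurable_continuous_onI continuous_intros)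
  have mf: "f \<in> borel_measurable borel" unfolding f_def
    by (intro borel_measurable_times borel_measurable_inner newton_measurable borel_measurable_const
        measurable_compose[OF cm borel_measurable_indicator] borel_open open_ball)
  have "M > 0" using w norm_ge_zero[of w] by linarith
  have "(LINT z|lborel. indicator (ball 0 M) z * (newton (w - z) \<bullet> e)) = (LINT y|lborel. f y)"
  proof -
    have "(\<lambda>z. indicator (ball 0 M) z * (newton (w - z) \<bullet> e)) = (\<lambda>z. f (w - z))" by (simp add: f_def)
    then show ?thesis using lborel_affine_integral(1)[of "-1" f w] mf by simp
  qed
  also have "\<dots> = (LINT s|lborel. LINT x|lborel. \<bar>x\<bar> * f (Complex x (x * s)))"
  proof (rule integral_slope, rule integrableI_bounded)
    show "f \<in> borel_measurable lborel" using mf by simp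
    have "(\<integral>\<^sup>+y. ennreal (norm (f y)) \<partial>lborel) \<le> (\<integral>\<^sup>+y. ennreal (norm e) * ennreal (indicator (ball w M) y / norm (0 - y)) \<partial>lborel)"
    proof (rule nn_integral_mono)
      fix y
      have "norm (f y) \<le> norm e * (indicator (ball w M) y / norm (0 - y))"
        using Cauchy_Schwarz_ineq2[of "newton y" e] unfolding f_def norm_newton
        by (auto simp: indicator_def dist_norm norm_minus_commute mult.commute)
      then show "ennreal (norm (f y)) \<le> ennreal (norm e) * ennreal (indicator (ball w M) y / norm (0 - y))"
        by (subst ennreal_mult'[symmetric]) (auto intro: ennreal_leI)
    qed
    also have "\<dots> = ennreal (norm e) * (\<integral>\<^sup>+y. ennreal (indicator (ball w M) y / norm (0 - y)) \<partial>lborel)"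
      using inverse_norm_measurable(1)[of "ball w M"] by (intro nn_integral_cmult) simp
    also have "\<dots> \<le> ennreal (norm e) * ennreal (2 * pi * 1 + measure lborel (ball w M) / 1)"
      using nn_integral_inverse_dist_le[of "ball w M" 1 0] emeasure_lborel_ball_finite[of w M]
      by (intro mult_left_mono) auto
    also have "\<dots> < \<infinity>" by (simp add: ennreal_mult_less_top)
    finally show "(\<integral>\<^sup>+y. ennreal (norm (f y)) \<partial>lborel) < \<infinity>" .
  qed
  also have "\<dots> = (LINT s|lborel. (2 * (Re w + Im w * s) / (1 + s\<^sup>2)) * ((Re e + Im e * s) / (1 + s\<^sup>2)))"
  proof (rule Bochner_Integration.integral_cong)
    fix s :: real
    define Q where "Q = 1 + s\<^sup>2"
    define b where "b = Re w + Im w * s"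
    have Q: "Q > 0" by (simp add: Q_def add_pos_nonneg)
    have m: "M\<^sup>2 - (norm w)\<^sup>2 > 0" using w \<open>M > 0\<close> by (simp add: abs_square_less_1 power_strict_mono)
    have "\<bar>x\<bar> * f (Complex x (x * s)) = ((Re e + Im e * s) / Q) * (sgn x * indicator {x. Q * x\<^sup>2 - 2 * b * x < M\<^sup>2 - (norm w)\<^sup>2} x)" for x
    proof -
      have n2: "(norm (Complex x (x * s)))\<^sup>2 = x\<^sup>2 * Q"
        using Q by (simp add: norm_Complex_slope power_mult_distrib Q_def)
      have "(norm (w - Complex x (x * s)))\<^sup>2 = (norm w)\<^sup>2 - 2 * (w \<bullet> Complex x (x * s)) + (norm (Complex x (x * s)))\<^sup>2"
        by (simp add: power2_norm_eq_inner algebra_simps inner_commute)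
      also have "w \<bullet> Complex x (x * s) = b * x" by (simp add: inner_complex_def b_def algebra_simps)
      finally have d: "(norm (w - Complex x (x * s)))\<^sup>2 = (norm w)\<^sup>2 - 2 * (b * x) + x\<^sup>2 * Q" by (simp add: n2)
      have "w - Complex x (x * s) \<in> ball 0 M \<longleftrightarrow> (norm (w - Complex x (x * s)))\<^sup>2 < M\<^sup>2"
        using \<open>M > 0\<close> by (auto intro: power_strict_mono power2_less_imp_less)
      then have ind: "indicator (ball 0 M) (w - Complex x (x * s)) = (indicator {x. Q * x\<^sup>2 - 2 * b * x < M\<^sup>2 - (norm w)\<^sup>2} x :: real)"
        unfolding d by (auto simp: indicator_def algebra_simps)
      \<comment> \<open>The Jacobian cancels the singularity exactly: along a line only the sign of
        \<open>x\<close> remains, which leaves the signed chord length.\<close>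
      have "\<bar>x\<bar> * (newton (Complex x (x * s)) \<bullet> e) = ((Re e + Im e * s) / Q) * sgn x"
      proof (cases "x = 0")
        case False
        have "\<bar>x\<bar> * (newton (Complex x (x * s)) \<bullet> e) = \<bar>x\<bar> * (x * (Re e + Im e * s)) / (x\<^sup>2 * Q)"
          unfolding inner_scaleR_left n2 by (simp add: inner_complex_def divide_inverse algebra_simps)
        also have "\<dots> = ((Re e + Im e * s) / Q) * sgn x"
          using False Q by (auto simp: sgn_if power2_eq_square abs_if field_simps)
        finally show ?thesis .
      qed simp
      note nn = this
      have "\<bar>x\<bar> * f (Complex x (x * s)) = indicator {x. Q * x\<^sup>2 - 2 * b * x < M\<^sup>2 - (norm w)\<^sup>2} x * (\<bar>x\<bar> * (newton (Complex x (x * s)) \<bullet> e))"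
        unfolding f_def ind by (rule mult.left_commute)
      then show ?thesis unfolding nn by (simp only: mult_ac)
    qed
    then have "(LINT x|lborel. \<bar>x\<bar> * f (Complex x (x * s))) = ((Re e + Im e * s) / Q) * (2 * b / Q)"
      using integral_sgn_chord[OF Q m, of b] by (simp only: integral_mult_right_zero)
    then show "(LINT x|lborel. \<bar>x\<bar> * f (Complex x (x * s))) = (2 * (Re w + Im w * s) / (1 + s\<^sup>2)) * ((Re e + Im e * s) / (1 + s\<^sup>2))"
      by (simp add: Q_def b_def)
  qed simp
  also have "\<dots> = pi * (w \<bullet> e)" by (simp only: integral_cbilinear_slope inner_complex_def)
  finally show ?thesis .
qed

text \<open>The exchange is legitimate although the kernel is singular along the curve: its integral
  over \<open>S\<close> is at most \<open>c * norm (g t) * B\<close>, with \<open>B\<close> uniform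
  over the poles, and this is integrable in t. The same estimate gives the third claim.\<close>

lemma area_fubini:
  fixes v g :: "real \<Rightarrow> complex" and K :: "complex \<Rightarrow> real"
  defines "k \<equiv> \<lambda>t z. newton (v t - z) \<bullet> (\<i> * g t)"
  assumes v: "continuous_on UNIV v" and g: "integrable circ g"
    and S: "S \<in> sets borel" and B: "\<And>w. (\<integral>\<^sup>+z. ennreal (indicator S z / norm (w - z)) \<partial>lborel) \<le> ennreal B" "B \<ge> 0"
    and K: "K \<in> borel_measurable borel" "\<And>z. z \<in> S \<Longrightarrow> \<bar>K z\<bar> \<le> c" "c \<ge> 0"
  shows "integrable lborel (\<lambda>z. indicator S z * K z * avg (\<lambda>t. k t z))"
    and "(LINT z|lborel. indicator S z * K z * avg (\<lambda>t. k t z)) = avg (\<lambda>t. LINT z|lborel. indicator S z * K z * k t z)"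
    and "\<bar>LINT z|lborel. indicator S z * K z * avg (\<lambda>t. k t z)\<bar> \<le> c * B * avg (\<lambda>t. norm (g t))"
proof -
  let ?k = "\<lambda>t z. indicator S z * K z * k t z"
  interpret P: pair_sigma_finite circ "lborel :: complex measure"
    by (rule pair_sigma_finite_circ[OF lborel.sigma_finite_measure_axioms])
  have vm[measurable]: "v \<in> borel_measurable circ" by (rule continuous_circ_measurable[OF v])
  have gm[measurable]: "g \<in> borel_measurable circ" using g by simp
  note K(1)[measurable] S[measurable]
  let ?f = "\<lambda>(t, z). indicator S z * K z * k t z"
  have "(\<lambda>p. newton (v (fst p) - snd p)) \<in> borel_measurable (circ \<Otimes>\<^sub>M lborel)"
    by (rule measurable_compose[OF _ newton_measurable]) measurable
  then have fm[measurable]: "?f \<in> borel_measurable (circ \<Otimes>\<^sub>M lborel)"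
    unfolding k_def case_prod_beta' by measurable
  have sec: "(\<lambda>z. ?k t z) \<in> borel_measurable lborel" if "t \<in> space circ" for t
    using measurable_compose[OF measurable_Pair1'[OF that] fm] by simp
  have nnb: "(\<integral>\<^sup>+z. ennreal (norm (?k t z)) \<partial>lborel) \<le> ennreal (c * norm (g t) * B)" for t
  proof -
    have "(\<integral>\<^sup>+z. ennreal (norm (?k t z)) \<partial>lborel)
      \<le> (\<integral>\<^sup>+z. ennreal (c * norm (g t)) * ennreal (indicator S z / norm (v t - z)) \<partial>lborel)"
    proof (rule nn_integral_mono)
      fix z
      have "\<bar>k t z\<bar> \<le> 1 / norm (v t - z) * norm (g t)"
        using Cauchy_Schwarz_ineq2[of "newton (v t - z)" "\<i> * g t"] unfolding k_def norm_newton by (simp add: norm_mult)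
      then have "norm (?k t z) \<le> (c * norm (g t)) * (indicator S z / norm (v t - z))"
        using K(2)[of z] K(3) mult_mono[of "\<bar>K z\<bar>" c "\<bar>k t z\<bar>" "1 / norm (v t - z) * norm (g t)"]
        by (auto simp: indicator_def abs_mult)
      then show "ennreal (norm (?k t z)) \<le> ennreal (c * norm (g t)) * ennreal (indicator S z / norm (v t - z))"
        using K(3) by (subst ennreal_mult'[symmetric]) (auto intro: ennreal_leI)
    qed
    also have "\<dots> = ennreal (c * norm (g t)) * (\<integral>\<^sup>+z. ennreal (indicator S z / norm (v t - z)) \<partial>lborel)"
    proof (rule nn_integral_cmult)
      have "(\<lambda>z. norm (v t - z)) \<in> borel_measurable borel"
        by (intro borel_measurable_continuous_onI continuous_intros)
      then show "(\<lambda>z. ennreal (indicator S z / norm (v t - z))) \<in> borel_measurable lborel" by measurable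
    qed
    also have "\<dots> \<le> ennreal (c * norm (g t)) * ennreal B"
      by (intro mult_left_mono B) simp
    also have "\<dots> = ennreal (c * norm (g t) * B)" using K(3) B(2) by (subst ennreal_mult) auto
    finally show ?thesis .
  qed
  have ii: "integrable lborel (\<lambda>z. ?k t z)" if "t \<in> space circ" for t
    using le_less_trans[OF nnb[of t] ennreal_less_top] sec[OF that] by (intro integrableI_bounded) simp_all
  have nb: "(LINT z|lborel. norm (?k t z)) \<le> c * norm (g t) * B" if "t \<in> space circ" for t
    using nnb[of t] ii[OF that] K(3) B(2)
    by (subst (asm) nn_integral_eq_integral[OF integrable_norm]) (auto simp: ennreal_le_iff)
  have icb: "integrable circ (\<lambda>t. c * norm (g t) * B)" using g by simp
  have im: "integrable circ (\<lambda>t. LINT z|lborel. norm (?f (t, z)))"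
  proof (rule Bochner_Integration.integrable_bound[OF icb])
    show "(\<lambda>t. LINT z|lborel. norm (?f (t, z))) \<in> borel_measurable circ"
      by (rule lborel.borel_measurable_lebesgue_integral) (use fm in \<open>simp add: case_prod_beta'\<close>)
    show "AE t in circ. norm (LINT z|lborel. norm (?f (t, z))) \<le> norm (c * norm (g t) * B)"
      using nb K(3) B(2) by (intro AE_I2) (simp add: abs_of_nonneg)
  qed
  have int: "integrable (circ \<Otimes>\<^sub>M lborel) ?f"
    by (rule P.Fubini_integrable[OF fm im]) (use ii in \<open>auto intro: AE_I2\<close>)
  have j: "indicator S z * K z * avg (\<lambda>t. k t z) = 1 / (2*pi) * (LINT t|circ. ?f (t, z))" for z
    by (simp add: avg_def mult.assoc)
  show "integrable lborel (\<lambda>z. indicator S z * K z * avg (\<lambda>t. k t z))"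
    unfolding j using P.integrable_snd[of "\<lambda>t z. ?f (t, z)"] int by (intro integrable_mult_right) simp
  show eq: "(LINT z|lborel. indicator S z * K z * avg (\<lambda>t. k t z)) = avg (\<lambda>t. LINT z|lborel. ?k t z)"
    unfolding j integral_mult_right_zero using P.Fubini_integral[of "\<lambda>t z. ?f (t, z)"] int by (simp add: avg_def)
  have i1: "integrable circ (\<lambda>t. LINT z|lborel. ?f (t, z))"
    using P.integrable_fst'[OF int] by simp
  have "\<bar>avg (\<lambda>t. LINT z|lborel. ?k t z)\<bar> \<le> 1 / (2*pi) * (LINT t|circ. \<bar>LINT z|lborel. ?f (t, z)\<bar>)"
    unfolding avg_def by (simp add: abs_mult divide_right_mono integral_abs_bound)
  also have "\<dots> \<le> 1 / (2*pi) * (LINT t|circ. c * norm (g t) * B)"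
  proof (intro mult_left_mono integral_mono)
    fix t assume t: "t \<in> space circ"
    have "\<bar>LINT z|lborel. ?f (t, z)\<bar> \<le> (LINT z|lborel. norm (?k t z))"
      using integral_norm_bound[of lborel "\<lambda>z. ?k t z"] by simp
    then show "\<bar>LINT z|lborel. ?f (t, z)\<bar> \<le> c * norm (g t) * B" using nb[OF t] by linarith
  qed (use i1 icb in auto)
  also have "\<dots> = c * B * avg (\<lambda>t. norm (g t))" by (simp add: avg_def)
  finally show "\<bar>LINT z|lborel. indicator S z * K z * avg (\<lambda>t. k t z)\<bar> \<le> c * B * avg (\<lambda>t. norm (g t))"
    unfolding eq .
qed

section \<open>The truncated logarithm\<close>

definition log_bump :: "real \<Rightarrow> real \<Rightarrow> complex \<Rightarrow> real" where
  "log_bump \<epsilon> a z = - a * ln (min 1 (max (norm z) \<epsilon>))"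

definition annulus :: "real \<Rightarrow> complex set" where
  "annulus \<epsilon> = ball 0 1 - cball 0 \<epsilon>"

lemma annulus_sets [simp, measurable]: "annulus \<epsilon> \<in> sets borel"
  by (auto simp: annulus_def)

lemma measure_annulus:
  assumes "0 < \<epsilon>" "\<epsilon> < 1"
  shows "measure lborel (annulus \<epsilon>) = pi * (1 - \<epsilon>\<^sup>2)" "emeasure lborel (annulus \<epsilon>) < \<infinity>"
proof -
  have "measure lborel (annulus \<epsilon>) = measure lborel (ball 0 1 :: complex set) - measure lborel (cball 0 \<epsilon> :: complex set)"
    unfolding annulus_def using assms emeasure_lborel_ball_finite[of "0::complex" 1]
    by (intro measure_Diff) (auto simp: subset_eq)
  also have "\<dots> = pi * (1 - \<epsilon>\<^sup>2)"
    using assms content_ball[of 1 "0::complex"] content_cball[of \<epsilon> "0::complex"]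
    by (simp add: unit_ball_vol_2 algebra_simps)
  finally show "measure lborel (annulus \<epsilon>) = pi * (1 - \<epsilon>\<^sup>2)" .
  have "emeasure lborel (annulus \<epsilon>) \<le> emeasure lborel (ball 0 1 :: complex set)"
    by (intro emeasure_mono) (auto simp: annulus_def)
  then show "emeasure lborel (annulus \<epsilon>) < \<infinity>"
    using emeasure_lborel_ball_finite[of "0::complex" 1] by (metis infinity_ennreal_def le_less_trans)
qed

lemma integrable_bounded_support:
  fixes f :: "complex \<Rightarrow> real"
  assumes "f \<in> borel_measurable borel" "\<And>z. norm z \<le> M \<Longrightarrow> \<bar>f z\<bar> \<le> C" "\<And>z. norm z > M \<Longrightarrow> f z = 0"
  shows "integrable lborel f"
proof (rule Bochner_Integration.integrable_bound)
  show "integrable lborel (\<lambda>z::complex. indicator (cball 0 M) z * C)"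
    using emeasure_lborel_cball_finite[of "0::complex" M] by (intro integrable_mult_left) auto
  show "AE z in lborel. norm (f z) \<le> norm (indicator (cball 0 M) z * C)"
  proof (rule AE_I2)
    fix z show "norm (f z) \<le> norm (indicator (cball 0 M) z * C)"
      using assms(2,3)[of z] by (cases "norm z \<le> M") (auto simp: indicator_def)
  qed
qed (use assms in simp)

context
  fixes \<epsilon> a :: real
  assumes \<epsilon>: "0 < \<epsilon>" "\<epsilon> < 1" and a: "a \<ge> 0"
begin

lemma log_bump_continuous: "continuous_on UNIV (log_bump \<epsilon> a)"
  unfolding log_bump_def using \<epsilon> by (intro continuous_intros) (auto simp: min_def max_def)

lemma log_bump_measurable: "log_bump \<epsilon> a \<in> borel_measurable borel"
  by (rule borel_measurable_continuous_onI[OF log_bump_continuous])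

lemma log_bump_bounds: "0 \<le> log_bump \<epsilon> a z" "log_bump \<epsilon> a z \<le> a * ln (1 / \<epsilon>)"
proof -
  have "0 < min 1 (max (norm z) \<epsilon>)" "min 1 (max (norm z) \<epsilon>) \<le> 1" "\<epsilon> \<le> min 1 (max (norm z) \<epsilon>)"
    using \<epsilon> by auto
  then have "ln \<epsilon> \<le> ln (min 1 (max (norm z) \<epsilon>))" "ln (min 1 (max (norm z) \<epsilon>)) \<le> 0"
    using \<epsilon> by (auto simp: ln_le_cancel_iff)
  then show "0 \<le> log_bump \<epsilon> a z" "log_bump \<epsilon> a z \<le> a * ln (1 / \<epsilon>)"
    using a \<epsilon> mult_left_mono[of "- ln (min 1 (max (norm z) \<epsilon>))" "- ln \<epsilon>" a]
    by (auto simp: log_bump_def ln_div mult_nonneg_nonpos)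
qed

lemma log_bump_outside: "1 \<le> norm z \<Longrightarrow> log_bump \<epsilon> a z = 0"
  by (auto simp: log_bump_def min_def max_def)

text \<open>Truncating the radius at \<epsilon> and 1 does not enlarge ratios, so a dilation by
  \<open>t\<close> changes the truncated radius by a factor of at most \<open>t\<close>. With ln t
  at most t - 1 this dominates the difference quotients by \<open>a\<close>.\<close>

lemma log_bump_dilate:
  assumes t: "t > 1"
  shows "0 \<le> log_bump \<epsilon> a (z /\<^sub>R t) - log_bump \<epsilon> a z" "log_bump \<epsilon> a (z /\<^sub>R t) - log_bump \<epsilon> a z \<le> a * ln t"
proof -
  define r where "r = norm z"
  define m where "m = min 1 (max r \<epsilon>)"
  define m' where "m' = min 1 (max (r / t) \<epsilon>)"
  have r: "r \<ge> 0" "r / t \<le> r" using t mult_left_mono[of 1 t r] by (auto simp: r_def field_simps)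
  have m: "0 < m" "0 < m'" using \<epsilon> by (auto simp: m_def m'_def)
  have "m' \<le> m" using r by (auto simp: m_def m'_def)
  then have 1: "ln m' \<le> ln m" using m by simp
  have "m \<le> t * m'"
  proof -
    have "1 \<le> t * 1" "r \<le> t * (r / t)" "\<epsilon> \<le> t * \<epsilon>" using t \<epsilon> by auto
    then have "m \<le> min (t * 1) (max (t * (r / t)) (t * \<epsilon>))" by (auto simp: m_def)
    also have "\<dots> = t * m'" using t by (simp add: m'_def min_mult_distrib_left max_mult_distrib_left)
    finally show ?thesis .
  qed
  then have "ln m \<le> ln (t * m')" using m t by simp
  also have "\<dots> = ln t + ln m'" using m t by (simp add: ln_mult)
  finally have 2: "ln m - ln m' \<le> ln t" by simp
  have "log_bump \<epsilon> a (z /\<^sub>R t) - log_bump \<epsilon> a z = a * (ln m - ln m')"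
    using t by (simp add: log_bump_def m_def m'_def r_def divide_inverse algebra_simps)
  then show "0 \<le> log_bump \<epsilon> a (z /\<^sub>R t) - log_bump \<epsilon> a z" "log_bump \<epsilon> a (z /\<^sub>R t) - log_bump \<epsilon> a z \<le> a * ln t"
    using 1 2 a by (auto intro: mult_left_mono)
qed

text \<open>The limit is minus the radial derivative z . grad, which equals \<open>a\<close> where
  the logarithm is active and 0 elsewhere; the two circles on which it jumps are excluded.\<close>

lemma log_bump_dilate_limit:
  assumes t: "\<And>n. t n > 1" "t \<longlonglongrightarrow> 1" and z: "norm z \<noteq> \<epsilon>" "norm z \<noteq> 1"
  shows "(\<lambda>n. (log_bump \<epsilon> a (z /\<^sub>R t n) - log_bump \<epsilon> a z) / (t n - 1)) \<longlonglongrightarrow> a * indicator (annulus \<epsilon>) z"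
proof -
  have lim: "(\<lambda>n. norm z / t n) \<longlonglongrightarrow> norm z / 1" by (intro tendsto_intros t) simp
  have nz: "norm (z /\<^sub>R t n) = norm z / t n" for n using t(1)[of n] by (simp add: divide_inverse mult.commute)
  consider "norm z < \<epsilon>" | "\<epsilon> < norm z" "norm z < 1" | "norm z > 1" using z by linarith
  then show ?thesis
  proof cases
    case 1
    have "norm z / t n \<le> \<epsilon>" for n
    proof -
      have "\<epsilon> * 1 \<le> \<epsilon> * t n" using t(1)[of n] \<epsilon> by (intro mult_left_mono) auto
      then show ?thesis using 1 t(1)[of n] by (simp add: pos_divide_le_eq)
    qed
    then have "log_bump \<epsilon> a (z /\<^sub>R t n) = log_bump \<epsilon> a z" for n
      unfolding log_bump_def nz using 1 by (simp add: max_absorb2)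
    then show ?thesis using 1 by (simp add: annulus_def)
  next
    case 2
    have "eventually (\<lambda>n. \<epsilon> < norm z / t n) sequentially"
      by (rule order_tendstoD(1)[OF lim]) (use 2 in simp)
    then have ev: "eventually (\<lambda>n. (log_bump \<epsilon> a (z /\<^sub>R t n) - log_bump \<epsilon> a z) / (t n - 1) = a * (ln (t n) / (t n - 1))) sequentially"
    proof eventually_elim
      case (elim n)
      have "norm z / t n < 1" using 2 t(1)[of n] by (simp add: field_simps)
      then have "log_bump \<epsilon> a (z /\<^sub>R t n) - log_bump \<epsilon> a z = a * ln (t n)"
      proof -
        have m: "min 1 (max (norm z / t n) \<epsilon>) = norm z / t n" "min 1 (max (norm z) \<epsilon>) = norm z"
          using 2 elim \<open>norm z / t n < 1\<close> by auto
        have l: "ln (norm z / t n) = ln (norm z) - ln (t n)"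
          using 2 \<epsilon> t(1)[of n] by (intro ln_divide_pos) auto
        show ?thesis unfolding log_bump_def nz m l by (simp add: algebra_simps)
      qed
      then show ?case by simp
    qed
    have "((\<lambda>x::real. ln x / (x - 1)) \<longlongrightarrow> 1) (at_right 1)" by real_asymp
    moreover have "filterlim t (at_right 1) sequentially"
    proof -
      have "t n \<noteq> 1" for n using t(1)[of n] by simp
      then show ?thesis using t by (simp add: filterlim_at)
    qed
    ultimately have "(\<lambda>n. ln (t n) / (t n - 1)) \<longlonglongrightarrow> 1" by (rule filterlim_compose)
    from tendsto_mult[OF tendsto_const[of a] this]
    have "(\<lambda>n. a * (ln (t n) / (t n - 1))) \<longlonglongrightarrow> a * 1" .
    then have "(\<lambda>n. (log_bump \<epsilon> a (z /\<^sub>R t n) - log_bump \<epsilon> a z) / (t n - 1)) \<longlonglongrightarrow> a * 1"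
      by (rule Lim_transform_eventually) (use ev in \<open>auto elim: eventually_mono\<close>)
    then show ?thesis using 2 by (simp add: annulus_def)
  next
    case 3
    have "eventually (\<lambda>n. 1 < norm z / t n) sequentially"
      by (rule order_tendstoD(1)[OF lim]) (use 3 in simp)
    then have "eventually (\<lambda>n. (log_bump \<epsilon> a (z /\<^sub>R t n) - log_bump \<epsilon> a z) / (t n - 1) = 0) sequentially"
    proof eventually_elim
      case (elim n)
      then have "log_bump \<epsilon> a (z /\<^sub>R t n) = 0" by (intro log_bump_outside) (simp only: nz less_imp_le)
      then show ?case using 3 by (simp add: log_bump_outside)
    qed
    then show ?thesis using 3 by (auto simp: annulus_def intro: tendsto_eventually)
  qed
qed

text \<open>The distributional identity behind \<open>dl\<close>: move a dilation \<open>z \<mapsto> t z\<close> from \<open>\<phi>\<close> to the kernel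
  and differentiate at \<open>t = 1\<close>.\<close>

lemma dilation_identity:
  assumes \<phi>: "\<And>z. (\<phi> has_derivative \<phi>' z) (at z)" "\<And>x y. norm x \<le> 2 * M \<Longrightarrow> norm y \<le> 2 * M \<Longrightarrow> \<bar>\<phi> x - \<phi> y\<bar> \<le> C * norm (x - y)"
    and bd: "\<And>z. norm z \<le> 2 * M \<Longrightarrow> \<bar>\<phi> z\<bar> \<le> B" and M: "M \<ge> 1"
    and supp: "b = 0 \<or> (\<forall>z. norm z > M \<longrightarrow> \<phi> z = 0)"
  shows "(LINT z|lborel. (b + log_bump \<epsilon> a z) * (2 * \<phi> z + \<phi>' z z)) = (LINT z|lborel. a * indicator (annulus \<epsilon>) z * \<phi> z)"
    and "(\<lambda>z. 2 * \<phi> z + \<phi>' z z) \<in> borel_measurable borel"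
proof -
  \<comment> \<open>Dilation factors in (1, 2] tending to 1; the bound 2 is why the hypotheses on
    \<open>\<phi>\<close> are posed on the ball of radius \<open>2 * M\<close>.\<close>
  define t :: "nat \<Rightarrow> real" where "t = (\<lambda>n. 1 + 1 / real (Suc n))"
  have t: "t n > 1" "t n \<le> 2" for n by (auto simp: t_def field_simps)
  have tl: "t \<longlonglongrightarrow> 1" unfolding t_def using LIMSEQ_inverse_real_of_nat_add[of 1] by (simp add: divide_inverse)
  define F where "F = (\<lambda>z. b + log_bump \<epsilon> a z)"
  define A where "A = \<bar>b\<bar> + a * ln (1 / \<epsilon>)"
  have FA: "\<bar>F z\<bar> \<le> A" for z using log_bump_bounds[of z] by (auto simp: F_def A_def)
  have A0: "A \<ge> 0" using FA[of 0] by linarith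
  have B0: "B \<ge> 0" using bd[of 0] M by simp
  have c\<phi>: "continuous_on UNIV \<phi>"
    using \<phi>(1) by (auto simp: continuous_on_eq_continuous_at intro: has_derivative_continuous)
  have m\<phi>: "\<phi> \<in> borel_measurable borel" by (rule borel_measurable_continuous_onI[OF c\<phi>])
  have mF: "F \<in> borel_measurable borel" unfolding F_def using log_bump_measurable by simp
  have m\<phi>t: "(\<lambda>z. \<phi> (c *\<^sub>R z)) \<in> borel_measurable borel" for c
    by (intro borel_measurable_continuous_onI continuous_on_compose2[OF c\<phi>] continuous_intros) auto
  have mFt: "(\<lambda>z. F (z /\<^sub>R c)) \<in> borel_measurable borel" for c
    unfolding F_def by (intro borel_measurable_continuous_onI continuous_on_add continuous_on_const
      continuous_on_compose2[OF log_bump_continuous] continuous_intros) auto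
  \<comment> \<open>Compact support comes either from \<open>\<phi>\<close> or, when
    \<open>b = 0\<close>, from \<open>log_bump\<close> itself; the second source admits the constant
    1 as \<open>\<phi>\<close>.\<close>
  have supp': "F z * \<phi> (c *\<^sub>R z) = 0" if "norm z > M" "c \<ge> 1" for z c
  proof (cases "b = 0")
    case True then show ?thesis using that M log_bump_outside[of z] by (simp add: F_def)
  next
    case False
    have "norm (c *\<^sub>R z) > M" using that M mult_mono[of 1 c M "norm z"] by (simp, smt (verit) mult_left_mono mult_le_cancel_right1 norm_ge_zero)
    then show ?thesis using False supp by simp
  qed
  \<comment> \<open>Two difference quotients at t = 1: \<open>f\<close> carries the dilation on
    \<open>\<phi>\<close> together with the Jacobian t^2, whose derivative is the summand 2 \<phi>;
    \<open>q\<close> carries the inverse dilation on \<open>F\<close>.\<close>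
  define f where "f = (\<lambda>n z. F z * (((t n)\<^sup>2 * \<phi> (t n *\<^sub>R z) - \<phi> z) / (t n - 1)))"
  define q where "q = (\<lambda>n z. (F (z /\<^sub>R t n) - F z) / (t n - 1))"
  have diff: "(\<lambda>n. ((t n)\<^sup>2 * \<phi> (t n *\<^sub>R z) - \<phi> z) / (t n - 1)) \<longlonglongrightarrow> 2 * \<phi> z + \<phi>' z z" for z
  proof -
    have "((\<lambda>s. \<phi> (s *\<^sub>R z)) has_derivative (\<lambda>h. \<phi>' (1 *\<^sub>R z) (h *\<^sub>R z))) (at 1)"
      by (rule has_derivative_compose[of "\<lambda>s. s *\<^sub>R z" _ 1 UNIV \<phi>]) (auto intro!: derivative_eq_intros \<phi>(1)[of z])
    moreover have "\<phi>' z (h *\<^sub>R z) = \<phi>' z z * h" for h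
      using linear_scale[OF has_derivative_linear[OF \<phi>(1)[of z]], of h z] by simp
    ultimately have "((\<lambda>s. \<phi> (s *\<^sub>R z)) has_real_derivative \<phi>' z z) (at 1)"
      by (simp add: has_field_derivative_def mult_commute_abs)
    then have "((\<lambda>s. (\<phi> (s *\<^sub>R z) - \<phi> z) / (s - 1)) \<longlongrightarrow> \<phi>' z z) (at 1)"
      by (simp add: has_field_derivative_iff)
    moreover have "filterlim t (at 1) sequentially"
      using tl t by (auto simp: filterlim_at intro!: always_eventually) (metis less_irrefl)
    ultimately have 1: "(\<lambda>n. (\<phi> (t n *\<^sub>R z) - \<phi> z) / (t n - 1)) \<longlonglongrightarrow> \<phi>' z z"
      by (rule filterlim_compose)
    have "isCont \<phi> (1 *\<^sub>R z)" using c\<phi> by (simp add: continuous_on_eq_continuous_at)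
    then have 2: "(\<lambda>n. (t n + 1) * \<phi> (t n *\<^sub>R z)) \<longlonglongrightarrow> (1 + 1) * \<phi> (1 *\<^sub>R z)"
      by (intro tendsto_intros isCont_tendsto_compose[of _ \<phi>] tl)
    have "((t n)\<^sup>2 * \<phi> (t n *\<^sub>R z) - \<phi> z) / (t n - 1) = (t n + 1) * \<phi> (t n *\<^sub>R z) + (\<phi> (t n *\<^sub>R z) - \<phi> z) / (t n - 1)" for n
    proof -
      have *: "(t n)\<^sup>2 * \<phi> (t n *\<^sub>R z) - \<phi> z = (t n + 1) * \<phi> (t n *\<^sub>R z) * (t n - 1) + (\<phi> (t n *\<^sub>R z) - \<phi> z)"
        by (simp add: power2_eq_square algebra_simps)
      have nz: "t n - 1 \<noteq> 0" using t(1)[of n] by simp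
      show ?thesis unfolding * add_divide_distrib nonzero_mult_div_cancel_right[OF nz] ..
    qed
    then show ?thesis using tendsto_add[OF 2 1] by simp
  qed
  show "(\<lambda>z. 2 * \<phi> z + \<phi>' z z) \<in> borel_measurable borel"
    by (rule borel_measurable_LIMSEQ_real[OF diff])
      (intro borel_measurable_divide borel_measurable_diff borel_measurable_times borel_measurable_const m\<phi> m\<phi>t)
  note ml = this
  have L: "(\<lambda>n. LINT z|lborel. f n z) \<longlonglongrightarrow> (LINT z|lborel. F z * (2 * \<phi> z + \<phi>' z z))"
  proof (rule integral_dominated_convergence[where w="\<lambda>z. indicator (cball 0 M) z * (A * (3 * B + C * M))"])
    show "(\<lambda>z. F z * (2 * \<phi> z + \<phi>' z z)) \<in> borel_measurable lborel" using mF ml by simp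
    show "f n \<in> borel_measurable lborel" for n unfolding f_def using mF m\<phi> m\<phi>t by simp
    show "integrable lborel (\<lambda>z::complex. indicator (cball 0 M) z * (A * (3 * B + C * M)))"
      using emeasure_lborel_cball_finite[of "0::complex" M] by (intro integrable_mult_left) auto
    show "AE z in lborel. (\<lambda>n. f n z) \<longlonglongrightarrow> F z * (2 * \<phi> z + \<phi>' z z)"
      unfolding f_def by (intro AE_I2 tendsto_mult tendsto_const diff)
    show "AE z in lborel. norm (f n z) \<le> indicator (cball 0 M) z * (A * (3 * B + C * M))" for n
    proof (rule AE_I2)
      fix z :: complex
      show "norm (f n z) \<le> indicator (cball 0 M) z * (A * (3 * B + C * M))"
      proof (cases "norm z \<le> M")
        case False
        then have "F z * \<phi> (t n *\<^sub>R z) = 0" "F z * \<phi> z = 0"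
          using supp'[of z "t n"] supp'[of z 1] t(1)[of n] by auto
        then have "f n z = 0" by (auto simp: f_def)
        then show ?thesis using False by simp
      next
        case True
        have n2: "norm (t n *\<^sub>R z) \<le> 2 * M" "norm z \<le> 2 * M"
          using True t[of n] M mult_mono[of "t n" 2 "norm z" M] by auto
        have C0: "C \<ge> 0" using \<phi>(2)[of 0 1] M by simp
        have "\<bar>\<phi> (t n *\<^sub>R z) - \<phi> z\<bar> \<le> C * norm (t n *\<^sub>R z - z)" by (rule \<phi>(2)[OF n2])
        also have "t n *\<^sub>R z - z = (t n - 1) *\<^sub>R z" by (simp add: scaleR_diff_left)
        also have "C * norm ((t n - 1) *\<^sub>R z) \<le> C * ((t n - 1) * M)"
          using C0 t(1)[of n] True by (intro mult_left_mono) auto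
        finally have d: "\<bar>\<phi> (t n *\<^sub>R z) - \<phi> z\<bar> \<le> C * M * (t n - 1)" by (simp add: algebra_simps)
        have "(t n)\<^sup>2 * \<phi> (t n *\<^sub>R z) - \<phi> z = ((t n + 1) * \<phi> (t n *\<^sub>R z)) * (t n - 1) + (\<phi> (t n *\<^sub>R z) - \<phi> z)"
          by (simp add: power2_eq_square algebra_simps)
        also have "\<bar>\<dots>\<bar> \<le> \<bar>(t n + 1) * \<phi> (t n *\<^sub>R z)\<bar> * (t n - 1) + C * M * (t n - 1)"
          using d t(1)[of n] abs_triangle_ineq[of "((t n + 1) * \<phi> (t n *\<^sub>R z)) * (t n - 1)" "\<phi> (t n *\<^sub>R z) - \<phi> z"]
          by (simp add: abs_mult)
        also have "\<dots> \<le> 3 * B * (t n - 1) + C * M * (t n - 1)"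
          using t[of n] bd[OF n2(1)] B0 by (intro add_mono mult_right_mono order_refl) (auto simp: abs_mult intro!: mult_mono)
        also have "\<dots> = (3 * B + C * M) * (t n - 1)" by (simp add: algebra_simps)
        finally have "\<bar>((t n)\<^sup>2 * \<phi> (t n *\<^sub>R z) - \<phi> z) / (t n - 1)\<bar> \<le> 3 * B + C * M"
          using t(1)[of n] by (simp add: abs_divide pos_divide_le_eq)
        then have "norm (f n z) \<le> A * (3 * B + C * M)"
          unfolding f_def real_norm_def abs_mult using FA[of z] A0 by (intro mult_mono) auto
        then show ?thesis using True by simp
      qed
    qed
  qed
  have R: "(\<lambda>n. LINT z|lborel. q n z * \<phi> z) \<longlonglongrightarrow> (LINT z|lborel. a * indicator (annulus \<epsilon>) z * \<phi> z)"
  proof (rule integral_dominated_convergence[where w="\<lambda>z. indicator (cball 0 (2 * M)) z * (a * B)"])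
    show "(\<lambda>z. a * indicator (annulus \<epsilon>) z * \<phi> z) \<in> borel_measurable lborel" using m\<phi> by simp
    show "(\<lambda>z. q n z * \<phi> z) \<in> borel_measurable lborel" for n unfolding q_def using mF mFt[of "t n"] m\<phi> by simp
    show "integrable lborel (\<lambda>z::complex. indicator (cball 0 (2 * M)) z * (a * B))"
      using emeasure_lborel_cball_finite[of "0::complex" "2 * M"] by (intro integrable_mult_left) auto
    have sph: "AE z in lborel. z \<notin> sphere (0::complex) r" for r
    proof (rule AE_not_in)
      show "sphere (0::complex) r \<in> null_sets lborel"
        using negligible_sphere[of "0::complex" r] by (simp add: negligible_iff_null_sets null_sets_completion_iff)
    qed
    show "AE z in lborel. (\<lambda>n. q n z * \<phi> z) \<longlonglongrightarrow> a * indicator (annulus \<epsilon>) z * \<phi> z"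
      using sph[of \<epsilon>] sph[of 1]
    proof eventually_elim
      case (elim z)
      then show ?case
        using log_bump_dilate_limit[of t z, OF t(1) tl] by (intro tendsto_mult tendsto_const) (auto simp: q_def F_def)
    qed
    show "AE z in lborel. norm (q n z * \<phi> z) \<le> indicator (cball 0 (2 * M)) z * (a * B)" for n
    proof (rule AE_I2)
      fix z :: complex
      have "ln (t n) \<le> t n - 1" using t(1)[of n] by (intro ln_le_minus_one) auto
      then have "a * ln (t n) \<le> a * (t n - 1)" using a by (rule mult_left_mono)
      then have qa: "\<bar>q n z\<bar> \<le> a"
        using log_bump_dilate[OF t(1)[of n], of z] t(1)[of n]
        by (simp add: q_def F_def abs_divide pos_divide_le_eq)
      show "norm (q n z * \<phi> z) \<le> indicator (cball 0 (2 * M)) z * (a * B)"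
      proof (cases "norm z \<le> 2 * M")
        case True
        then show ?thesis using qa bd[OF True] a by (auto simp: abs_mult intro!: mult_mono)
      next
        case False
        have "q n z * \<phi> z = 0"
        proof (cases "b = 0")
          case True
          have "norm z / t n \<ge> 1" using False M t[of n] by (simp add: field_simps)
          then have "log_bump \<epsilon> a (z /\<^sub>R t n) = 0" using t(1)[of n] by (intro log_bump_outside) (simp add: divide_inverse mult.commute)
          moreover have "log_bump \<epsilon> a z = 0" using False M by (intro log_bump_outside) auto
          ultimately show ?thesis by (simp add: q_def F_def)
        next
          case 2: False
          have "norm z > M" using False M by auto
          then show ?thesis using 2 supp by simp
        qed
        then show ?thesis using False by simp
      qed
    qed
  qed
  \<comment> \<open>Change of variables y = t z in the dilated summand alone.\<close>
  have "(LINT z|lborel. f n z) = (LINT z|lborel. q n z * \<phi> z)" for n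
  proof -
    have t0: "t n \<noteq> 0" using t(1)[of n] by auto
    have bdt: "\<bar>F z * \<phi> (c *\<^sub>R z)\<bar> \<le> A * B" if "norm z \<le> M" "1 \<le> c" "c \<le> 2" for z c
    proof -
      have "norm (c *\<^sub>R z) \<le> 2 * M" using that M mult_mono[of c 2 "norm z" M] by auto
      then show ?thesis using FA[of z] bd[of "c *\<^sub>R z"] A0 by (auto simp: abs_mult intro!: mult_mono)
    qed
    have i: "integrable lborel (\<lambda>z. F z * \<phi> (c *\<^sub>R z))" if c: "1 \<le> c" "c \<le> 2" for c
      by (rule integrable_bounded_support[where M=M and C="A * B"])
         (use mF m\<phi>t[of c] bdt[OF _ c] supp'[OF _ c(1)] in auto)
    have i1: "integrable lborel (\<lambda>z. F z * \<phi> z)" using i[of 1] by simp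
    have it: "integrable lborel (\<lambda>z. F z * \<phi> (t n *\<^sub>R z))" using i[of "t n"] t[of n] by simp
    let ?P = "\<lambda>y. F (y /\<^sub>R t n) * \<phi> y"
    have mP: "?P \<in> borel_measurable borel" using mFt m\<phi> by simp
    have P: "?P (0 + t n *\<^sub>R z) = F z * \<phi> (t n *\<^sub>R z)" for z using t0 by simp
    have iP: "integrable lborel ?P"
      using lborel_affine_integral(2)[OF t0 mP, of 0] it unfolding P by simp
    have eP: "(LINT y|lborel. ?P y) = (t n)\<^sup>2 * (LINT z|lborel. F z * \<phi> (t n *\<^sub>R z))"
      using lborel_affine_integral(1)[OF t0 mP, of 0] unfolding P by simp
    have "(LINT z|lborel. f n z) = (LINT z|lborel. ((t n)\<^sup>2 * (F z * \<phi> (t n *\<^sub>R z)) - F z * \<phi> z) / (t n - 1))"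
      unfolding f_def by (intro Bochner_Integration.integral_cong) (auto simp: algebra_simps diff_divide_distrib)
    also have "\<dots> = ((LINT y|lborel. ?P y) - (LINT z|lborel. F z * \<phi> z)) / (t n - 1)"
      using i1 it by (simp add: eP)
    also have "\<dots> = (LINT z|lborel. (?P z - F z * \<phi> z) / (t n - 1))" using i1 iP by simp
    also have "\<dots> = (LINT z|lborel. q n z * \<phi> z)"
      unfolding q_def by (intro Bochner_Integration.integral_cong) (auto simp: algebra_simps diff_divide_distrib)
    finally show ?thesis .
  qed
  then show "(LINT z|lborel. (b + log_bump \<epsilon> a z) * (2 * \<phi> z + \<phi>' z z)) = (LINT z|lborel. a * indicator (annulus \<epsilon>) z * \<phi> z)"
    using LIMSEQ_unique[OF L] R by (simp add: F_def)
qed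

text \<open>The dilation identity with \<open>\<phi>\<close> equal to 1: twice the integral is
  \<open>a\<close> times the area of the annulus.\<close>

lemma integral_log_bump: "(LINT z|lborel. log_bump \<epsilon> a z) = a * pi * (1 - \<epsilon>\<^sup>2) / 2"
proof -
  have "(LINT z|lborel. (0 + log_bump \<epsilon> a z) * (2 * 1 + 0)) = (LINT z|lborel. a * indicator (annulus \<epsilon>) z * 1)"
    by (rule dilation_identity(1)[where \<phi>="\<lambda>_. 1" and \<phi>'="\<lambda>_ _. 0" and M=1 and C=0 and B=1]) auto
  also have "\<dots> = a * (pi * (1 - \<epsilon>\<^sup>2))"
    using measure_annulus[OF \<epsilon>] by simp
  finally show ?thesis by simp
qed

end

section \<open>The distribution \<open>dl\<close> of the perturbed constant and the value of
  \<open>N_H\<close>\<close>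

lemma linear_complex_components:
  fixes L :: "complex \<Rightarrow> real"
  assumes "linear L" shows "L h = Re h * L 1 + Im h * L \<i>"
proof -
  have "L h = L (Re h *\<^sub>R 1 + Im h *\<^sub>R \<i>)" by (rule arg_cong[where f=L]) (simp add: complex_eq_iff)
  also have "\<dots> = Re h * L 1 + Im h * L \<i>"
    by (simp only: linear_add[OF assms] linear_scale[OF assms] real_scaleR_def)
  finally show ?thesis .
qed

text \<open>Continuous partial derivatives are bounded on a closed ball, and convexity of the ball
  turns this into a Lipschitz bound; these are the regularity hypotheses of
  \<open>dilation_identity\<close>.\<close>

lemma smooth_frechet:
  fixes \<phi> :: "complex \<Rightarrow> real"
  assumes "smooth \<phi>"
  shows "(\<phi> has_derivative frechet_derivative \<phi> (at z)) (at z)"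
    and "\<exists>C. \<forall>x y. norm x \<le> R \<longrightarrow> norm y \<le> R \<longrightarrow> \<bar>\<phi> x - \<phi> y\<bar> \<le> C * norm (x - y)"
    and "\<exists>B. \<forall>z. norm z \<le> R \<longrightarrow> \<bar>\<phi> z\<bar> \<le> B"
proof -
  have C1: "C_k (Suc 0) \<phi>" using assms smooth_def by blast
  let ?D = "\<lambda>z. frechet_derivative \<phi> (at z)"
  show der: "(\<phi> has_derivative ?D z) (at z)" for z by (rule C_k_SucD(1)[OF C1])
  have cont: "continuous_on UNIV (\<lambda>z. ?D z 1)" "continuous_on UNIV (\<lambda>z. ?D z \<i>)"
    using C_k_SucD(2)[OF C1, of 1] C_k_SucD(2)[OF C1, of \<i>] by (auto simp: Basis_complex_def)
  have bdd: "\<exists>B. \<forall>z\<in>cball 0 R. norm (h z) \<le> B" if "continuous_on UNIV h" for h :: "complex \<Rightarrow> real"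
  proof -
    have "bounded (h ` cball 0 R)"
      by (intro compact_imp_bounded compact_continuous_image continuous_on_subset[OF that]) auto
    then show ?thesis by (auto simp: bounded_iff)
  qed
  obtain B1 B2 where B: "\<And>z. z \<in> cball 0 R \<Longrightarrow> norm (?D z 1) \<le> B1" "\<And>z. z \<in> cball 0 R \<Longrightarrow> norm (?D z \<i>) \<le> B2"
    using bdd[OF cont(1)] bdd[OF cont(2)] by metis
  have "\<bar>\<phi> x - \<phi> y\<bar> \<le> (B1 + B2) * norm (x - y)" if "norm x \<le> R" "norm y \<le> R" for x y
  proof -
    have "norm (\<phi> x - \<phi> y) \<le> (B1 + B2) * norm (x - y)"
    proof (rule differentiable_bound[where S="cball 0 R"])
      fix z assume z: "z \<in> cball (0::complex) R"
      show "(\<phi> has_derivative ?D z) (at z within cball 0 R)" using der by (rule has_derivative_at_withinI)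
      show "onorm (?D z) \<le> B1 + B2"
      proof (rule onorm_bound)
        show "0 \<le> B1 + B2" using B[OF z] norm_ge_zero[of "?D z 1"] norm_ge_zero[of "?D z \<i>"] by linarith
        fix h :: complex
        have lin: "linear (?D z)" using der by (rule has_derivative_linear)
        have "?D z h = Re h * ?D z 1 + Im h * ?D z \<i>" by (rule linear_complex_components[OF lin])
        also have "norm \<dots> \<le> \<bar>Re h\<bar> * norm (?D z 1) + \<bar>Im h\<bar> * norm (?D z \<i>)"
          unfolding real_norm_def abs_mult[symmetric] by (rule abs_triangle_ineq)
        also have "\<dots> \<le> norm h * B1 + norm h * B2"
          using B[OF z] by (intro add_mono mult_mono abs_Re_le_cmod abs_Im_le_cmod) auto
        finally show "norm (?D z h) \<le> (B1 + B2) * norm h" by (simp add: algebra_simps)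
      qed
    qed (use that in auto)
    then show ?thesis by simp
  qed
  then show "\<exists>C. \<forall>x y. norm x \<le> R \<longrightarrow> norm y \<le> R \<longrightarrow> \<bar>\<phi> x - \<phi> y\<bar> \<le> C * norm (x - y)" by blast
  show "\<exists>B. \<forall>z. norm z \<le> R \<longrightarrow> \<bar>\<phi> z\<bar> \<le> B"
  proof -
    obtain B where "\<forall>z\<in>cball 0 R. norm (\<phi> z) \<le> B" using bdd[OF smooth_continuous[OF assms]] by blast
    then show ?thesis by (intro exI[of _ B]) auto
  qed
qed

lemma divergence_radial:
  fixes \<phi> :: "complex \<Rightarrow> real"
  assumes "(\<phi> has_derivative \<phi>') (at z)"
  shows "divergence (\<lambda>w. \<phi> w *\<^sub>R w) z = 2 * \<phi> z + \<phi>' z"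
proof -
  have "((\<lambda>w. \<phi> w *\<^sub>R w) has_derivative (\<lambda>h. \<phi> z *\<^sub>R h + \<phi>' h *\<^sub>R z)) (at z)"
    using has_derivative_scaleR[OF assms has_derivative_ident] by simp
  then have fd: "frechet_derivative (\<lambda>w. \<phi> w *\<^sub>R w) (at z) = (\<lambda>h. \<phi> z *\<^sub>R h + \<phi>' h *\<^sub>R z)"
    using frechet_derivative_at by metis
  have lin: "linear \<phi>'" using assms by (rule has_derivative_linear)
  have "\<phi>' z = Re z * \<phi>' 1 + Im z * \<phi>' \<i>" by (rule linear_complex_components[OF lin])
  then show ?thesis by (simp add: divergence_def fd Basis_complex_def)
qed

lemma test_function_bounded_support:
  fixes \<phi> :: "complex \<Rightarrow> real"
  assumes "test_function \<phi>"
  obtains M where "M \<ge> 1" "\<And>z. norm z > M \<Longrightarrow> \<phi> z = 0"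
proof -
  have "bounded {x. \<phi> x \<noteq> 0}"
    by (rule bounded_subset[OF compact_imp_bounded closure_subset]) (use assms in \<open>simp add: test_function_def\<close>)
  then obtain b where b: "\<And>x. \<phi> x \<noteq> 0 \<Longrightarrow> norm x \<le> b" by (auto simp: bounded_iff)
  show ?thesis
  proof (rule that[of "max 1 b"])
    fix z :: complex assume "norm z > max 1 b"
    then show "\<phi> z = 0" using b[of z] by linarith
  qed simp
qed

text \<open>The divergence of \<phi>(z) z is 2 \<phi> plus the radial derivative of \<phi>, so this
  is the dilation identity with \<open>b = 1\<close>; the minus sign is that in
  \<open>dl\<close>.\<close>

lemma dl_log_bump:
  assumes \<epsilon>: "0 < \<epsilon>" "\<epsilon> < 1" and a: "a \<ge> 0"
  shows "dl_represented_by (\<lambda>z. 1 + log_bump \<epsilon> a z) (\<lambda>z. - a * indicator (annulus \<epsilon>) z)"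
  unfolding dl_represented_by_def
proof safe
  have i: "integrable lborel (\<lambda>z. a\<^sup>2 * indicat_real (annulus \<epsilon>) z)"
    using measure_annulus(2)[OF \<epsilon>] by (intro integrable_mult_right) auto
  have eq: "(\<lambda>z. (norm (- a * indicat_real (annulus \<epsilon>) z))\<^sup>2) = (\<lambda>z. a\<^sup>2 * indicat_real (annulus \<epsilon>) z)"
    by (auto simp: indicator_def)
  have m: "(\<lambda>z. - a * indicat_real (annulus \<epsilon>) z) \<in> borel_measurable lborel"
    by (intro borel_measurable_times borel_measurable_const borel_measurable_indicator) simp
  show "square_integrable lebesgue (\<lambda>z. - a * indicat_real (annulus \<epsilon>) z)"
    unfolding square_integrable_def
  proof
    show "(\<lambda>z. - a * indicat_real (annulus \<epsilon>) z) \<in> borel_measurable lebesgue"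
      by (rule measurable_completion[OF m])
    show "integrable lebesgue (\<lambda>z. (norm (- a * indicat_real (annulus \<epsilon>) z))\<^sup>2)"
      unfolding eq using i borel_measurable_integrable[OF i] by (subst integrable_completion)
  qed
  fix \<phi> :: "complex \<Rightarrow> real" assume \<phi>: "test_function \<phi>"
  then have s: "smooth \<phi>" by (simp add: test_function_def)
  obtain M where M: "M \<ge> 1" "\<And>z. norm z > M \<Longrightarrow> \<phi> z = 0" using test_function_bounded_support[OF \<phi>] by blast
  obtain C where C: "\<And>x y. norm x \<le> 2 * M \<Longrightarrow> norm y \<le> 2 * M \<Longrightarrow> \<bar>\<phi> x - \<phi> y\<bar> \<le> C * norm (x - y)"
    using smooth_frechet(2)[OF s, of "2 * M"] by blast
  obtain B where B: "\<And>z. norm z \<le> 2 * M \<Longrightarrow> \<bar>\<phi> z\<bar> \<le> B"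
    using smooth_frechet(3)[OF s, of "2 * M"] by blast
  note di = dilation_identity[OF \<epsilon> a smooth_frechet(1)[OF s] C B M(1), where b=1]
  have d: "(\<lambda>z. (1 + log_bump \<epsilon> a z) * divergence (\<lambda>w. \<phi> w *\<^sub>R w) z)
    = (\<lambda>z. (1 + log_bump \<epsilon> a z) * (2 * \<phi> z + frechet_derivative \<phi> (at z) z))"
    by (rule ext) (simp only: divergence_radial[OF smooth_frechet(1)[OF s]])
  have "(\<lambda>z. (1 + log_bump \<epsilon> a z) * (2 * \<phi> z + frechet_derivative \<phi> (at z) z)) \<in> borel_measurable lborel"
    using di(2) M(2) log_bump_measurable[OF \<epsilon> a] by simp
  then have "dl (\<lambda>z. 1 + log_bump \<epsilon> a z) \<phi> = - (LINT z|lborel. (1 + log_bump \<epsilon> a z) * (2 * \<phi> z + frechet_derivative \<phi> (at z) z))"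
    unfolding dl_def d by (simp add: integral_completion)
  also have "\<dots> = - (LINT z|lborel. a * indicator (annulus \<epsilon>) z * \<phi> z)"
    using di(1) M(2) by simp
  also have "\<dots> = (LINT z|lborel. - a * indicator (annulus \<epsilon>) z * \<phi> z)" by simp
  also have "\<dots> = (LINT z|lebesgue. - a * indicator (annulus \<epsilon>) z * \<phi> z)"
  proof (rule integral_completion[symmetric])
    have "\<phi> \<in> borel_measurable lborel"
      using borel_measurable_continuous_onI[OF smooth_continuous[OF s]] by simp
    then show "(\<lambda>z. - a * indicat_real (annulus \<epsilon>) z * \<phi> z) \<in> borel_measurable lborel"
      using m by (rule_tac borel_measurable_times)
  qed
  finally show "dl (\<lambda>z. 1 + log_bump \<epsilon> a z) \<phi> = (LINT z|lebesgue. - a * indicator (annulus \<epsilon>) z * \<phi> z)" .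
qed

text \<open>A product of one-dimensional cutoffs, so that smoothness and convergence to the
  indicator of the open box reduce to one variable.\<close>

definition box_cutoff :: "nat \<Rightarrow> 'a::euclidean_space \<Rightarrow> 'a \<Rightarrow> 'a \<Rightarrow> real" where
  "box_cutoff m l u x = (\<Prod>b\<in>Basis. cutoff m (x \<bullet> b - l \<bullet> b) * cutoff m (u \<bullet> b - x \<bullet> b))"

lemma box_cutoff:
  shows "x \<notin> box l u \<Longrightarrow> box_cutoff m l u x = 0" "0 \<le> box_cutoff m l u x" "box_cutoff m l u x \<le> 1"
    and "(\<lambda>m. box_cutoff m l u x) \<longlonglongrightarrow> indicator (box l u) x" "test_function (box_cutoff m l u)"
proof -
  show z: "box_cutoff m l u x = 0" if "x \<notin> box l u" for x m
  proof -
    from that obtain b where b: "b \<in> Basis" "x \<bullet> b - l \<bullet> b \<le> 0 \<or> u \<bullet> b - x \<bullet> b \<le> 0"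
      by (auto simp: mem_box not_less)
    then show ?thesis unfolding box_cutoff_def by (intro prod_zero bexI[of _ b]) (auto simp: cutoff_nonpos)
  qed
  show "0 \<le> box_cutoff m l u x" unfolding box_cutoff_def by (intro prod_nonneg mult_nonneg_nonneg cutoff_bounds)
  show "box_cutoff m l u x \<le> 1" unfolding box_cutoff_def
    by (intro prod_le_1) (auto simp: cutoff_bounds intro!: mult_le_one)
  show "(\<lambda>m. box_cutoff m l u x) \<longlonglongrightarrow> indicator (box l u) x"
  proof (cases "x \<in> box l u")
    case True
    have "(\<lambda>m. box_cutoff m l u x) \<longlonglongrightarrow> (\<Prod>b\<in>(Basis::'a set). 1 * 1)"
      unfolding box_cutoff_def
    proof (intro tendsto_prod tendsto_mult)
      fix b :: 'a assume "b \<in> Basis"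
      then have "0 < x \<bullet> b - l \<bullet> b" "0 < u \<bullet> b - x \<bullet> b" using True by (auto simp: mem_box)
      then show "(\<lambda>m. cutoff m (x \<bullet> b - l \<bullet> b)) \<longlonglongrightarrow> 1" "(\<lambda>m. cutoff m (u \<bullet> b - x \<bullet> b)) \<longlonglongrightarrow> 1"
        using cutoff_tendsto[of "x \<bullet> b - l \<bullet> b"] cutoff_tendsto[of "u \<bullet> b - x \<bullet> b"] by auto
    qed
    then show ?thesis using True by simp
  next
    case False
    then show ?thesis using z by simp
  qed
  show "test_function (box_cutoff m l u)"
    unfolding test_function_def
  proof
    show "smooth (box_cutoff m l u)" unfolding box_cutoff_def
      by (intro smooth_prod smooth_mult smooth_cutoff smooth_diff smooth_inner smooth_const) simp
    have "{x. box_cutoff m l u x \<noteq> 0} \<subseteq> cbox l u"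
      using z box_subset_cbox[of l u] by blast
    then show "compact (closure {x. box_cutoff m l u x \<noteq> 0})"
      unfolding compact_closure by (rule bounded_subset[OF bounded_cbox])
  qed
qed

text \<open>\<open>N_H\<close> evaluates an unspecified representing function, so uniqueness is
  needed to compute it. Pairing the difference with box cutoffs and passing to the limit makes its
  integral over every box vanish.\<close>

lemma dl_represented_unique:
  assumes g: "dl_represented_by H g" and h: "dl_represented_by H h"
  shows "AE z in lebesgue. g z = h z"
proof -
  define d where "d = (\<lambda>z. g z - h z)"
  have sq: "square_integrable lebesgue g" "square_integrable lebesgue h"
    using g h by (auto simp: dl_represented_by_def)
  then have mg: "g \<in> borel_measurable lebesgue" "h \<in> borel_measurable lebesgue" by (auto simp: square_integrable_def)
  have loc: "integrable lebesgue (\<lambda>z. indicator (box l u) z * f z)" if "square_integrable lebesgue f" for f :: "complex \<Rightarrow> real" and l u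
  proof (rule Bochner_Integration.integrable_bound)
    have "integrable lborel (\<lambda>z. indicat_real (box l u) z)"
      using emeasure_lborel_box_finite[of l u] by (intro integrable_real_indicator) auto
    then have "integrable lebesgue (\<lambda>z. indicat_real (box l u) z)" by (subst integrable_completion) auto
    then show "integrable lebesgue (\<lambda>z. indicat_real (box l u) z + (norm (f z))\<^sup>2)"
      using that by (auto simp: square_integrable_def)
    show "(\<lambda>z. indicator (box l u) z * f z) \<in> borel_measurable lebesgue"
      using that by (intro borel_measurable_times borel_measurable_indicator) (auto simp: square_integrable_def)
    show "AE z in lebesgue. norm (indicat_real (box l u) z * f z) \<le> norm (indicat_real (box l u) z + (norm (f z))\<^sup>2)"
    proof (rule AE_I2)
      fix z
      have "0 \<le> (\<bar>f z\<bar> - 1)\<^sup>2" by simp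
      then have "2 * \<bar>f z\<bar> \<le> 1 + (f z)\<^sup>2" by (simp add: power2_eq_square algebra_simps)
      then show "norm (indicat_real (box l u) z * f z) \<le> norm (indicat_real (box l u) z + (norm (f z))\<^sup>2)"
        by (auto simp: indicator_def)
    qed
  qed
  have iw: "integrable lebesgue (\<lambda>z. \<phi> z * f z)" if "square_integrable lebesgue f" "\<And>z. z \<notin> box l u \<Longrightarrow> \<phi> z = 0"
    "\<And>z. \<bar>\<phi> z\<bar> \<le> 1" "continuous_on UNIV \<phi>" for f \<phi> :: "complex \<Rightarrow> real" and l u
  proof (rule Bochner_Integration.integrable_bound[OF loc[OF that(1), of l u]])
    have "\<phi> \<in> borel_measurable lebesgue"
      using borel_measurable_continuous_onI[OF that(4)] by (intro measurable_completion) simp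
    then show "(\<lambda>z. \<phi> z * f z) \<in> borel_measurable lebesgue" using that(1) by (auto simp: square_integrable_def)
    show "AE z in lebesgue. norm (\<phi> z * f z) \<le> norm (indicator (box l u) z * f z)"
      using that(2,3) by (intro AE_I2) (auto simp: indicator_def abs_mult mult_left_le_one_le)
  qed
  have box0: "(LINT z|lebesgue. indicator (box l u) z * d z) = 0" for l u
  proof -
    note tf = box_cutoff(5)[of _ l u]
    have c: "continuous_on UNIV (box_cutoff m l u)" for m
      using tf[of m] smooth_continuous by (auto simp: test_function_def)
    have ab: "\<bar>box_cutoff m l u z\<bar> \<le> 1" for m z using box_cutoff(2,3)[of m l u z] by simp
    have "(LINT z|lebesgue. box_cutoff m l u z * d z) = 0" for m
    proof -
      have "(LINT z|lebesgue. g z * box_cutoff m l u z) = (LINT z|lebesgue. h z * box_cutoff m l u z)"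
        using g h tf[of m] by (simp add: dl_represented_by_def)
      moreover have "integrable lebesgue (\<lambda>z. box_cutoff m l u z * g z)" "integrable lebesgue (\<lambda>z. box_cutoff m l u z * h z)"
        by (rule iw[where l=l and u=u]; (rule sq box_cutoff(1) ab c; assumption?))+
      then have "(LINT z|lebesgue. box_cutoff m l u z * d z)
          = (LINT z|lebesgue. box_cutoff m l u z * g z) - (LINT z|lebesgue. box_cutoff m l u z * h z)"
        by (simp add: d_def right_diff_distrib)
      ultimately show ?thesis by (simp add: mult.commute)
    qed
    moreover have "(\<lambda>m. LINT z|lebesgue. box_cutoff m l u z * d z) \<longlonglongrightarrow> (LINT z|lebesgue. indicator (box l u) z * d z)"
    proof (rule integral_dominated_convergence[where w="\<lambda>z. norm (indicator (box l u) z * g z) + norm (indicator (box l u) z * h z)"])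
      show "(\<lambda>z. indicator (box l u) z * d z) \<in> borel_measurable lebesgue"
        unfolding d_def by (intro borel_measurable_times borel_measurable_indicator borel_measurable_diff mg) simp
      show "(\<lambda>z. box_cutoff m l u z * d z) \<in> borel_measurable lebesgue" for m
        unfolding d_def using borel_measurable_continuous_onI[OF c[of m]]
        by (intro borel_measurable_times borel_measurable_diff mg measurable_completion) simp
      show "integrable lebesgue (\<lambda>z. norm (indicator (box l u) z * g z) + norm (indicator (box l u) z * h z))"
        by (intro Bochner_Integration.integrable_add integrable_norm loc sq)
      show "AE z in lebesgue. (\<lambda>m. box_cutoff m l u z * d z) \<longlonglongrightarrow> indicator (box l u) z * d z"
        by (intro AE_I2 tendsto_mult box_cutoff(4) tendsto_const)
      show "AE z in lebesgue. norm (box_cutoff m l u z * d z) \<le> norm (indicator (box l u) z * g z) + norm (indicator (box l u) z * h z)" for m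
      proof (rule AE_I2)
        fix z
        show "norm (box_cutoff m l u z * d z) \<le> norm (indicator (box l u) z * g z) + norm (indicator (box l u) z * h z)"
        proof (cases "z \<in> box l u")
          case True
          have "norm (box_cutoff m l u z * d z) \<le> 1 * \<bar>d z\<bar>" unfolding real_norm_def abs_mult
            by (intro mult_right_mono ab) simp
          then show ?thesis using True abs_triangle_ineq4[of "g z" "h z"] by (simp add: d_def)
        next
          case False
          then show ?thesis using box_cutoff(1)[OF False, of m] by simp
        qed
      qed
    qed
    ultimately show ?thesis by (simp add: LIMSEQ_const_iff)
  qed
  \<comment> \<open>A square integrable function on the plane is only locally integrable, so the
    criterion is applied on growing boxes.\<close>
  let ?A = "\<lambda>n::nat. box (- (real n *\<^sub>R One)) (real n *\<^sub>R One) :: complex set"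
  have "AE z in lebesgue. indicator (?A n) z * d z = 0" for n
  proof (rule AE_lebesgue_zero_if_box_integrals_zero)
    show "integrable lebesgue (\<lambda>z. indicator (?A n) z * d z)"
      using loc[OF sq(1)] loc[OF sq(2)] by (simp add: d_def right_diff_distrib)
    fix l u :: complex
    obtain l' u' where *: "box l u \<inter> ?A n = box l' u'" unfolding box_Int_box by blast
    have "(LINT z:box l u|lebesgue. indicator (?A n) z * d z) = (LINT z|lebesgue. indicator (box l' u') z * d z)"
      unfolding set_lebesgue_integral_def *[symmetric]
      by (intro Bochner_Integration.integral_cong) (auto simp: indicator_def)
    then show "(LINT z:box l u|lebesgue. indicator (?A n) z * d z) = 0" by (simp add: box0)
  qed
  then have "AE z in lebesgue. \<forall>n. indicator (?A n) z * d z = 0" unfolding AE_all_countable by blast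
  then show ?thesis
  proof eventually_elim
    case (elim z)
    have "z \<in> (\<Union>n. ?A n)" unfolding UN_box_eq_UNIV by simp
    then obtain n where "z \<in> ?A n" by blast
    with elim[rule_format, of n] show ?case by (simp add: d_def)
  qed
qed

text \<open>The squared norm is \<open>a\<^sup>2\<close> times the area pi (1 - \<epsilon>^2), and
  the factor 1 / sqrt (4 pi) removes pi and leaves the 1/2.\<close>

lemma N_H_log_bump:
  assumes \<epsilon>: "0 < \<epsilon>" "\<epsilon> < 1" and a: "a \<ge> 0"
  shows "N_H (\<lambda>z. 1 + log_bump \<epsilon> a z) = ereal (a * sqrt (1 - \<epsilon>\<^sup>2) / 2)"
proof -
  let ?H = "\<lambda>z. 1 + log_bump \<epsilon> a z"
  define g where "g = (SOME g. dl_represented_by ?H g)"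
  note r = dl_log_bump[OF assms]
  have g: "dl_represented_by ?H g" unfolding g_def by (rule someI[where P="dl_represented_by ?H", OF r])
  have m: "(\<lambda>z. a\<^sup>2 * indicat_real (annulus \<epsilon>) z) \<in> borel_measurable lborel" by measurable
  have mg: "g \<in> borel_measurable lebesgue" using g by (simp add: dl_represented_by_def square_integrable_def)
  have "(LINT z|lebesgue. (g z)\<^sup>2) = (LINT z|lebesgue. a\<^sup>2 * indicat_real (annulus \<epsilon>) z)"
  proof (rule integral_cong_AE)
    show "AE z in lebesgue. (g z)\<^sup>2 = a\<^sup>2 * indicat_real (annulus \<epsilon>) z"
      using dl_represented_unique[OF g r] by eventually_elim (auto simp: indicator_def)
    show "(\<lambda>z. a\<^sup>2 * indicat_real (annulus \<epsilon>) z) \<in> borel_measurable lebesgue"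
      using m by (rule measurable_completion)
  qed (use mg in simp)
  also have "\<dots> = (LINT z|lborel. a\<^sup>2 * indicat_real (annulus \<epsilon>) z)" using m by (rule integral_completion)
  also have "\<dots> = a\<^sup>2 * (pi * (1 - \<epsilon>\<^sup>2))" using measure_annulus[OF \<epsilon>] by simp
  finally have "N_H ?H = ereal (1 / sqrt (4 * pi) * sqrt (a\<^sup>2 * (pi * (1 - \<epsilon>\<^sup>2))))"
    using r unfolding N_H_def g_def[symmetric] by auto
  also have "1 / sqrt (4 * pi) * sqrt (a\<^sup>2 * (pi * (1 - \<epsilon>\<^sup>2))) = a * sqrt (1 - \<epsilon>\<^sup>2) / 2"
    using a by (simp add: real_sqrt_mult)
  finally show ?thesis .
qed

section \<open>The energy near a multiply covered circle\<close>

lemma weak_deriv_of_C1: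
  assumes u: "\<And>t. (u has_vector_derivative u' t) (at t)" "continuous_on UNIV u'" "periodic u"
  shows "weak_deriv_of u u'"
  unfolding weak_deriv_of_def
proof safe
  show "square_integrable circ u'" by (rule continuous_square_integrable[OF u(2)])
  have cu: "continuous_on UNIV u"
    using has_vector_derivative_continuous[OF u(1)] by (simp add: continuous_on_eq_continuous_at)
  fix \<phi> :: "real \<Rightarrow> real" assume s: "smooth \<phi>" "periodic \<phi>"
  have i: "integrable circ (\<lambda>t. deriv \<phi> t *\<^sub>R u t)" "integrable circ (\<lambda>t. \<phi> t *\<^sub>R u' t)"
    by (rule integrable_circ_continuous_scaleR[OF smooth_DERIV(2)[OF s(1)] integrable_circ_continuous[OF cu]],
        rule integrable_circ_continuous_scaleR[OF smooth_continuous[OF s(1)] integrable_circ_continuous[OF u(2)]])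
  have "((\<lambda>t. \<phi> t *\<^sub>R u' t + deriv \<phi> t *\<^sub>R u t) has_integral \<phi> (2*pi) *\<^sub>R u (2*pi) - \<phi> 0 *\<^sub>R u 0) {0..2*pi}"
  proof (rule fundamental_theorem_of_calculus)
    fix t
    show "((\<lambda>t. \<phi> t *\<^sub>R u t) has_vector_derivative \<phi> t *\<^sub>R u' t + deriv \<phi> t *\<^sub>R u t) (at t within {0..2*pi})"
      by (intro has_vector_derivative_scaleR has_vector_derivative_at_within[OF u(1)]
          DERIV_subset[OF smooth_DERIV(1)[OF s(1)]]) simp
  qed simp
  moreover have "\<phi> (2*pi) = \<phi> 0" "u (2*pi) = u 0"
    using s(2) u(3) unfolding periodic_def by (metis add_0)+
  ultimately have "integral {0..2*pi} (\<lambda>t. \<phi> t *\<^sub>R u' t + deriv \<phi> t *\<^sub>R u t) = 0"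
    by (simp add: integral_unique)
  then have "(LINT t|circ. \<phi> t *\<^sub>R u' t) + (LINT t|circ. deriv \<phi> t *\<^sub>R u t) = 0"
    using lebesgue_integral_eq_integral[OF Bochner_Integration.integrable_add[OF i(2,1)]] i by simp
  then have "(LINT t|circ. deriv \<phi> t *\<^sub>R u t) = - (LINT t|circ. \<phi> t *\<^sub>R u' t)"
    by (simp add: add_eq_0_iff)
  then show "avg (\<lambda>t. deriv \<phi> t *\<^sub>R u t) = - avg (\<lambda>t. \<phi> t *\<^sub>R u' t)" by (simp add: avg_def)
qed

lemma avg_cong_AE:
  fixes f h :: "real \<Rightarrow> 'a::euclidean_space"
  assumes "AE t in circ. f t = h t" "f \<in> borel_measurable circ" "h \<in> borel_measurable circ"
  shows "avg f = avg h"
  unfolding avg_def using integral_cong_AE[OF assms(2,3,1)] by simp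

lemma avg_add:
  fixes f h :: "real \<Rightarrow> real"
  shows "integrable circ f \<Longrightarrow> integrable circ h \<Longrightarrow> avg (\<lambda>t. f t + h t) = avg f + avg h"
  by (simp add: avg_def add_divide_distrib)

lemma avg_cmult: "avg (\<lambda>t. c * f t) = c * avg f" for f :: "real \<Rightarrow> real"
  by (simp add: avg_def)

lemma avg_const: "avg (\<lambda>t. c) = c" for c :: real
  unfolding avg_def integral_circ_const by simp

text \<open>The phase \<open>d\<close> makes the family closed under differentiation up to the
  factor \<open>k\<close>: a quarter turn is multiplication by the imaginary unit, a half turn is a
  sign.\<close>

definition wave :: "nat \<Rightarrow> real \<Rightarrow> real \<Rightarrow> complex" where
  "wave k d t = cis (real k * t + d)"

lemma wave_deriv: "(wave k d has_vector_derivative real k *\<^sub>R wave k (d + pi/2) t) (at t)"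
proof -
  have "(wave k d has_vector_derivative real k *\<^sub>R (\<i> * wave k d t)) (at t)"
    unfolding wave_def has_vector_derivative_complex_iff
    by (auto intro!: derivative_eq_intros)
  moreover have "\<i> * wave k d t = wave k (d + pi/2) t"
    by (simp add: wave_def cis_mult[symmetric] add.assoc[symmetric])
  ultimately show ?thesis by simp
qed

lemma wave_continuous: "continuous_on UNIV (wave k d)"
  using has_vector_derivative_continuous[OF wave_deriv] by (simp add: continuous_on_eq_continuous_at)

lemma wave_periodic: "periodic (wave k d)"
proof -
  have "cis (real k * (t + 2*pi) + d) = cis (real k * t + d)" for t
  proof -
    have "cis (real k * (t + 2*pi) + d) = cis (real k * t + d) * cis (2 * pi * real k)"
      by (simp add: cis_mult algebra_simps)
    also have "cis (2 * pi * real k) = 1" by (simp add: cis_multiple_2pi)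
    finally show ?thesis by simp
  qed
  then show ?thesis by (simp add: periodic_def wave_def)
qed

lemma wave_weak_deriv: "weak_deriv_of (wave k d) (\<lambda>t. real k *\<^sub>R wave k (d + pi/2) t)"
  by (intro weak_deriv_of_C1 wave_deriv wave_periodic continuous_intros wave_continuous)

lemma wave_H1: "wave k d \<in> H1_per"
  using wave_weak_deriv wave_continuous wave_periodic unfolding H1_per_def by blast

lemma wave_norm [simp]: "norm (wave k d t) = 1" by (simp add: wave_def)

lemma wave_shift: "wave k (d + pi/2) t = \<i> * wave k d t" "wave k (d + pi) t = - wave k d t"
  by (simp_all add: wave_def cis_mult[symmetric] add.assoc[symmetric])

lemma square_integrable_wderiv: "u \<in> H1_per \<Longrightarrow> square_integrable circ (wderiv u)"
  using H1_per_wderiv by (auto simp: weak_deriv_of_def)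

text \<open>The weak derivative is tested against real functions only, so the real and imaginary
  parts of the wave are used as two separate test functions and the results are recombined into
  inner products.\<close>

lemma inner_wave_wderiv:
  assumes \<phi>: "\<phi> \<in> H1_per"
  shows "avg (\<lambda>t. wave k d t \<bullet> wderiv \<phi> t) = - real k * avg (\<lambda>t. wave k (d + pi/2) t \<bullet> \<phi> t)"
proof -
  let ?c = "\<lambda>t. cos (real k * t + d)" and ?s = "\<lambda>t. cos (real k * t + (d - pi/2))"
  note w = H1_per_wderiv[OF \<phi>]
  have c\<phi>: "continuous_on UNIV \<phi>" using \<phi> by (simp add: H1_per_def)
  have sm: "smooth ?c" "smooth ?s" by (rule smooth_cos_affine)+
  \<comment> \<open>The sine is entered as a shifted cosine so that \<open>smooth_cos_affine\<close>
    serves both components.\<close>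
  have s: "?s = (\<lambda>t. sin (real k * t + d))"
    unfolding add_diff_eq by (rule ext) (simp only: cos_diff cos_pi_half sin_pi_half mult_zero_right mult_1_right add_0)
  have per: "periodic ?c" "periodic ?s"
    unfolding s using wave_periodic[of k d] by (auto simp: periodic_def wave_def complex_eq_iff)
  have d: "deriv ?c t = Re (real k *\<^sub>R wave k (d + pi/2) t)" "deriv ?s t = Im (real k *\<^sub>R wave k (d + pi/2) t)" for t
    unfolding s wave_shift(1) by (auto intro!: DERIV_imp_deriv derivative_eq_intros simp: wave_def)
  have i: "integrable circ (\<lambda>t. h t *\<^sub>R wderiv \<phi> t)" if "continuous_on UNIV h" for h
    by (rule integrable_circ_continuous_scaleR[OF that weak_deriv_integrable[OF w]])
  have j: "integrable circ (\<lambda>t. h t *\<^sub>R \<phi> t)" if "continuous_on UNIV h" for h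
    by (rule integrable_circ_continuous_scaleR[OF that integrable_circ_continuous[OF c\<phi>]])
  note i' = i[OF smooth_continuous[OF sm(1)]] i[OF smooth_continuous[OF sm(2)]]
  note j' = j[OF smooth_DERIV(2)[OF sm(1)]] j[OF smooth_DERIV(2)[OF sm(2)]]
  have "(LINT t|circ. wave k d t \<bullet> wderiv \<phi> t) = (LINT t|circ. Re (?c t *\<^sub>R wderiv \<phi> t) + Im (?s t *\<^sub>R wderiv \<phi> t))"
    by (intro Bochner_Integration.integral_cong) (auto simp: fun_cong[OF s] wave_def inner_complex_def)
  also have "\<dots> = Re (LINT t|circ. ?c t *\<^sub>R wderiv \<phi> t) + Im (LINT t|circ. ?s t *\<^sub>R wderiv \<phi> t)"
    by (subst Bochner_Integration.integral_add) (simp_all only: integrable_Re integrable_Im integral_Re integral_Im i')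
  also have "\<dots> = - (Re (LINT t|circ. deriv ?c t *\<^sub>R \<phi> t) + Im (LINT t|circ. deriv ?s t *\<^sub>R \<phi> t))"
    using weak_deriv_test[OF w sm(1) per(1)] weak_deriv_test[OF w sm(2) per(2)] by simp
  also have "Re (LINT t|circ. deriv ?c t *\<^sub>R \<phi> t) + Im (LINT t|circ. deriv ?s t *\<^sub>R \<phi> t)
     = (LINT t|circ. Re (deriv ?c t *\<^sub>R \<phi> t) + Im (deriv ?s t *\<^sub>R \<phi> t))"
    by (subst Bochner_Integration.integral_add) (simp_all only: integrable_Re integrable_Im integral_Re integral_Im j')
  also have "\<dots> = (LINT t|circ. real k * (wave k (d + pi/2) t \<bullet> \<phi> t))"
    unfolding scaleR_complex.sel d inner_complex_def
    by (intro Bochner_Integration.integral_cong) (auto simp: algebra_simps)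
  finally show ?thesis by (simp add: avg_def)
qed

text \<open>Identifies the integrand of \<open>j_fun\<close> with the imaginary part of a
  logarithmic derivative; hence, off the curve, \<open>j_fun\<close> is minus the winding
  number.\<close>

lemma newton_inner: "newton y \<bullet> (\<i> * g) = - Im (g / y)"
proof (cases "y = 0")
  case False
  have "complex_of_real ((norm y)\<^sup>2) = y * cnj y" using complex_norm_square[of y] by simp
  then have "g / y = g * cnj y / (of_real ((norm y)\<^sup>2))" using False by simp
  then have "Im (g / y) = Im (g * cnj y) / (norm y)\<^sup>2" by (simp only: Im_divide_of_real)
  also have "\<dots> = (Im g * Re y - Re g * Im y) / (norm y)\<^sup>2" by simp
  finally show ?thesis by (simp add: inner_complex_def divide_inverse algebra_simps)
qed simp

section \<open>Winding numbers of curves near the circle and far from a point\<close>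

lemma j_fun_eq_Im:
  assumes v: "v \<in> H1_per" and \<kappa>: "\<kappa> > 0" "\<And>t. t \<in> {0..2*pi} \<Longrightarrow> norm (v t - z) \<ge> \<kappa>"
  shows "j_fun v z = - Im (LINT t|circ. wderiv v t / (v t - z)) / (2*pi)"
proof -
  have "continuous_on UNIV (\<lambda>t. v t - z)" using v by (intro continuous_intros) (simp add: H1_per_def)
  then have i: "integrable circ (\<lambda>t. wderiv v t / (v t - z))"
    by (intro integrable_circ_divide[OF weak_deriv_integrable[OF H1_per_wderiv[OF v]] continuous_circ_measurable \<kappa>])
  show ?thesis unfolding j_fun_def avg_def newton_inner using i by simp
qed

text \<open>Here \<open>p\<close> is a smooth curve to which v - z is compared by the Rouche
  principle; closedness of \<open>v\<close> enters as mean zero of its weak derivative.\<close>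

lemma j_fun_eq_winding:
  assumes v: "v \<in> H1_per"
    and p: "\<And>t. (p has_vector_derivative p' t) (at t)" "continuous_on UNIV p'" "p (2*pi) = p 0"
    and \<kappa>: "\<kappa> > 0" "\<And>t. t \<in> {0..2*pi} \<Longrightarrow> norm (v t - z - p t) + \<kappa> \<le> norm (p t)"
  shows "j_fun v z = - Im (LINT t|circ. p' t / p t) / (2*pi)"
proof -
  note w = H1_per_wderiv[OF v]
  have c: "continuous_on UNIV v" using v by (simp add: H1_per_def)
  have "(LINT t|circ. wderiv v t / (v t - z)) = (LINT t|circ. p' t / p t)"
  proof (rule integral_log_deriv_eq[OF weak_deriv_integrable[OF w] weak_deriv_mean_zero[OF w] _ _ p \<kappa>(1)])
    show "v t - z = v 0 - z + integral {0..t} (wderiv v)" if "t \<in> {0..2*pi}" for t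
      using weak_deriv_FTC[OF c w that] by simp
    show "(\<lambda>t. v t - z) \<in> borel_measurable circ"
      by (intro continuous_circ_measurable continuous_intros c)
  qed (rule \<kappa>(2))
  moreover have "norm (v t - z) \<ge> \<kappa>" if "t \<in> {0..2*pi}" for t
    using \<kappa>(2)[OF that] norm_triangle_ineq2[of "p t" "v t - z"] by (simp add: norm_minus_commute)
  ultimately show ?thesis using j_fun_eq_Im[OF v \<kappa>(1)] by simp
qed

lemma j_fun_outside:
  assumes v: "v \<in> H1_per" and M: "\<And>t. norm (v t) \<le> M" "norm z > M"
  shows "j_fun v z = 0"
proof -
  \<comment> \<open>The comparison curve is the constant \<open>- z\<close>, which does not
    wind.\<close>
  have "j_fun v z = - Im (LINT t|circ. 0 / (- z)) / (2*pi)"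
  proof (rule j_fun_eq_winding[OF v, where \<kappa>="norm z - M"])
    show "norm (v t - z - - z) + (norm z - M) \<le> norm (- z)" for t using M(1)[of t] by simp
  qed (use M in auto)
  then show ?thesis by simp
qed

text \<open>The curve v - z differs from the wave by at most \<eta> + |z| < 1, so it winds like the
  wave itself; the kernel orients \<open>j_fun\<close> so that counterclockwise turns count
  negatively.\<close>

lemma j_fun_inside:
  assumes v: "v \<in> H1_per" and \<eta>: "\<And>t. norm (v t - wave k 0 t) \<le> \<eta>" "norm z < 1 - \<eta>"
  shows "j_fun v z = - real k"
proof -
  have "j_fun v z = - Im (LINT t|circ. (real k *\<^sub>R wave k (0 + pi/2) t) / wave k 0 t) / (2*pi)"
  proof (rule j_fun_eq_winding[OF v wave_deriv, where \<kappa>="1 - \<eta> - norm z"])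
    show "norm (v t - z - wave k 0 t) + (1 - \<eta> - norm z) \<le> norm (wave k 0 t)" for t
      using norm_triangle_ineq4[of "v t - wave k 0 t" z] \<eta>(1)[of t] by (simp add: algebra_simps)
    show "wave k 0 (2*pi) = wave k 0 0" using wave_periodic[of k 0] unfolding periodic_def by (metis add_0)
  qed (use \<eta> in \<open>auto intro!: continuous_intros wave_continuous\<close>)
  also have "(LINT t|circ. (real k *\<^sub>R wave k (0 + pi/2) t) / wave k 0 t) = (LINT t|circ. real k *\<^sub>R \<i>)"
  proof (rule Bochner_Integration.integral_cong)
    fix t
    have "wave k 0 t \<noteq> 0" using wave_norm[of k 0 t] by (metis norm_zero zero_neq_one)
    then show "(real k *\<^sub>R wave k (0 + pi/2) t) / wave k 0 t = real k *\<^sub>R \<i>"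
      by (simp only: wave_shift) (simp add: scaleR_conv_of_real)
  qed simp
  also have "\<dots> = (2*pi) *\<^sub>R (real k *\<^sub>R \<i>)" by (rule integral_circ_const)
  finally show ?thesis by simp
qed

text \<open>Any radius, here 1, serves for integrability and the exchange of integrals; in the
  estimate \<open>\<rho>\<close> stays free, to be matched to the area of \<open>S\<close>.\<close>

lemma set_integral_j_fun:
  fixes K :: "complex \<Rightarrow> real"
  assumes v: "v \<in> H1_per" and S: "S \<in> sets borel" "emeasure lborel S < \<infinity>"
    and K: "K \<in> borel_measurable borel" "\<And>z. z \<in> S \<Longrightarrow> \<bar>K z\<bar> \<le> c" "c \<ge> 0"
  shows "integrable lborel (\<lambda>z. indicator S z * K z * j_fun v z)"
    and "(LINT z|lborel. indicator S z * K z * j_fun v z) = avg (\<lambda>t. LINT z|lborel. indicator S z * K z * (newton (v t - z) \<bullet> (\<i> * wderiv v t)))"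
    and "\<rho> > 0 \<Longrightarrow> \<bar>LINT z|lborel. indicator S z * K z * j_fun v z\<bar> \<le> c * (2 * pi * \<rho> + measure lborel S / \<rho>) * avg (\<lambda>t. norm (wderiv v t))"
proof -
  have c: "continuous_on UNIV v" using v by (simp add: H1_per_def)
  note f = area_fubini[OF c weak_deriv_integrable[OF H1_per_wderiv[OF v]] S(1) _ _ K, folded j_fun_def]
  have b: "2 * pi * \<rho> + measure lborel S / \<rho> \<ge> 0" if "\<rho> > 0" for \<rho> using that by simp
  note n = nn_integral_inverse_dist_le[OF S(1) _ S(2)]
  show "integrable lborel (\<lambda>z. indicator S z * K z * j_fun v z)"
    by (rule f(1)[OF n[of 1] b[of 1]]) simp_all
  show "(LINT z|lborel. indicator S z * K z * j_fun v z) = avg (\<lambda>t. LINT z|lborel. indicator S z * K z * (newton (v t - z) \<bullet> (\<i> * wderiv v t)))"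
    by (rule f(2)[OF n[of 1] b[of 1]]) simp_all
  show "\<bar>LINT z|lborel. indicator S z * K z * j_fun v z\<bar> \<le> c * (2 * pi * \<rho> + measure lborel S / \<rho>) * avg (\<lambda>t. norm (wderiv v t))" if "\<rho> > 0"
    by (rule f(3)[OF n[OF that] b[OF that]])
qed

text \<open>For the constant part, \<open>j_fun\<close> vanishes off a disc containing the curve.
  Exchanging integrals on that disc leaves its Newtonian field at v(t), which is pi v(t) for
  whatever radius, so the area term is an exact quadratic form.\<close>

lemma A_fun_decomp:
  assumes \<epsilon>: "0 < \<epsilon>" "\<epsilon> < 1" and a: "a \<ge> 0" and v: "v \<in> H1_per"
  shows "A_fun (\<lambda>z. 1 + log_bump \<epsilon> a z) v
    = avg (\<lambda>t. v t \<bullet> (\<i> * wderiv v t)) / 2 + (LINT z|lborel. indicator (ball 0 1) z * log_bump \<epsilon> a z * j_fun v z) / (2*pi)"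
proof -
  \<comment> \<open>One more than the sup bound: the curve then lies strictly inside the disc, as
    \<open>ball_potential\<close> asks, and points off the disc are strictly farther out than the
    curve.\<close>
  define M where "M = 1 + (1 + 2*pi) * H1_norm v"
  have M1: "M \<ge> 1" using H1_norm_bounds(1)[of v] by (simp add: M_def)
  have vM: "norm (v t) < M" for t using H1_sup_bound[OF v, of t] by (simp add: M_def)
  let ?j = "j_fun v" and ?G = "log_bump \<epsilon> a"
  have b: "ball 0 r \<in> sets (borel :: complex measure)" "emeasure lborel (ball (0::complex) r) < \<infinity>" for r
    using emeasure_lborel_ball_finite[of "0::complex" r] by auto
  note i1 = set_integral_j_fun[OF v b[of M], of "\<lambda>_. 1" 1]
  have iG: "integrable lborel (\<lambda>z. indicator (ball 0 1) z * ?G z * ?j z)"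
    by (rule set_integral_j_fun(1)[OF v b[of 1] log_bump_measurable[OF \<epsilon> a], of "a * ln (1/\<epsilon>)"])
       (use log_bump_bounds[OF \<epsilon> a] a \<epsilon> in \<open>auto intro!: mult_nonneg_nonneg\<close>)
  have split: "(1 + ?G z) * ?j z = indicator (ball 0 M) z * 1 * ?j z + indicator (ball 0 1) z * ?G z * ?j z" for z
  proof -
    have "?j z = indicator (ball 0 M) z * 1 * ?j z"
    proof (cases "norm z < M")
      case False
      define M' where "M' = (1 + 2*pi) * H1_norm v"
      have "?j z = 0"
        by (rule j_fun_outside[OF v, of M']) (use False H1_sup_bound[OF v] in \<open>auto simp: M'_def M_def\<close>)
      then show ?thesis by simp
    qed simp
    moreover have "?G z = indicator (ball 0 1) z * ?G z"
      using log_bump_outside[OF \<epsilon> a, of z] by (cases "norm z < 1") auto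
    ultimately show ?thesis by (metis (no_types, lifting) distrib_right mult_1)
  qed
  have "(\<lambda>z. (1 + ?G z) * ?j z) \<in> borel_measurable lborel"
    unfolding split using i1(1) iG by (intro borel_measurable_add borel_measurable_integrable) auto
  then have "(LINT z|lebesgue. (1 + ?G z) * ?j z) = (LINT z|lborel. indicator (ball 0 M) z * 1 * ?j z + indicator (ball 0 1) z * ?G z * ?j z)"
    unfolding split by (rule integral_completion)
  also have "\<dots> = (LINT z|lborel. indicator (ball 0 M) z * 1 * ?j z) + (LINT z|lborel. indicator (ball 0 1) z * ?G z * ?j z)"
    using i1(1) iG by (intro Bochner_Integration.integral_add) auto
  also have "(LINT z|lborel. indicator (ball 0 M) z * 1 * ?j z) = avg (\<lambda>t. pi * (v t \<bullet> (\<i> * wderiv v t)))"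
    using i1(2) ball_potential[OF vM] by simp
  finally show ?thesis by (simp add: A_fun_def avg_def add_divide_distrib)
qed

lemma integral_log_bump_ball:
  assumes \<epsilon>: "0 < \<epsilon>" "\<epsilon> < 1" and a: "a \<ge> 0"
  shows "(LINT z|lborel. indicator (ball 0 1) z * log_bump \<epsilon> a z) = a * pi * (1 - \<epsilon>\<^sup>2) / 2"
proof -
  have "(LINT z|lborel. indicator (ball 0 1) z * log_bump \<epsilon> a z) = (LINT z|lborel. log_bump \<epsilon> a z)"
    by (intro Bochner_Integration.integral_cong) (auto simp: indicator_def not_less log_bump_outside[OF \<epsilon> a])
  then show ?thesis using integral_log_bump[OF assms] by simp
qed

text \<open>For \<eta> up to 1/2 one has 1 / (1 - \<eta>) at most 1 + 2 \<eta>, hence - ln (1 -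
  \<eta>) at most 2 \<eta>.\<close>

lemma log_bump_near_boundary:
  assumes \<epsilon>: "0 < \<epsilon>" "\<epsilon> < 1" and a: "a \<ge> 0" and \<eta>: "0 < \<eta>" "\<eta> \<le> 1/2" and z: "1 - \<eta> \<le> norm z"
  shows "\<bar>log_bump \<epsilon> a z\<bar> \<le> 2 * a * \<eta>"
proof -
  have "1 - \<eta> \<le> min 1 (max (norm z) \<epsilon>)" using z \<eta> by auto
  then have "ln (1 - \<eta>) \<le> ln (min 1 (max (norm z) \<epsilon>))" using \<eta> by simp
  moreover have "- 2 * \<eta> \<le> ln (1 - \<eta>)"
  proof -
    have "1 / (1 - \<eta>) \<le> 1 + 2 * \<eta>"
    proof -
      have "\<eta> * (1 - 2 * \<eta>) \<ge> 0" using \<eta> by (intro mult_nonneg_nonneg) auto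
      then have "1 \<le> (1 + 2 * \<eta>) * (1 - \<eta>)" by (simp add: algebra_simps)
      then show ?thesis using \<eta> by (simp add: pos_divide_le_eq)
    qed
    then have "ln (1 / (1 - \<eta>)) \<le> 2 * \<eta>"
      using ln_le_minus_one[of "1 / (1 - \<eta>)"] \<eta> by simp
    then show ?thesis using \<eta> by (simp add: ln_div)
  qed
  ultimately have "- ln (min 1 (max (norm z) \<epsilon>)) \<le> 2 * \<eta>" by linarith
  then have "a * - ln (min 1 (max (norm z) \<epsilon>)) \<le> a * (2 * \<eta>)" using a by (rule mult_left_mono)
  then show ?thesis using log_bump_bounds(1)[OF \<epsilon> a, of z] by (simp add: log_bump_def mult.commute mult.left_commute)
qed

text \<open>Off a thin annulus around the unit circle the winding numbers of \<open>v\<close> are those of the circle; on the annulus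
  the truncated logarithm is itself of the order of the thickness.\<close>

lemma log_bump_area_near_circle:
  assumes \<epsilon>: "0 < \<epsilon>" "\<epsilon> < 1" and a: "a \<ge> 0" and v: "v \<in> H1_per"
    and \<eta>: "0 < \<eta>" "\<eta> \<le> 1/2" "\<And>t. norm (v t - wave k 0 t) \<le> \<eta>"
  shows "\<bar>(LINT z|lborel. indicator (ball 0 1) z * log_bump \<epsilon> a z * j_fun v z) + real k * (a * pi * (1 - \<epsilon>\<^sup>2) / 2)\<bar>
    \<le> 8 * pi * a * \<eta> * sqrt \<eta> * (avg (\<lambda>t. norm (wderiv v t)) + real k)"
proof -
  let ?j = "j_fun v" and ?G = "log_bump \<epsilon> a"
  \<comment> \<open>On \<open>S\<close> the winding number is known exactly; \<open>T\<close> is the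
    rest of the unit disc, of area at most 2 pi \<eta>.\<close>
  define S T where "S = ball (0::complex) (1 - \<eta>)" and "T = ball (0::complex) 1 - ball 0 (1 - \<eta>)"
  have T: "T \<in> sets borel" "emeasure lborel T < \<infinity>" and mT: "measure lborel T \<le> 2 * pi * \<eta>"
  proof -
    show "T \<in> sets borel" by (simp add: T_def)
    have "emeasure lborel T \<le> emeasure lborel (ball (0::complex) 1)" by (intro emeasure_mono) (auto simp: T_def)
    then show "emeasure lborel T < \<infinity>" using emeasure_lborel_ball_finite[of "0::complex" 1]
      by (metis infinity_ennreal_def le_less_trans)
    have "measure lborel T = measure lborel (ball (0::complex) 1) - measure lborel (ball (0::complex) (1 - \<eta>))"
      unfolding T_def using \<eta> emeasure_lborel_ball_finite[of "0::complex" 1] by (intro measure_Diff) (auto simp: subset_eq)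
    also have "\<dots> = pi - pi * (1 - \<eta>)\<^sup>2"
      using \<eta> content_ball[of 1 "0::complex"] content_ball[of "1 - \<eta>" "0::complex"] by (simp add: unit_ball_vol_2)
    also have "\<dots> = pi * (2 * \<eta> - \<eta>\<^sup>2)" by (simp add: power2_eq_square algebra_simps)
    also have "\<dots> \<le> pi * (2 * \<eta>)" by (intro mult_left_mono) auto
    finally show "measure lborel T \<le> 2 * pi * \<eta>" by simp
  qed
  have GT: "\<bar>?G z\<bar> \<le> 2 * a * \<eta>" if "z \<in> T" for z
    using that by (intro log_bump_near_boundary[OF \<epsilon> a \<eta>(1,2)]) (auto simp: T_def)
  have c0: "2 * a * \<eta> \<ge> 0" using a \<eta> by simp
  note mG = log_bump_measurable[OF \<epsilon> a]
  have iT: "integrable lborel (\<lambda>z. indicator T z * ?G z * ?j z)"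
    by (rule set_integral_j_fun(1)[OF v T mG GT c0])
  have iTG: "integrable lborel (\<lambda>z. indicator T z * ?G z)" and iBG: "integrable lborel (\<lambda>z. indicator (ball 0 1) z * ?G z)"
  proof -
    show "integrable lborel (\<lambda>z. indicator T z * ?G z)"
      by (rule integrable_bounded_support[where M=1 and C="a * ln (1/\<epsilon>)"])
         (use mG T(1) log_bump_bounds[OF \<epsilon> a] in \<open>auto simp: indicator_def T_def intro: order_trans\<close>)
    show "integrable lborel (\<lambda>z. indicator (ball 0 1) z * ?G z)"
      by (rule integrable_bounded_support[where M=1 and C="a * ln (1/\<epsilon>)"])
         (use mG log_bump_bounds[OF \<epsilon> a] in \<open>auto simp: indicator_def intro: order_trans\<close>)
  qed
  \<comment> \<open>Replacing \<open>j_fun\<close> by \<open>- real k\<close> on the whole disc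
    costs an error supported on \<open>T\<close> only.\<close>
  have eq: "indicator (ball 0 1) z * ?G z * ?j z
     = indicator T z * ?G z * ?j z + real k * (indicator T z * ?G z) - real k * (indicator (ball 0 1) z * ?G z)" for z
  proof (cases "z \<in> S")
    case True
    then have "?j z = - real k" using j_fun_inside[OF v \<eta>(3), of z] by (simp add: S_def)
    moreover have "z \<in> ball 0 1" "z \<notin> T" using True \<eta> by (auto simp: S_def T_def)
    ultimately show ?thesis by simp
  next
    case False
    then have "indicator T z = (indicator (ball 0 1) z :: real)" by (auto simp: S_def T_def indicator_def)
    then show ?thesis by simp
  qed
  have "(LINT z|lborel. indicator (ball 0 1) z * ?G z * ?j z) + real k * (LINT z|lborel. indicator (ball 0 1) z * ?G z)
     = (LINT z|lborel. indicator T z * ?G z * ?j z) + real k * (LINT z|lborel. indicator T z * ?G z)"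
    unfolding eq using iT iTG iBG by simp
  also have "\<bar>\<dots>\<bar> \<le> (2 * a * \<eta>) * (2 * pi * sqrt \<eta> + measure lborel T / sqrt \<eta>) * avg (\<lambda>t. norm (wderiv v t)) + real k * (2 * a * \<eta> * measure lborel T)"
  proof -
    \<comment> \<open>The radius sqrt \<eta> balances the two terms of the kernel bound, as the area
      of \<open>T\<close> is of order \<eta>; both become of order sqrt \<eta>.\<close>
    have 1: "\<bar>LINT z|lborel. indicator T z * ?G z * ?j z\<bar> \<le> (2 * a * \<eta>) * (2 * pi * sqrt \<eta> + measure lborel T / sqrt \<eta>) * avg (\<lambda>t. norm (wderiv v t))"
      by (rule set_integral_j_fun(3)[OF v T mG GT c0 real_sqrt_gt_zero[OF \<eta>(1)]])
    have "\<bar>LINT z|lborel. indicator T z * ?G z\<bar> \<le> (LINT z|lborel. \<bar>indicator T z * ?G z\<bar>)" by (rule integral_abs_bound)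
    also have "\<dots> \<le> (LINT z|lborel. indicator T z * (2 * a * \<eta>))"
    proof (rule integral_mono)
      show "integrable lborel (\<lambda>z. indicator T z * (2 * a * \<eta>))"
        using T by (intro integrable_mult_left integrable_real_indicator) auto
      show "integrable lborel (\<lambda>z. \<bar>indicator T z * ?G z\<bar>)" using iTG by (rule integrable_abs)
      show "\<bar>indicator T z * ?G z\<bar> \<le> indicator T z * (2 * a * \<eta>)" for z
        using GT[of z] by (cases "z \<in> T") auto
    qed
    also have "\<dots> = 2 * a * \<eta> * measure lborel T" using T by simp
    finally have "\<bar>real k * (LINT z|lborel. indicator T z * ?G z)\<bar> \<le> real k * (2 * a * \<eta> * measure lborel T)"
      unfolding abs_mult by (simp add: mult_left_mono)
    with 1 show ?thesis by linarith
  qed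
  also have "\<dots> \<le> (2 * a * \<eta>) * (4 * pi * sqrt \<eta>) * avg (\<lambda>t. norm (wderiv v t)) + real k * (2 * a * \<eta> * (4 * pi * sqrt \<eta>))"
  proof -
    have "measure lborel T / sqrt \<eta> \<le> 2 * pi * (\<eta> / sqrt \<eta>)" unfolding times_divide_eq_right
      using mT \<eta>(1) by (intro divide_right_mono) auto
    also have "\<eta> / sqrt \<eta> = sqrt \<eta>" using \<eta>(1) by (simp add: real_div_sqrt)
    finally have m1: "2 * pi * sqrt \<eta> + measure lborel T / sqrt \<eta> \<le> 4 * pi * sqrt \<eta>" by simp
    have "\<eta> \<le> sqrt \<eta>" using \<eta> by (intro real_le_rsqrt) (simp add: power2_eq_square mult_left_le)
    then have "2 * pi * \<eta> \<le> 2 * pi * sqrt \<eta>" by simp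
    moreover have "0 \<le> 2 * pi * sqrt \<eta>" using \<eta> by simp
    ultimately have m2: "measure lborel T \<le> 4 * pi * sqrt \<eta>" using mT by linarith
    have "avg (\<lambda>t. norm (wderiv v t)) \<ge> 0" by (simp add: avg_def)
    then show ?thesis using m1 m2 c0 by (intro add_mono mult_right_mono mult_left_mono) auto
  qed
  finally show ?thesis
    unfolding integral_log_bump_ball[OF \<epsilon> a] by (simp add: algebra_simps)
qed

lemma H1_norm_zero_imp: "\<phi> \<in> H1_per \<Longrightarrow> H1_norm \<phi> = 0 \<Longrightarrow> \<phi> t = 0"
  using H1_sup_bound[of \<phi> t] by simp

text \<open>First order expansion of the square root with quadratic remainder. Multiplying by the
  conjugate factor L + k, which is at least k, works for every nonnegative radicand.\<close>

lemma L_fun_near_circle: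
  fixes k N s q :: real
  assumes k: "k \<ge> 1" and N: "0 \<le> N" "N \<le> 1" and s: "\<bar>s\<bar> \<le> N" and q: "0 \<le> q" "q \<le> N\<^sup>2" and X: "k\<^sup>2 + 2 * k\<^sup>2 * s + q \<ge> 0"
  shows "\<bar>sqrt (k\<^sup>2 + 2 * k\<^sup>2 * s + q) - k - k * s\<bar> \<le> (2 * k + 2) * N\<^sup>2"
proof -
  define L where "L = sqrt (k\<^sup>2 + 2 * k\<^sup>2 * s + q)"
  have L: "L \<ge> 0" "L\<^sup>2 = k\<^sup>2 + 2 * k\<^sup>2 * s + q" using X by (auto simp: L_def)
  have id1: "(L - k) * (L + k) = 2 * k\<^sup>2 * s + q" using L(2) by (simp add: power2_eq_square algebra_simps)
  have "\<bar>L - k\<bar> * k \<le> \<bar>L - k\<bar> * (L + k)" using L(1) by (intro mult_left_mono) auto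
  also have "\<dots> = \<bar>2 * k\<^sup>2 * s + q\<bar>" using L(1) k by (simp add: id1[symmetric] abs_mult)
  also have "\<dots> \<le> 2 * k\<^sup>2 * \<bar>s\<bar> + q" using q by (simp add: abs_mult abs_triangle_ineq[THEN order_trans])
  finally have Lk: "\<bar>L - k\<bar> * k \<le> 2 * k\<^sup>2 * \<bar>s\<bar> + q" .
  \<comment> \<open>The linear terms cancel: what remains is \<open>s\<close> times the small
    difference \<open>k - L\<close>, and \<open>q\<close>.\<close>
  have "(L - k - k * s) * (L + k) = k * s * (k - L) + q"
    using id1 by (simp add: power2_eq_square algebra_simps)
  then have "\<bar>L - k - k * s\<bar> * (L + k) = \<bar>k * s * (k - L) + q\<bar>" using L(1) k by (metis abs_mult abs_of_nonneg add_nonneg_nonneg le_numeral_extra(4) order_trans zero_le_one)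
  also have "\<dots> \<le> \<bar>s\<bar> * (\<bar>L - k\<bar> * k) + q"
    using abs_triangle_ineq[of "k * s * (k - L)" q] q k by (simp add: abs_mult abs_minus_commute mult_ac)
  also have "\<dots> \<le> \<bar>s\<bar> * (2 * k\<^sup>2 * \<bar>s\<bar> + q) + q" using Lk by (intro add_right_mono mult_left_mono) auto
  also have "\<dots> \<le> N * (2 * k\<^sup>2 * N + N\<^sup>2) + N\<^sup>2"
    using s q N by (intro add_mono mult_mono mult_left_mono) auto
  also have "\<dots> \<le> (2 * k\<^sup>2 + 2) * N\<^sup>2"
  proof -
    have "N * N\<^sup>2 \<le> 1 * N\<^sup>2" using N by (intro mult_right_mono) auto
    then show ?thesis by (simp add: power2_eq_square algebra_simps)
  qed
  also have "\<dots> \<le> ((2 * k + 2) * N\<^sup>2) * k"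
  proof -
    have "2 * 1 \<le> 2 * k" using k by simp
    then have "2 * k\<^sup>2 + 2 \<le> (2 * k + 2) * k" by (simp add: power2_eq_square algebra_simps)
    from mult_right_mono[OF this, of "N\<^sup>2"] show ?thesis by (simp add: mult_ac)
  qed
  finally have "\<bar>L - k - k * s\<bar> * (L + k) \<le> ((2 * k + 2) * N\<^sup>2) * k" .
  moreover have "\<bar>L - k - k * s\<bar> * k \<le> \<bar>L - k - k * s\<bar> * (L + k)" using L(1) by (intro mult_left_mono) auto
  ultimately have "\<bar>L - k - k * s\<bar> * k \<le> ((2 * k + 2) * N\<^sup>2) * k" by linarith
  then show ?thesis using k by (simp add: L_def mult_le_cancel_right)
qed

lemma avg_norm_wderiv_le: "u \<in> H1_per \<Longrightarrow> avg (\<lambda>t. norm (wderiv u t)) \<le> H1_norm u"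
  using avg_norm_le[OF square_integrable_wderiv, of u] H1_norm_bounds(4)[of u] by linarith

lemma H1_norm_sq: "(H1_norm u)\<^sup>2 = avg (\<lambda>t. (norm (u t))\<^sup>2) + avg (\<lambda>t. (norm (wderiv u t))\<^sup>2)"
  unfolding H1_norm_def by (simp add: avg_def)

lemma wave_wderiv: "AE t in circ. wderiv (wave k d) t = real k *\<^sub>R wave k (d + pi/2) t"
  by (rule weak_deriv_unique[OF H1_per_wderiv[OF wave_H1] wave_weak_deriv])

lemma zero_H1: "(\<lambda>_. 0) \<in> H1_per" "H1_norm (\<lambda>_. 0) = 0"
proof -
  have w: "weak_deriv_of (\<lambda>_. 0) (\<lambda>_. 0)" by (rule weak_deriv_of_C1) (auto simp: periodic_def)
  then show H: "(\<lambda>_. 0) \<in> H1_per" by (auto simp: H1_per_def periodic_def)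
  have m: "wderiv (\<lambda>_. 0) \<in> borel_measurable circ"
    using square_integrable_wderiv[OF H] by (simp add: square_integrable_def)
  have "avg (\<lambda>t. (norm (wderiv (\<lambda>_. 0) t))\<^sup>2) = avg (\<lambda>t. 0::real)"
    by (rule avg_cong_AE) (use weak_deriv_unique[OF H1_per_wderiv[OF H] w] m in auto)
  then show "H1_norm (\<lambda>_. 0) = 0" by (simp add: H1_norm_def avg_def)
qed

text \<open>Energy expansion around the \<open>k\<close>-fold unit circle; \<open>s\<close> is the first variation of the area and of
  the length, which cancel.\<close>

lemma energy_expansion:
  fixes \<phi> :: "real \<Rightarrow> complex" and k :: nat
  defines "v \<equiv> \<lambda>t. wave k 0 t + \<phi> t"
  assumes \<phi>: "\<phi> \<in> H1_per"
  obtains s q r where "\<bar>s\<bar> \<le> H1_norm \<phi>" "0 \<le> q" "q \<le> (H1_norm \<phi>)\<^sup>2" "\<bar>r\<bar> \<le> (H1_norm \<phi>)\<^sup>2"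
    "(real k)\<^sup>2 + 2 * (real k)\<^sup>2 * s + q \<ge> 0"
    "L_fun v = sqrt ((real k)\<^sup>2 + 2 * (real k)\<^sup>2 * s + q)"
    "avg (\<lambda>t. v t \<bullet> (\<i> * wderiv v t)) = - real k - 2 * real k * s + r"
    "avg (\<lambda>t. norm (wderiv v t)) \<le> real k + H1_norm \<phi>"
proof -
  let ?u = "wave k 0" and ?\<phi>' = "wderiv \<phi>"
  \<comment> \<open>All first order terms reduce to \<open>s\<close>; \<open>q\<close> and
    \<open>r\<close> are of second order.\<close>
  define s where "s = avg (\<lambda>t. ?u t \<bullet> \<phi> t)"
  define q where "q = avg (\<lambda>t. (norm (?\<phi>' t))\<^sup>2)"
  define r where "r = avg (\<lambda>t. \<phi> t \<bullet> (\<i> * ?\<phi>' t))"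
  have vH: "v \<in> H1_per" unfolding v_def by (rule H1_per_add(1)[OF wave_H1 \<phi>])
  have c\<phi>: "continuous_on UNIV \<phi>" using \<phi> by (simp add: H1_per_def)
  note sq = square_integrable_wderiv[OF \<phi>] continuous_square_integrable[OF wave_continuous] continuous_square_integrable[OF c\<phi>]
  have sqi: "square_integrable circ (\<lambda>t. \<i> * ?\<phi>' t)"
    using sq(1) by (auto simp: square_integrable_def norm_mult)
  have mv: "wderiv v \<in> borel_measurable circ" "?\<phi>' \<in> borel_measurable circ"
    using square_integrable_wderiv[OF vH] sq(1) by (auto simp: square_integrable_def)
  note mw = continuous_circ_measurable[OF wave_continuous] continuous_circ_measurable[OF c\<phi>]
  have wv: "AE t in circ. wderiv v t = real k *\<^sub>R wave k (pi/2) t + ?\<phi>' t"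
    using H1_per_add(2)[OF wave_H1[of k 0] \<phi>] wave_wderiv[of k 0] unfolding v_def by eventually_elim simp
  \<comment> \<open>Integration by parts advances the phase to pi; that sign cancels the one from
    the integration by parts.\<close>
  have ibp: "avg (\<lambda>t. wave k (pi/2) t \<bullet> ?\<phi>' t) = real k * s"
  proof -
    have "avg (\<lambda>t. wave k (pi/2) t \<bullet> ?\<phi>' t) = - real k * avg (\<lambda>t. wave k (0 + pi) t \<bullet> \<phi> t)"
      using inner_wave_wderiv[OF \<phi>, of k "pi/2"] by simp
    also have "\<dots> = real k * s" unfolding wave_shift(2) by (simp add: s_def avg_def)
    finally show ?thesis .
  qed
  have iw: "integrable circ (\<lambda>t. wave k d t \<bullet> ?\<phi>' t)" "integrable circ (\<lambda>t. wave k d t \<bullet> \<phi> t)" for d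
    by (intro square_integrable_inner sq)+
  have iq: "integrable circ (\<lambda>t. (norm (?\<phi>' t))\<^sup>2)" using sq(1) by (simp add: square_integrable_def)
  have ic: "integrable circ (\<lambda>t. c)" for c :: real by (rule integrable_circ_continuous) (rule continuous_on_const)
  have Lsq: "avg (\<lambda>t. (norm (wderiv v t))\<^sup>2) = (real k)\<^sup>2 + 2 * (real k)\<^sup>2 * s + q"
  proof -
    have "avg (\<lambda>t. (norm (wderiv v t))\<^sup>2) = avg (\<lambda>t. (real k)\<^sup>2 + (2 * real k * (wave k (pi/2) t \<bullet> ?\<phi>' t) + (norm (?\<phi>' t))\<^sup>2))"
    proof (rule avg_cong_AE)
      show "AE t in circ. (norm (wderiv v t))\<^sup>2 = (real k)\<^sup>2 + (2 * real k * (wave k (pi/2) t \<bullet> ?\<phi>' t) + (norm (?\<phi>' t))\<^sup>2)"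
        using wv
      proof eventually_elim
        case (elim t)
        have "(norm (wave k (pi/2) t))\<^sup>2 = 1" by simp
        then have "wave k (pi/2) t \<bullet> wave k (pi/2) t = 1" by (simp only: power2_norm_eq_inner)
        then show ?case unfolding elim power2_norm_eq_inner
          by (simp add: inner_add_left inner_add_right inner_commute power2_eq_square)
      qed
      show "(\<lambda>t. (norm (wderiv v t))\<^sup>2) \<in> borel_measurable circ" using mv by simp
      show "(\<lambda>t. (real k)\<^sup>2 + (2 * real k * (wave k (pi/2) t \<bullet> ?\<phi>' t) + (norm (?\<phi>' t))\<^sup>2)) \<in> borel_measurable circ"
        using borel_measurable_integrable[OF iw(1)] mv by simp
    qed
    also have "\<dots> = (real k)\<^sup>2 + (2 * real k * (real k * s) + q)"
      using iw(1) iq ic by (simp add: avg_add avg_cmult avg_const ibp q_def)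
    finally show ?thesis by (simp add: power2_eq_square)
  qed
  have A: "avg (\<lambda>t. v t \<bullet> (\<i> * wderiv v t)) = - real k - 2 * real k * s + r"
  proof -
    have "avg (\<lambda>t. v t \<bullet> (\<i> * wderiv v t))
       = avg (\<lambda>t. - real k + ((- real k) * (?u t \<bullet> \<phi> t) + ((- 1) * (wave k (pi/2) t \<bullet> ?\<phi>' t) + \<phi> t \<bullet> (\<i> * ?\<phi>' t))))"
    proof (rule avg_cong_AE)
      show "AE t in circ. v t \<bullet> (\<i> * wderiv v t) = - real k + ((- real k) * (?u t \<bullet> \<phi> t) + ((- 1) * (wave k (pi/2) t \<bullet> ?\<phi>' t) + \<phi> t \<bullet> (\<i> * ?\<phi>' t)))"
        using wv
      proof eventually_elim
        case (elim t)
        have w1: "wave k (pi/2) t = \<i> * ?u t" using wave_shift(1)[of k 0 t] by simp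
        have "(norm (?u t))\<^sup>2 = 1" by simp
        then have u1: "?u t \<bullet> ?u t = 1" by (simp only: power2_norm_eq_inner)
        have i1: "\<i> * (real k *\<^sub>R (\<i> * ?u t) + ?\<phi>' t) = - (real k *\<^sub>R ?u t) + \<i> * ?\<phi>' t"
          by (simp add: complex_eq_iff)
        have i2: "?u t \<bullet> (\<i> * ?\<phi>' t) = - ((\<i> * ?u t) \<bullet> ?\<phi>' t)" by (simp add: inner_complex_def)
        show ?case unfolding elim unfolding w1 i1 unfolding v_def
          by (simp add: inner_add_left inner_add_right inner_diff_right distrib_left u1 i2 inner_commute[of "\<phi> t" "?u t"])
      qed
      show "(\<lambda>t. v t \<bullet> (\<i> * wderiv v t)) \<in> borel_measurable circ"
        using vH by (intro borel_measurable_inner borel_measurable_times borel_measurable_const mv(1) continuous_circ_measurable)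
          (simp add: H1_per_def)
      show "(\<lambda>t. - real k + ((- real k) * (?u t \<bullet> \<phi> t) + ((- 1) * (wave k (pi/2) t \<bullet> ?\<phi>' t) + \<phi> t \<bullet> (\<i> * ?\<phi>' t)))) \<in> borel_measurable circ"
        using borel_measurable_integrable[OF iw(1)] borel_measurable_integrable[OF iw(2)] borel_measurable_integrable[OF square_integrable_inner[OF sq(3) sqi]]
        by simp
    qed
    also have "\<dots> = - real k + ((- real k) * s + ((- 1) * (real k * s) + r))"
      using iw square_integrable_inner[OF sq(3) sqi] ic
      by (simp only: avg_add avg_cmult avg_const ibp s_def[symmetric] r_def[symmetric]
           integrable_mult_right Bochner_Integration.integrable_add)
    finally show ?thesis by simp
  qed
  have N: "0 \<le> H1_norm \<phi>" by (rule H1_norm_bounds)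
  have s: "\<bar>s\<bar> \<le> H1_norm \<phi>"
  proof -
    have "\<bar>s\<bar> \<le> 1 / (2*pi) * (LINT t|circ. \<bar>?u t \<bullet> \<phi> t\<bar>)"
      unfolding s_def avg_def by (simp add: abs_mult divide_right_mono integral_abs_bound)
    also have "\<dots> \<le> 1 / (2*pi) * (LINT t|circ. norm (\<phi> t))"
    proof (intro mult_left_mono integral_mono)
      fix t show "\<bar>?u t \<bullet> \<phi> t\<bar> \<le> norm (\<phi> t)" using Cauchy_Schwarz_ineq2[of "?u t" "\<phi> t"] by simp
    qed (use iw integrable_circ_continuous[OF c\<phi>] in auto)
    also have "\<dots> = avg (\<lambda>t. norm (\<phi> t))" by (simp add: avg_def)
    also have "\<dots> \<le> H1_norm \<phi>" using avg_norm_le[OF sq(3)] H1_norm_bounds(2)[of \<phi>] by linarith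
    finally show ?thesis .
  qed
  have i\<phi>: "integrable circ (\<lambda>t. (norm (\<phi> t))\<^sup>2)" using sq(3) by (simp add: square_integrable_def)
  have q: "0 \<le> q" "q \<le> (H1_norm \<phi>)\<^sup>2" unfolding H1_norm_sq q_def by (simp_all add: avg_def)
  have r: "\<bar>r\<bar> \<le> (H1_norm \<phi>)\<^sup>2"
  proof -
    have "\<bar>r\<bar> \<le> 1 / (2*pi) * (LINT t|circ. \<bar>\<phi> t \<bullet> (\<i> * ?\<phi>' t)\<bar>)"
      unfolding r_def avg_def by (simp add: abs_mult divide_right_mono integral_abs_bound)
    also have "\<dots> \<le> 1 / (2*pi) * (LINT t|circ. (norm (\<phi> t))\<^sup>2 + (norm (?\<phi>' t))\<^sup>2)"
    proof (intro mult_left_mono integral_mono)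
      fix t
      have "\<bar>\<phi> t \<bullet> (\<i> * ?\<phi>' t)\<bar> \<le> norm (\<phi> t) * norm (?\<phi>' t)"
        using Cauchy_Schwarz_ineq2[of "\<phi> t" "\<i> * ?\<phi>' t"] by (simp add: norm_mult)
      also have "\<dots> \<le> (norm (\<phi> t))\<^sup>2 + (norm (?\<phi>' t))\<^sup>2"
      proof -
        have "0 \<le> norm (\<phi> t) * norm (?\<phi>' t)" by simp
        then show ?thesis using sum_squares_bound[of "norm (\<phi> t)" "norm (?\<phi>' t)"] by linarith
      qed
      finally show "\<bar>\<phi> t \<bullet> (\<i> * ?\<phi>' t)\<bar> \<le> (norm (\<phi> t))\<^sup>2 + (norm (?\<phi>' t))\<^sup>2" .
    qed (use square_integrable_inner[OF sq(3) sqi] i\<phi> iq in auto)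
    also have "\<dots> = (H1_norm \<phi>)\<^sup>2" unfolding H1_norm_sq avg_def using i\<phi> iq by (simp add: add_divide_distrib)
    finally show ?thesis .
  qed
  have "0 \<le> avg (\<lambda>t. (norm (wderiv v t))\<^sup>2)" by (simp add: avg_def)
  moreover have "avg (\<lambda>t. norm (wderiv v t)) \<le> real k + H1_norm \<phi>"
  proof -
    have "avg (\<lambda>t. norm (wderiv v t)) \<le> avg (\<lambda>t. real k + norm (?\<phi>' t))"
      unfolding avg_def real_scaleR_def
    proof (intro mult_left_mono integral_mono_AE)
      show "AE t in circ. norm (wderiv v t) \<le> real k + norm (?\<phi>' t)" using wv
      proof eventually_elim
        case (elim t)
        show ?case unfolding elim using norm_triangle_ineq[of "real k *\<^sub>R wave k (pi/2) t" "?\<phi>' t"] by simp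
      qed
    qed (use square_integrable_circ_integrable[OF square_integrable_wderiv[OF vH]] square_integrable_circ_integrable[OF sq(1)] ic in auto)
    also have "\<dots> = real k + avg (\<lambda>t. norm (?\<phi>' t))"
      using square_integrable_circ_integrable[OF sq(1)] ic by (simp add: avg_add avg_const)
    finally show ?thesis using avg_norm_wderiv_le[OF \<phi>] by linarith
  qed
  ultimately show ?thesis using that[OF s q r _ _ A] Lsq by (simp add: L_fun_def)
qed

text \<open>The energy is k - k/2 - k/2: length, constant part, logarithmic part. The expansion with
  zero perturbation forces s = q = r = 0, and \<open>j_fun_inside\<close> with \<eta> = 0 gives the
  winding number on the whole open disc.\<close>

lemma E_fun_wave:
  assumes \<epsilon>: "0 < \<epsilon>" "\<epsilon> < 1" and k: "k \<ge> 1"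
  shows "E_fun (\<lambda>z. 1 + log_bump \<epsilon> (2 / (1 - \<epsilon>\<^sup>2)) z) (wave k 0) = 0" "L_fun (wave k 0) = real k"
proof -
  define a where "a = 2 / (1 - \<epsilon>\<^sup>2)"
  have e2: "1 - \<epsilon>\<^sup>2 > 0" using \<epsilon> by (simp add: power_less_one_iff)
  have a: "a \<ge> 0" "a * (1 - \<epsilon>\<^sup>2) = 2"
  proof -
    show "a \<ge> 0" using e2 by (simp add: a_def)
    show "a * (1 - \<epsilon>\<^sup>2) = 2" unfolding a_def
      by (rule nonzero_eq_divide_eq[THEN iffD1, OF _ refl]) (use e2 in linarith)
  qed
  obtain s q r where e: "\<bar>s\<bar> \<le> H1_norm (\<lambda>_. 0)" "0 \<le> q" "q \<le> (H1_norm (\<lambda>_. 0))\<^sup>2" "\<bar>r\<bar> \<le> (H1_norm (\<lambda>_. 0))\<^sup>2"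
    "(real k)\<^sup>2 + 2 * (real k)\<^sup>2 * s + q \<ge> 0"
    "L_fun (\<lambda>t. wave k 0 t + 0) = sqrt ((real k)\<^sup>2 + 2 * (real k)\<^sup>2 * s + q)"
    "avg (\<lambda>t. (wave k 0 t + 0) \<bullet> (\<i> * wderiv (\<lambda>t. wave k 0 t + 0) t)) = - real k - 2 * real k * s + r"
    "avg (\<lambda>t. norm (wderiv (\<lambda>t. wave k 0 t + 0) t)) \<le> real k + H1_norm (\<lambda>_. 0)"
    by (rule energy_expansion[OF zero_H1(1), of k])
  have z: "s = 0" "q = 0" "r = 0" using e(1-4) by (auto simp: zero_H1(2))
  show L: "L_fun (wave k 0) = real k" using e(6) by (simp add: z)
  have A: "avg (\<lambda>t. wave k 0 t \<bullet> (\<i> * wderiv (wave k 0) t)) = - real k" using e(7) by (simp add: z)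
  have "(LINT z|lborel. indicator (ball 0 1) z * log_bump \<epsilon> a z * j_fun (wave k 0) z)
     = (LINT z|lborel. - real k * (indicator (ball 0 1) z * log_bump \<epsilon> a z))"
    using j_fun_inside[OF wave_H1, of k 0 k 0]
    by (intro Bochner_Integration.integral_cong) (auto simp: indicator_def)
  also have "\<dots> = - real k * pi"
    unfolding integral_mult_right_zero integral_log_bump_ball[OF \<epsilon> a(1)] using a(2) by simp
  finally show "E_fun (\<lambda>z. 1 + log_bump \<epsilon> (2 / (1 - \<epsilon>\<^sup>2)) z) (wave k 0) = 0"
    unfolding E_fun_def a_def[symmetric] A_fun_decomp[OF \<epsilon> a(1) wave_H1] by (simp add: A L)
qed

text \<open>Length and constant part leave errors of order N^2; the thin annulus contributes order
  N^(3/2), which decides the exponent and is still o(N). The bound of 1/2 on (1 + 2 pi) N makes this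
  number an admissible thickness \<eta>.\<close>

lemma energy_quadratic_bound:
  assumes \<epsilon>: "0 < \<epsilon>" "\<epsilon> < 1" and k: "k \<ge> 1" and \<phi>: "\<phi> \<in> H1_per"
  defines "a \<equiv> 2 / (1 - \<epsilon>\<^sup>2)" and "N \<equiv> H1_norm \<phi>"
  assumes N: "0 < N" "(1 + 2*pi) * N \<le> 1/2"
  shows "\<bar>E_fun (\<lambda>z. 1 + log_bump \<epsilon> a z) (\<lambda>t. wave k 0 t + \<phi> t)\<bar>
    \<le> N * (sqrt N * (2 * real k + 3 + 4 * a * (1 + 2*pi) * sqrt (1 + 2*pi) * (2 * real k + 1)))"
proof -
  let ?v = "\<lambda>t. wave k 0 t + \<phi> t"
  define c where "c = 1 + 2*pi"
  have c1: "c \<ge> 1" by (simp add: c_def)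
  have e2: "1 - \<epsilon>\<^sup>2 > 0" using \<epsilon> by (simp add: power_less_one_iff)
  have a: "a \<ge> 0" "a * (1 - \<epsilon>\<^sup>2) = 2"
  proof -
    show "a \<ge> 0" using e2 by (simp add: a_def)
    show "a * (1 - \<epsilon>\<^sup>2) = 2" unfolding a_def
      by (rule nonzero_eq_divide_eq[THEN iffD1, OF _ refl]) (use e2 in linarith)
  qed
  have cN: "0 < c * N" "c * N \<le> 1/2"
  proof -
    show "0 < c * N" using c1 N(1) by (intro mult_pos_pos) auto
    show "c * N \<le> 1/2" using N(2) by (simp add: c_def)
  qed
  have N1: "N \<le> 1" using cN mult_right_mono[OF c1, of N] N by linarith
  have vH: "?v \<in> H1_per" by (rule H1_per_add(1)[OF wave_H1 \<phi>])
  obtain s q r where e: "\<bar>s\<bar> \<le> N" "0 \<le> q" "q \<le> N\<^sup>2" "\<bar>r\<bar> \<le> N\<^sup>2"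
    "(real k)\<^sup>2 + 2 * (real k)\<^sup>2 * s + q \<ge> 0"
    "L_fun ?v = sqrt ((real k)\<^sup>2 + 2 * (real k)\<^sup>2 * s + q)"
    "avg (\<lambda>t. ?v t \<bullet> (\<i> * wderiv ?v t)) = - real k - 2 * real k * s + r"
    "avg (\<lambda>t. norm (wderiv ?v t)) \<le> real k + N"
    unfolding N_def by (rule energy_expansion[OF \<phi>, of k])
  have L: "\<bar>L_fun ?v - real k - real k * s\<bar> \<le> (2 * real k + 2) * N\<^sup>2"
    unfolding e(6) using k N(1) N1 e by (intro L_fun_near_circle) auto
  let ?I = "LINT z|lborel. indicator (ball 0 1) z * log_bump \<epsilon> a z * j_fun ?v z"
  have nr: "norm (?v t - wave k 0 t) \<le> c * N" for t
    using H1_sup_bound[OF \<phi>, of t] by (simp add: c_def N_def)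
  have "\<bar>?I + real k * (a * pi * (1 - \<epsilon>\<^sup>2) / 2)\<bar> \<le> 8 * pi * a * (c * N) * sqrt (c * N) * (avg (\<lambda>t. norm (wderiv ?v t)) + real k)"
    by (rule log_bump_area_near_circle[OF \<epsilon> a(1) vH cN nr])
  also have "\<dots> \<le> 8 * pi * a * (c * N) * sqrt (c * N) * (2 * real k + 1)"
    using e(8) N1 a(1) cN by (intro mult_left_mono) auto
  also have "a * pi * (1 - \<epsilon>\<^sup>2) / 2 = pi" using a(2) by (simp add: mult.commute mult.left_commute)
  finally have "\<bar>?I + real k * pi\<bar> / (2*pi) \<le> (8 * pi * a * (c * N) * sqrt (c * N) * (2 * real k + 1)) / (2*pi)"
    by (intro divide_right_mono) auto
  also have "\<dots> = N * (sqrt N * (4 * a * c * sqrt c * (2 * real k + 1)))"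
    by (simp add: real_sqrt_mult)
  finally have I: "\<bar>?I / (2*pi) + real k / 2\<bar> \<le> N * (sqrt N * (4 * a * c * sqrt c * (2 * real k + 1)))"
  proof -
    assume *: "\<bar>?I + real k * pi\<bar> / (2*pi) \<le> N * (sqrt N * (4 * a * c * sqrt c * (2 * real k + 1)))"
    have "?I / (2*pi) + real k / 2 = (?I + real k * pi) / (2*pi)" by (simp add: add_divide_distrib)
    then show ?thesis using * by (simp add: abs_divide)
  qed
  \<comment> \<open>The first variation of length is \<open>k * s\<close> and that of half the area
    form is \<open>- k * s\<close>; the grouping shows their cancellation, and the zeroth order
    terms k - k/2 - k/2 cancel as well.\<close>
  have "E_fun (\<lambda>z. 1 + log_bump \<epsilon> a z) ?v = (L_fun ?v - real k - real k * s) + r / 2 + (?I / (2*pi) + real k / 2)"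
    unfolding E_fun_def A_fun_decomp[OF \<epsilon> a(1) vH] e(7) by (simp add: field_simps)
  also have "\<bar>\<dots>\<bar> \<le> (2 * real k + 2) * N\<^sup>2 + N\<^sup>2 + N * (sqrt N * (4 * a * c * sqrt c * (2 * real k + 1)))"
    using L e(4) I by linarith
  also have "(2 * real k + 2) * N\<^sup>2 + N\<^sup>2 \<le> N * (sqrt N * (2 * real k + 3))"
  proof -
    have "N \<le> sqrt N" using N(1) N1 by (intro real_le_rsqrt) (simp add: power2_eq_square mult_left_le)
    then have "N * N * (2 * real k + 3) \<le> N * sqrt N * (2 * real k + 3)" using N by (intro mult_right_mono mult_left_mono) auto
    then show ?thesis by (simp add: power2_eq_square algebra_simps)
  qed
  finally show ?thesis unfolding c_def by (simp add: algebra_simps)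
qed

text \<open>Since the energy at the circle is 0, the bound on the perturbed energy is directly the
  defining estimate for the differential 0.\<close>

lemma wave_critical:
  assumes \<epsilon>: "0 < \<epsilon>" "\<epsilon> < 1" and k: "k \<ge> 1"
  shows "has_H1_differential (E_fun (\<lambda>z. 1 + log_bump \<epsilon> (2 / (1 - \<epsilon>\<^sup>2)) z)) (\<lambda>_. 0) (wave k 0)"
  unfolding has_H1_differential_def
proof safe
  let ?E = "E_fun (\<lambda>z. 1 + log_bump \<epsilon> (2 / (1 - \<epsilon>\<^sup>2)) z)"
  show "H1_dual (\<lambda>_. 0)" unfolding H1_dual_def by (auto intro: exI[of _ 0])
  define a where "a = 2 / (1 - \<epsilon>\<^sup>2)"
  define K where "K = 2 * real k + 3 + 4 * a * (1 + 2*pi) * sqrt (1 + 2*pi) * (2 * real k + 1)"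
  have "1 - \<epsilon>\<^sup>2 > 0" using \<epsilon> by (simp add: power_less_one_iff)
  then have "4 * a * (1 + 2*pi) * sqrt (1 + 2*pi) * (2 * real k + 1) \<ge> 0"
    by (intro mult_nonneg_nonneg) (auto simp: a_def)
  then have K: "K > 0" unfolding K_def by linarith
  fix e :: real assume e: "0 < e"
  \<comment> \<open>The first entry secures the smallness needed for the energy bound, the second
    makes \<open>sqrt (H1_norm \<phi>) * K\<close> at most \<open>e\<close>.\<close>
  define \<eta> where "\<eta> = min (1 / (2 * (1 + 2*pi))) ((e / K)\<^sup>2)"
  have pp: "1 + 2*pi > 0" by (simp add: add_pos_pos)
  have \<eta>: "\<eta> > 0" using e K pp by (auto simp: \<eta>_def)
  show "\<exists>\<eta>>0. \<forall>\<phi>\<in>H1_per. H1_norm \<phi> < \<eta> \<longrightarrow>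
      \<bar>?E (\<lambda>t. wave k 0 t + \<phi> t) - ?E (wave k 0) - 0\<bar>
      \<le> e * H1_norm \<phi>"
  proof (intro exI[of _ \<eta>] conjI ballI impI \<eta>)
    fix \<phi> assume \<phi>: "\<phi> \<in> H1_per" and small: "H1_norm \<phi> < \<eta>"
    show "\<bar>?E (\<lambda>t. wave k 0 t + \<phi> t) - ?E (wave k 0) - 0\<bar>
      \<le> e * H1_norm \<phi>"
    \<comment> \<open>The energy bound is for positive norm; a zero norm forces
      \<open>\<phi>\<close> to vanish everywhere by the sup bound.\<close>
    proof (cases "H1_norm \<phi> = 0")
      case True
      then have "\<phi> t = 0" for t using H1_norm_zero_imp[OF \<phi>] by blast
      then show ?thesis using True by simp
    next
      case False
      then have N: "0 < H1_norm \<phi>" using H1_norm_bounds(1)[of \<phi>] by simp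
      have "H1_norm \<phi> \<le> 1 / (2 * (1 + 2*pi))" using small by (simp add: \<eta>_def)
      then have "(1 + 2*pi) * H1_norm \<phi> \<le> (1 + 2*pi) * (1 / (2 * (1 + 2*pi)))" using pp by (intro mult_left_mono) auto
      also have "\<dots> = 1/2" using pp by simp
      finally have N2: "(1 + 2*pi) * H1_norm \<phi> \<le> 1/2" .
      have "sqrt (H1_norm \<phi>) \<le> e / K"
      proof (rule real_le_lsqrt)
        show "H1_norm \<phi> \<le> (e / K)\<^sup>2" using small by (simp add: \<eta>_def)
      qed (use e K in auto)
      then have "sqrt (H1_norm \<phi>) * K \<le> e" using K by (simp add: pos_le_divide_eq)
      then have "H1_norm \<phi> * (sqrt (H1_norm \<phi>) * K) \<le> H1_norm \<phi> * e" using N by (intro mult_left_mono) auto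
      then show ?thesis
        using energy_quadratic_bound[OF \<epsilon> k \<phi> N N2] E_fun_wave(1)[OF \<epsilon> k]
        unfolding K_def a_def by (simp add: mult.commute)
    qed
  qed
qed

lemma wave_nonconstant:
  assumes "k \<ge> 1" shows "wave k 0 \<in> nonconstant_H1_per"
  unfolding nonconstant_H1_per_def
proof safe
  fix c assume c: "wave k 0 = (\<lambda>_. c)"
  have "wave k 0 0 = 1" by (simp add: wave_def)
  moreover have "wave k 0 (pi / real k) = -1" using assms by (simp add: wave_def)
  ultimately show False using c by (metis one_neq_neg_one)
qed (rule wave_H1)

theorem claim2:
  fixes \<delta> :: real
  assumes "\<delta> > 0"
  shows "\<exists>H :: complex \<Rightarrow> real.
           continuous_on UNIV H \<and>
           1 < N_H H \<and> N_H H < ereal (1 + \<delta>) \<and>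
           (\<lambda>z. H z - 1) \<in> o[at_infinity](\<lambda>z. 1 / norm z) \<and>
           (\<exists>(c :: real) u. palais_smale H c u \<and>
              filterlim (\<lambda>n. L_fun (u n)) at_top sequentially)"
proof -
  \<comment> \<open>\<open>N_H\<close> will equal \<open>1 / \<nu>\<close>, so this choice gives
    \<open>1 + \<delta> / 2\<close>, strictly between the required bounds; \<open>\<epsilon>\<close>
    then follows from \<open>1 - \<epsilon>\<^sup>2 = \<nu>\<^sup>2\<close>.\<close>
  define \<nu> where "\<nu> = 1 / (1 + \<delta> / 2)"
  have \<nu>: "0 < \<nu>" "\<nu> < 1" using assms by (auto simp: \<nu>_def field_simps)
  define \<epsilon> where "\<epsilon> = sqrt (1 - \<nu>\<^sup>2)"
  have \<nu>2: "0 < \<nu>\<^sup>2" "\<nu>\<^sup>2 < 1" using \<nu> by (auto simp: power_less_one_iff)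
  then have \<epsilon>: "0 < \<epsilon>" "\<epsilon> < 1" "1 - \<epsilon>\<^sup>2 = \<nu>\<^sup>2" by (auto simp: \<epsilon>_def)
  define a where "a = 2 / (1 - \<epsilon>\<^sup>2)"
  have a: "a \<ge> 0" using \<nu>2 by (simp add: a_def \<epsilon>(3))
  define H where "H = (\<lambda>z. 1 + log_bump \<epsilon> a z)"
  have "a * sqrt (1 - \<epsilon>\<^sup>2) / 2 = 1 + \<delta> / 2"
  proof -
    have "sqrt (1 - \<epsilon>\<^sup>2) = \<nu>" unfolding \<epsilon>(3) using \<nu> by simp
    then have "a * sqrt (1 - \<epsilon>\<^sup>2) / 2 = 1 / \<nu>"
      unfolding a_def \<epsilon>(3) using \<nu> by (simp add: power2_eq_square)
    then show ?thesis by (simp add: \<nu>_def)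
  qed
  then have N: "N_H H = ereal (1 + \<delta> / 2)" unfolding H_def N_H_log_bump[OF \<epsilon>(1,2) a] by simp
  have "(\<lambda>z. H z - 1) \<in> o[at_infinity](\<lambda>z. 1 / norm z)"
  \<comment> \<open>\<open>H z - 1\<close> is identically 0 for norms at least 1, so any decay rate
    holds.\<close>
  proof (rule landau_o.small.in_cong[THEN iffD2])
    show "eventually (\<lambda>z. H z - 1 = 0) at_infinity"
      unfolding eventually_at_infinity H_def by (auto intro!: exI[of _ 1] log_bump_outside[OF \<epsilon>(1,2) a])
  qed simp
  moreover have "continuous_on UNIV H" unfolding H_def
    by (intro continuous_on_add continuous_on_const log_bump_continuous[OF \<epsilon>(1,2) a])
  \<comment> \<open>The index starts at \<open>Suc 0\<close> because \<open>wave 0 0\<close> is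
    constant.\<close>
  moreover have "palais_smale H 0 (\<lambda>n. wave (Suc n) 0)"
    unfolding palais_smale_def
  proof (intro conjI allI exI)
    show "wave (Suc n) 0 \<in> nonconstant_H1_per" for n by (rule wave_nonconstant) simp
    show "(\<lambda>n. E_fun H (wave (Suc n) 0)) \<longlonglongrightarrow> 0"
      unfolding H_def a_def using E_fun_wave(1)[OF \<epsilon>(1,2)] by simp
    show "has_H1_differential (E_fun H) (\<lambda>_. 0) (wave (Suc n) 0)" for n
      unfolding H_def a_def by (rule wave_critical[OF \<epsilon>(1,2)]) simp
    \<comment> \<open>Nonemptiness makes the supremum of the constant 0 equal to 0; a supremum over
      the empty set of reals would be unspecified.\<close>
    have "{\<phi> \<in> H1_per. H1_norm \<phi> \<le> 1} \<noteq> {}" using zero_H1 by force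
    then show "(\<lambda>n. dual_norm (\<lambda>_. 0)) \<longlonglongrightarrow> 0" by (simp add: dual_norm_def)
  qed
  moreover have "filterlim (\<lambda>n. L_fun (wave (Suc n) 0)) at_top sequentially"
  proof -
    have "L_fun (wave (Suc n) 0) = real (Suc n)" for n by (rule E_fun_wave(2)[OF \<epsilon>(1,2)]) simp
    then show ?thesis
      using filterlim_compose[OF filterlim_real_sequentially filterlim_Suc] by (simp del: of_nat_Suc)
  qed
  ultimately show ?thesis using N assms by (intro exI[of _ H]) auto
qed

end
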